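(* Let $\mathbf u\in[W^3_\infty(\Omega)]^2$ be the exact velocity, with $\mathbf u|_{\partial\Omega}=0$, $\nabla\cdot\mathbf u=0$, and let $\boldsymbol\sigma=\nabla\mathbf u$. Let $\tilde{\boldsymbol\sigma}_h=\Pi^\Sigma_h\boldsymbol\sigma$ and $\tilde{\mathbf u}_h=\Pi^U_h\mathbf u-\boldsymbol\delta_h$. Then $$(\mathbf u\cdot\nabla\mathbf u,\mathbf v_h)-c_h(\tilde{\boldsymbol\sigma}_h,\tilde{\mathbf u}_h,\mathbf v_h)\lesssim h^2\|\mathbf v_h\|_{H^1,h},\qquad\forall\mathbf v_h\in U_{h,0}.$$
   Context: **Mesh.** $\Omega$ is an open rectangle with a (possibly non-uniform) $n_x\times n_y$ Cartesian grid with points $(x_i,y_j)$, $0\le i\le n_x$, $0\le j\le n_y$ ($x_i$, $y_j$ strictly increasing). Write $i^\pm=i\pm\frac12$, $j^\pm=j\pm\frac12$, $x_{i^+}=(x_i+x_{i+1})/2$, $y_{j^+}=(y_j+y_{j+1})/2$, $h^x_{i^+}=x_{i+1}-x_i$, $h^y_{j^+}=y_{j+1}-y_j$, $h=\max\{h^x_{i^+},h^y_{j^+}\}$. Grid regularity: $C_1\le h^y_{j^+}/h^x_{i^+}\le C_2$ for all $i,j$, with positive constants $C_1,C_2$ independent of $h$. Each grid cell $T_{i^+,j^+}=[x_i,x_{i+1}]\times[y_j,y_{j+1}]$ is cut by its diagonal $e_{i^+,j^+}$ from the top-left to the bottom-right corner (length $l_{i^+,j^+}$) into the lower-left triangle $T^-_{i^+,j^+}$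 and the upper-right triangle $T^+_{i^+,j^+}$; $\mathcal T_h$ is the set of all triangles. $e_{i^+,j}$ is the horizontal edge with midpoint $(x_{i^+},y_j)$, $e_{i,j^+}$ the vertical edge with midpoint $(x_i,y_{j^+})$. $\mathcal E^H_h,\mathcal E^V_h,\mathcal E^D_h$ are the sets of horizontal, vertical, diagonal edges; $\mathring{\mathcal E}^H_h,\mathring{\mathcal E}^V_h$ the subsets of edges interior to $\Omega$; $h_e$ is the length of $e$. $T_{i^+,j}=T^-_{i^+,j^+}\cup T^+_{i^+,j^-}$ and $T_{i,j^+}=T^-_{i^+,j^+}\cup T^+_{i^-,j^+}$ (triangles outside $\Omega$ omitted). Unit normals/tangents: $\mathbf n=(0,1)^{\mathsf T},\mathbf t=(1,0)^{\mathsf T}$ on horizontal edges; $\mathbf n=(1,0)^{\mathsf T},\mathbf t=(0,1)^{\mathsf T}$ on vertical edges; $\mathbf n=(n^x,n^y)^{\mathsf T}=(h^y_{j^+},h^x_{i^+})^{\mathsf T}/l_{i^+,j^+}$ on $e_{i^+,j^+}$. Jump $\llbracket\cdot\rrbracket=(\cdot)^--(\cdot)^+$ and average $\{\!\{\cdot\}\!\}=\frac12((\cdot)^-+(\cdot)^+)$, where $(\cdot)^+$ is the trace from the side toward which $\mathbf n$ points and $(\cdot)^-$ the trace from the other side; on boundary edges the trace from outside $\Omega$ is taken as $0$. **Spaces.** With $\mathcal P_0(T)$ the constants on $T$: $\Sigma_h=\{\boldsymbol\tau_h:\boldsymbol\tau_h|_T\in\mathcal P_0(T)^{2\times2}\ \forall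 T\in\mathcal T_h;\ \llbracket\boldsymbol\tau_h\mathbf n\cdot\mathbf t\rrbracket=0$ on each $e\in\mathring{\mathcal E}^H_h\cup\mathring{\mathcal E}^V_h;\ \llbracket\boldsymbol\tau_h\mathbf n\rrbracket=0$ on each $e\in\mathcal E^D_h\}$; $U_h=\{\mathbf v_h:\mathbf v_h|_T\in\mathcal P_0(T)^2\ \forall T\in\mathcal T_h;\ \llbracket\mathbf v_h\cdot\mathbf n\rrbracket=0$ on each $e\in\mathring{\mathcal E}^H_h\cup\mathring{\mathcal E}^V_h\}$; $U_{h,0}=\{\mathbf v_h\in U_h:\mathbf v_h\cdot\mathbf n=0$ on $\partial\Omega\}$. Thus $v^x_h$ is constant on each $T_{i,j^+}$ (value $v^x_{i,j^+}$) and $v^y_h$ is constant on each $T_{i^+,j}$ (value $v^y_{i^+,j}$). Tensors have first row $(\tau^{x,x},\tau^{x,y})$ and second row $(\tau^{y,x},\tau^{y,y})$; $\nabla\mathbf u$ has rows $(\partial_xu^x,\partial_yu^x)$ and $(\partial_xu^y,\partial_yu^y)$. **Interpolation and correction.** $\Pi^\Sigma_h\boldsymbol\sigma\in\Sigma_h$ is determined by $\int_e(\Pi^\Sigma_h\boldsymbol\sigma)\mathbf n\cdot\mathbf t\,ds=\int_e\boldsymbol\sigma\mathbf n\cdot\mathbf t\,ds$ for $e\in\mathcal E^H_h\cup\mathcal E^V_h$ and $\int_e(\Pi^\Sigma_h\boldsymbol\sigma)\mathbf n\,ds=\int_e\boldsymbol\sigma\mathbf n\,ds$ for $e\in\mathcal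 E^D_h$. $\Pi^U_h\mathbf u\in U_h$ is determined by $\int_e(\Pi^U_h\mathbf u)\cdot\mathbf n\,ds=\int_e\mathbf u\cdot\mathbf n\,ds$ for $e\in\mathcal E^H_h\cup\mathcal E^V_h$. $\boldsymbol\delta_h\in U_h$ has values $\delta^x_{i,j^+}=\frac{(h^y_{j^+})^2}{6}\frac{\partial^2u^x}{\partial y^2}(x_i,y_{j^+})$ and $\delta^y_{i^+,j}=\frac{(h^x_{i^+})^2}{6}\frac{\partial^2u^y}{\partial x^2}(x_{i^+},y_j)$. **Discrete convection term and norm.** With $(\cdot,\cdot)$ the $L^2(\Omega)$ inner product, $$c_h(\boldsymbol\sigma_h,\mathbf u_h,\mathbf v_h)=-\sum_{e\in\mathcal E^D_h}\int_en^x\{\!\{u^x_h\}\!\}\llbracket u^x_h\rrbracket\{\!\{v^x_h\}\!\}\,ds+(u^y_h\sigma^{x,y}_h,v^x_h)-\sum_{e\in\mathcal E^D_h}\int_en^y\{\!\{u^y_h\}\!\}\llbracket u^y_h\rrbracket\{\!\{v^y_h\}\!\}\,ds+(u^x_h\sigma^{y,x}_h,v^y_h),$$ $$\|\mathbf v_h\|_{H^1,h}^2=\sum_{e\in\mathcal E^H_h\cup\mathcal E^V_h}h_e^{-1}\|\llbracket\mathbf v_h\cdot\mathbf t\rrbracket\|_{L^2(e)}^2+\sum_{e\in\mathcal E^D_h}h_e^{-1}\|\llbracket\mathbf v_h\rrbracket\|_{L^2(e)}^2.$$ $(\mathbf u\cdot\nabla\mathbf u)$ has components $u^x\partial_xu^x+u^y\partial_yu^x$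 and $u^x\partial_xu^y+u^y\partial_yu^y$. **Convention.** $W^m_\infty(\Omega)$ is the Sobolev space of functions with bounded derivatives up to order $m$. $A\lesssim B$ means $A\le CB$ with a positive constant $C$ independent of $h$ and $\mathbf v_h$ (and of the viscosity), possibly depending on $C_1,C_2$, $\Omega$ and the exact solution $\mathbf u$. *)

theory Defs
  imports "HOL-Analysis.Analysis"
begin

section \<open>Partial derivatives and Sobolev spaces\<close>

text \<open>Partial derivatives relative to a set \<open>S\<close> of points of the plane: two-sided in the interior of
  \<open>S\<close>, one-sided at boundary points when \<open>S\<close> is a closed rectangle.\<close>

definition partial_x :: "(real \<times> real) set \<Rightarrow> (real \<times> real \<Rightarrow> real) \<Rightarrow> real \<times> real \<Rightarrow> real" where
  "partial_x S f p = vector_derivative (\<lambda>s. f (s, snd p)) (at (fst p) within {s. (s, snd p) \<in> S})"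

definition partial_y :: "(real \<times> real) set \<Rightarrow> (real \<times> real \<Rightarrow> real) \<Rightarrow> real \<times> real \<Rightarrow> real" where
  "partial_y S f p = vector_derivative (\<lambda>s. f (fst p, s)) (at (snd p) within {s. (fst p, s) \<in> S})"

definition gradient :: "(real \<times> real) set \<Rightarrow> (real \<times> real \<Rightarrow> real^2) \<Rightarrow> real \<times> real \<Rightarrow> real^2^2" where
  "gradient S u p =
     vector [vector [partial_x S (\<lambda>q. u q $ 1) p, partial_y S (\<lambda>q. u q $ 1) p],
             vector [partial_x S (\<lambda>q. u q $ 2) p, partial_y S (\<lambda>q. u q $ 2) p]]"

definition divergence :: "(real \<times> real) set \<Rightarrow> (real \<times> real \<Rightarrow> real^2) \<Rightarrow> real \<times> real \<Rightarrow> real" where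
  "divergence S u p = partial_x S (\<lambda>q. u q $ 1) p + partial_y S (\<lambda>q. u q $ 2) p"

definition mixed_partial :: "nat \<Rightarrow> nat \<Rightarrow> (real \<times> real \<Rightarrow> real) \<Rightarrow> real \<times> real \<Rightarrow> real" where
  "mixed_partial a b f = (partial_x UNIV ^^ a) ((partial_y UNIV ^^ b) f)"

text \<open>Infinitely differentiable functions with compact support in \<open>\<Omega>\<close>. Total differentiability of all
  the derivatives below makes them continuous, so the order of differentiation is irrelevant.\<close>

definition test_functions :: "(real \<times> real) set \<Rightarrow> (real \<times> real \<Rightarrow> real) set" where
  "test_functions \<Omega> =
     {\<phi>. (\<forall>a b. mixed_partial a b \<phi> differentiable_on UNIV) \<and>
         compact (closure {p. \<phi> p \<noteq> 0}) \<and> closure {p. \<phi> p \<noteq> 0} \<subseteq> \<Omega>}"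

definition essentially_bounded :: "(real \<times> real) set \<Rightarrow> (real \<times> real \<Rightarrow> real) \<Rightarrow> bool" where
  "essentially_bounded \<Omega> f \<longleftrightarrow>
     f \<in> borel_measurable (lebesgue_on \<Omega>) \<and> (\<exists>K. AE p in lebesgue_on \<Omega>. \<bar>f p\<bar> \<le> K)"

definition weak_derivative ::
  "(real \<times> real) set \<Rightarrow> nat \<Rightarrow> nat \<Rightarrow> (real \<times> real \<Rightarrow> real) \<Rightarrow> (real \<times> real \<Rightarrow> real) \<Rightarrow> bool" where
  "weak_derivative \<Omega> a b f g \<longleftrightarrow>
     (\<forall>\<phi>\<in>test_functions \<Omega>.
        (LINT p|lebesgue_on \<Omega>. f p * mixed_partial a b \<phi> p)
          = (-1) ^ (a + b) * (LINT p|lebesgue_on \<Omega>. g p * \<phi> p))"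

definition sobolev_inf :: "nat \<Rightarrow> (real \<times> real) set \<Rightarrow> (real \<times> real \<Rightarrow> real) set" where
  "sobolev_inf m \<Omega> =
     {f. essentially_bounded \<Omega> f \<and>
         (\<forall>a b. a + b \<le> m \<longrightarrow> (\<exists>g. essentially_bounded \<Omega> g \<and> weak_derivative \<Omega> a b f g))}"

definition L2_inner ::
  "(real \<times> real) set \<Rightarrow> (real \<times> real \<Rightarrow> 'a) \<Rightarrow> (real \<times> real \<Rightarrow> 'a::real_inner) \<Rightarrow> real" where
  "L2_inner \<Omega> f g = (LINT p|lebesgue_on \<Omega>. f p \<bullet> g p)"


section \<open>Triangulated Cartesian meshes\<close>

record mesh =
  nx :: nat
  ny :: nat
  xpt :: "nat \<Rightarrow> real"
  ypt :: "nat \<Rightarrow> real"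

definition mesh_domain :: "mesh \<Rightarrow> (real \<times> real) set" where
  "mesh_domain M = {xpt M 0 <..< xpt M (nx M)} \<times> {ypt M 0 <..< ypt M (ny M)}"

definition cartesian_mesh_of :: "(real \<times> real) set \<Rightarrow> mesh \<Rightarrow> bool" where
  "cartesian_mesh_of \<Omega> M \<longleftrightarrow>
     1 \<le> nx M \<and> 1 \<le> ny M \<and>
     strict_mono_on {0..nx M} (xpt M) \<and> strict_mono_on {0..ny M} (ypt M) \<and> mesh_domain M = \<Omega>"

text \<open>Half-integer indices are rounded down: \<open>hx M i\<close> is the width of \<open>[x\<^sub>i, x\<^sub>i\<^sub>+\<^sub>1]\<close>.\<close>

definition hx :: "mesh \<Rightarrow> nat \<Rightarrow> real" where
  "hx M i = xpt M (Suc i) - xpt M i"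

definition hy :: "mesh \<Rightarrow> nat \<Rightarrow> real" where
  "hy M j = ypt M (Suc j) - ypt M j"

definition xmid :: "mesh \<Rightarrow> nat \<Rightarrow> real" where
  "xmid M i = (xpt M i + xpt M (Suc i)) / 2"

definition ymid :: "mesh \<Rightarrow> nat \<Rightarrow> real" where
  "ymid M j = (ypt M j + ypt M (Suc j)) / 2"

definition mesh_size :: "mesh \<Rightarrow> real" where
  "mesh_size M = Max (hx M ` {..<nx M} \<union> hy M ` {..<ny M})"

definition mesh_regular :: "real \<Rightarrow> real \<Rightarrow> mesh \<Rightarrow> bool" where
  "mesh_regular C1 C2 M \<longleftrightarrow>
     (\<forall>i<nx M. \<forall>j<ny M. C1 \<le> hy M j / hx M i \<and> hy M j / hx M i \<le> C2)"

text \<open>\<open>Lower i j\<close> and \<open>Upper i j\<close> are the lower-left and the upper-right triangle of the cell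
  \<open>[x\<^sub>i, x\<^sub>i\<^sub>+\<^sub>1] \<times> [y\<^sub>j, y\<^sub>j\<^sub>+\<^sub>1]\<close>.\<close>

datatype tri = Lower nat nat | Upper nat nat

primrec tri_set :: "mesh \<Rightarrow> tri \<Rightarrow> (real \<times> real) set" where
  "tri_set M (Lower i j) =
     convex hull {(xpt M i, ypt M j), (xpt M (Suc i), ypt M j), (xpt M i, ypt M (Suc j))}"
| "tri_set M (Upper i j) =
     convex hull {(xpt M (Suc i), ypt M (Suc j)), (xpt M (Suc i), ypt M j), (xpt M i, ypt M (Suc j))}"

definition triangles :: "mesh \<Rightarrow> tri set" where
  "triangles M = (\<Union>i<nx M. \<Union>j<ny M. {Lower i j, Upper i j})"

text \<open>\<open>HEdge i j\<close>: from \<open>(x\<^sub>i, y\<^sub>j)\<close> to \<open>(x\<^sub>i\<^sub>+\<^sub>1, y\<^sub>j)\<close>; \<open>VEdge i j\<close>: from \<open>(x\<^sub>i, y\<^sub>j)\<close> to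
  \<open>(x\<^sub>i, y\<^sub>j\<^sub>+\<^sub>1)\<close>; \<open>DEdge i j\<close>: the top-left to bottom-right diagonal of the cell \<open>(i, j)\<close>.\<close>

datatype edge = HEdge nat nat | VEdge nat nat | DEdge nat nat

definition hedges :: "mesh \<Rightarrow> edge set" where
  "hedges M = {HEdge i j | i j. i < nx M \<and> j \<le> ny M}"

definition vedges :: "mesh \<Rightarrow> edge set" where
  "vedges M = {VEdge i j | i j. i \<le> nx M \<and> j < ny M}"

definition dedges :: "mesh \<Rightarrow> edge set" where
  "dedges M = {DEdge i j | i j. i < nx M \<and> j < ny M}"

definition interior_hedges :: "mesh \<Rightarrow> edge set" where
  "interior_hedges M = {HEdge i j | i j. i < nx M \<and> 0 < j \<and> j < ny M}"

definition interior_vedges :: "mesh \<Rightarrow> edge set" where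
  "interior_vedges M = {VEdge i j | i j. 0 < i \<and> i < nx M \<and> j < ny M}"

definition boundary_edges :: "mesh \<Rightarrow> edge set" where
  "boundary_edges M = (hedges M \<union> vedges M) - (interior_hedges M \<union> interior_vedges M)"

primrec edge_start :: "mesh \<Rightarrow> edge \<Rightarrow> real \<times> real" where
  "edge_start M (HEdge i j) = (xpt M i, ypt M j)"
| "edge_start M (VEdge i j) = (xpt M i, ypt M j)"
| "edge_start M (DEdge i j) = (xpt M i, ypt M (Suc j))"

primrec edge_end :: "mesh \<Rightarrow> edge \<Rightarrow> real \<times> real" where
  "edge_end M (HEdge i j) = (xpt M (Suc i), ypt M j)"
| "edge_end M (VEdge i j) = (xpt M i, ypt M (Suc j))"
| "edge_end M (DEdge i j) = (xpt M (Suc i), ypt M j)"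

definition edge_len :: "mesh \<Rightarrow> edge \<Rightarrow> real" where
  "edge_len M e = dist (edge_start M e) (edge_end M e)"

text \<open>Integral over an edge with respect to arc length.\<close>

definition edge_integral :: "mesh \<Rightarrow> edge \<Rightarrow> (real \<times> real \<Rightarrow> 'a) \<Rightarrow> 'a::real_normed_vector" where
  "edge_integral M e f =
     edge_len M e *\<^sub>R integral {0..1} (\<lambda>s. f (linepath (edge_start M e) (edge_end M e) s))"

primrec normal :: "mesh \<Rightarrow> edge \<Rightarrow> real^2" where
  "normal M (HEdge i j) = vector [0, 1]"
| "normal M (VEdge i j) = vector [1, 0]"
| "normal M (DEdge i j) = (1 / edge_len M (DEdge i j)) *\<^sub>R vector [hy M j, hx M i]"

primrec tangent :: "mesh \<Rightarrow> edge \<Rightarrow> real^2" where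
  "tangent M (HEdge i j) = vector [1, 0]"
| "tangent M (VEdge i j) = vector [0, 1]"
| "tangent M (DEdge i j) = (1 / edge_len M (DEdge i j)) *\<^sub>R vector [hx M i, - hy M j]"

text \<open>The triangle on the side toward which the normal points (\<open>tri_plus\<close>) and the one on the other
  side (\<open>tri_minus\<close>); \<open>None\<close> if that side lies outside the domain.\<close>

primrec tri_minus :: "mesh \<Rightarrow> edge \<Rightarrow> tri option" where
  "tri_minus M (HEdge i j) = (if 0 < j then Some (Upper i (j - 1)) else None)"
| "tri_minus M (VEdge i j) = (if 0 < i then Some (Upper (i - 1) j) else None)"
| "tri_minus M (DEdge i j) = Some (Lower i j)"

primrec tri_plus :: "mesh \<Rightarrow> edge \<Rightarrow> tri option" where
  "tri_plus M (HEdge i j) = (if j < ny M then Some (Lower i j) else None)"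
| "tri_plus M (VEdge i j) = (if i < nx M then Some (Lower i j) else None)"
| "tri_plus M (DEdge i j) = Some (Upper i j)"

definition adjacent :: "mesh \<Rightarrow> edge \<Rightarrow> tri set" where
  "adjacent M e = set_option (tri_minus M e) \<union> set_option (tri_plus M e)"


section \<open>Piecewise constant fields\<close>

text \<open>A piecewise constant field is represented by its value on each triangle, extended by \<open>0\<close> to
  labels that do not belong to the mesh so that the representation is unique. \<open>realize M w\<close> is the
  field as a function on the plane (\<open>0\<close> on edges, a null set).\<close>

definition piecewise_constant :: "mesh \<Rightarrow> (tri \<Rightarrow> 'a::zero) set" where
  "piecewise_constant M = {w. \<forall>T. T \<notin> triangles M \<longrightarrow> w T = 0}"

definition realize :: "mesh \<Rightarrow> (tri \<Rightarrow> 'a::real_vector) \<Rightarrow> real \<times> real \<Rightarrow> 'a" where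
  "realize M w p = (\<Sum>T\<in>triangles M. indicat_real (interior (tri_set M T)) p *\<^sub>R w T)"

definition one_sided_trace :: "(tri \<Rightarrow> 'a::zero) \<Rightarrow> tri option \<Rightarrow> 'a" where
  "one_sided_trace w s = (case s of None \<Rightarrow> 0 | Some T \<Rightarrow> w T)"

definition jump :: "mesh \<Rightarrow> (tri \<Rightarrow> 'a::real_vector) \<Rightarrow> edge \<Rightarrow> 'a" where
  "jump M w e = one_sided_trace w (tri_minus M e) - one_sided_trace w (tri_plus M e)"

definition avg :: "mesh \<Rightarrow> (tri \<Rightarrow> 'a::real_vector) \<Rightarrow> edge \<Rightarrow> 'a" where
  "avg M w e = (1 / 2) *\<^sub>R (one_sided_trace w (tri_minus M e) + one_sided_trace w (tri_plus M e))"

definition Sigma_h :: "mesh \<Rightarrow> (tri \<Rightarrow> real^2^2) set" where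
  "Sigma_h M =
     {\<tau> \<in> piecewise_constant M.
        (\<forall>e\<in>interior_hedges M \<union> interior_vedges M.
           jump M (\<lambda>T. (\<tau> T *v normal M e) \<bullet> tangent M e) e = 0) \<and>
        (\<forall>e\<in>dedges M. jump M (\<lambda>T. \<tau> T *v normal M e) e = 0)}"

definition U_h :: "mesh \<Rightarrow> (tri \<Rightarrow> real^2) set" where
  "U_h M =
     {v \<in> piecewise_constant M.
        \<forall>e\<in>interior_hedges M \<union> interior_vedges M. jump M (\<lambda>T. v T \<bullet> normal M e) e = 0}"

definition U_h0 :: "mesh \<Rightarrow> (tri \<Rightarrow> real^2) set" where
  "U_h0 M = {v \<in> U_h M. \<forall>e\<in>boundary_edges M. \<forall>T\<in>adjacent M e. v T \<bullet> normal M e = 0}"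

text \<open>In the edge conditions of both interpolants the integrand on the left is single-valued on
  interior edges, so it may be evaluated from any adjacent triangle.\<close>

definition interp_Sigma :: "mesh \<Rightarrow> (real \<times> real \<Rightarrow> real^2^2) \<Rightarrow> tri \<Rightarrow> real^2^2" where
  "interp_Sigma M \<sigma> =
     (THE \<tau>. \<tau> \<in> Sigma_h M \<and>
        (\<forall>e\<in>hedges M \<union> vedges M. \<forall>T\<in>adjacent M e.
           edge_integral M e (\<lambda>p. (\<tau> T *v normal M e) \<bullet> tangent M e)
             = edge_integral M e (\<lambda>p. (\<sigma> p *v normal M e) \<bullet> tangent M e)) \<and>
        (\<forall>e\<in>dedges M. \<forall>T\<in>adjacent M e.
           edge_integral M e (\<lambda>p. \<tau> T *v normal M e)
             = edge_integral M e (\<lambda>p. \<sigma> p *v normal M e)))"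

definition interp_U :: "mesh \<Rightarrow> (real \<times> real \<Rightarrow> real^2) \<Rightarrow> tri \<Rightarrow> real^2" where
  "interp_U M u =
     (THE w. w \<in> U_h M \<and>
        (\<forall>e\<in>hedges M \<union> vedges M. \<forall>T\<in>adjacent M e.
           edge_integral M e (\<lambda>p. w T \<bullet> normal M e)
             = edge_integral M e (\<lambda>p. u p \<bullet> normal M e)))"

definition delta_x :: "mesh \<Rightarrow> (real \<times> real \<Rightarrow> real^2) \<Rightarrow> nat \<Rightarrow> nat \<Rightarrow> real" where
  "delta_x M u i j =
     (let S = closure (mesh_domain M) in
      (hy M j)\<^sup>2 / 6 * partial_y S (partial_y S (\<lambda>p. u p $ 1)) (xpt M i, ymid M j))"

definition delta_y :: "mesh \<Rightarrow> (real \<times> real \<Rightarrow> real^2) \<Rightarrow> nat \<Rightarrow> nat \<Rightarrow> real" where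
  "delta_y M u i j =
     (let S = closure (mesh_domain M) in
      (hx M i)\<^sup>2 / 6 * partial_x S (partial_x S (\<lambda>p. u p $ 2)) (xmid M i, ypt M j))"

text \<open>The x-component is attached to the vertical edge of a triangle, the y-component to its
  horizontal edge.\<close>

definition delta_h :: "mesh \<Rightarrow> (real \<times> real \<Rightarrow> real^2) \<Rightarrow> tri \<Rightarrow> real^2" where
  "delta_h M u T =
     (if T \<in> triangles M
      then (case T of
              Lower i j \<Rightarrow> vector [delta_x M u i j, delta_y M u i j]
            | Upper i j \<Rightarrow> vector [delta_x M u (Suc i) j, delta_y M u i (Suc j)])
      else 0)"


section \<open>Discrete convection form and discrete norm\<close>

definition c_h :: "mesh \<Rightarrow> (tri \<Rightarrow> real^2^2) \<Rightarrow> (tri \<Rightarrow> real^2) \<Rightarrow> (tri \<Rightarrow> real^2) \<Rightarrow> real" where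
  "c_h M \<sigma> u v =
     - (\<Sum>e\<in>dedges M. edge_integral M e
          (\<lambda>p. normal M e $ 1 * avg M (\<lambda>T. u T $ 1) e * jump M (\<lambda>T. u T $ 1) e
                 * avg M (\<lambda>T. v T $ 1) e))
     + L2_inner (mesh_domain M) (\<lambda>p. realize M u p $ 2 * realize M \<sigma> p $ 1 $ 2)
         (\<lambda>p. realize M v p $ 1)
     - (\<Sum>e\<in>dedges M. edge_integral M e
          (\<lambda>p. normal M e $ 2 * avg M (\<lambda>T. u T $ 2) e * jump M (\<lambda>T. u T $ 2) e
                 * avg M (\<lambda>T. v T $ 2) e))
     + L2_inner (mesh_domain M) (\<lambda>p. realize M u p $ 1 * realize M \<sigma> p $ 2 $ 1)
         (\<lambda>p. realize M v p $ 2)"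

definition H1h_norm :: "mesh \<Rightarrow> (tri \<Rightarrow> real^2) \<Rightarrow> real" where
  "H1h_norm M v = sqrt (
     (\<Sum>e\<in>hedges M \<union> vedges M.
        inverse (edge_len M e) * edge_integral M e (\<lambda>p. (jump M (\<lambda>T. v T \<bullet> tangent M e) e)\<^sup>2))
   + (\<Sum>e\<in>dedges M.
        inverse (edge_len M e) * edge_integral M e (\<lambda>p. (norm (jump M v e))\<^sup>2)))"

end

theory Submission
  imports Defs
begin

text \<open>Cell by cell, \<open>c_h\<close> approximates the convection term only to first order. The total error is
  nevertheless of second order, because each first order contribution is multiplied by a jump of \<open>v\<^sub>h\<close>
  across a diagonal. On a cell the component \<open>v\<^sup>x\<close> has one value \<open>v0\<close> on the lower and one value \<open>v1\<close> on the
  upper triangle, and for arbitrary weights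
  \<open>A0 v0 + A1 v1 = (A0 + A1) (v0 + v1) / 2 + (A1 - A0) (v1 - v0) / 2\<close>.
  In the symmetric part all terms are centred at the midpoint of the cell: the integral of
  \<open>u \<cdot> \<nabla>u\<close> over the whole cell, the difference quotient of \<open>(u\<^sup>x)\<^sup>2 / 2\<close> between the two vertical
  edges (which is what average times jump amounts to), and the mean of the products
  \<open>u\<^sup>y \<sigma>\<^sup>x\<^sup>y\<close> at the two horizontal edges. Reflection at the midpoint cancels the first order terms, so
  that the symmetric weights differ by \<open>O(h\<^sup>2)\<close> times the area. The correction \<open>\<delta>\<^sub>h\<close> is
  \<open>O(h\<^sup>2)\<close> and its increments across a cell are \<open>O(h\<^sup>3)\<close>, so that the difference quotient keeps
  its accuracy. The antisymmetric weights differ by \<open>O(h)\<close> times the area. This is the content of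
  \<open>transport_cell.total_error\<close>.

  The area of a cell is a product of its side lengths, so the Cauchy-Schwarz inequality turns the
  sum of \<open>h\<close> times area times jump into \<open>h\<^sup>2\<close> times the discrete norm. The terms with the values
  of \<open>v\<^sub>h\<close> are reduced to the jumps by summation from the boundary, where the normal component
  vanishes (\<open>discrete_poincare\<close>); both steps use the grid regularity. The second velocity component
  is the same situation with the coordinates exchanged: the reflection in the line \<open>x = y\<close> maps
  lower triangles to lower triangles and diagonals to diagonals.

  All this needs \<open>u\<close> to have Lipschitz continuous second derivatives up to the boundary, whereas
  the hypothesis speaks of weak derivatives. A mollification of \<open>u\<close> on a slightly contracted
  rectangle has derivatives up to order three that are bounded by the weak ones. Bounds on Taylor
  remainders are preserved by pointwise limits, and they force the derivatives of the approximations
  to converge as soon as the approximations do; this gives the second order jet of \<open>u\<close> on the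
  closed rectangle (\<open>sobolev_inf_jet\<close>).\<close>

section \<open>A smooth function with compact support\<close>

text \<open>Dividing by powers of \<open>x\<close> makes the family closed under differentiation, up to linear
  combinations. For \<open>k = 0\<close> it is the standard smooth function that is flat at the origin.\<close>

definition flat :: "nat \<Rightarrow> real \<Rightarrow> real" where
  "flat k x = (if x > 0 then exp (- (1 / x)) / x ^ k else 0)"

text \<open>Only the origin is delicate: there the difference quotient is a power of \<open>1 / h\<close> times
  \<open>exp (- 1 / h)\<close>, and the exponential wins.\<close>

lemma flat_has_derivative:
  "(flat k has_real_derivative flat (k + 2) x - real k * flat (k + 1) x) (at x)"
proof -
  consider "x > 0" | "x < 0" | "x = 0" by linarith
  then show ?thesis
  proof cases
    case 1
    have "((\<lambda>x. exp (- (1 / x)) / x ^ k) has_real_derivative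
            flat (k + 2) x - real k * flat (k + 1) x) (at x)"
      using 1
      apply (auto intro!: derivative_eq_intros simp: flat_def)
      apply (cases k)
       apply (auto simp: field_simps power2_eq_square)
      done
    then show ?thesis
      by (rule has_field_derivative_transform_within_open[of _ _ _ "{0<..}"])
         (use 1 in \<open>auto simp: flat_def\<close>)
  next
    case 2
    have "((\<lambda>x. 0) has_real_derivative flat (k + 2) x - real k * flat (k + 1) x) (at x)"
      using 2 by (auto simp: flat_def)
    then show ?thesis
      by (rule has_field_derivative_transform_within_open[of _ _ _ "{..<0}"])
         (use 2 in \<open>auto simp: flat_def\<close>)
  next
    case 3
    have *: "((\<lambda>h. flat k h / h) \<longlongrightarrow> 0) (at_right 0)"
    proof (rule Lim_transform_eventually)
      have "filterlim (\<lambda>h::real. inverse h) at_top (at_right 0)"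
        by (rule filterlim_inverse_at_top_right)
      from filterlim_compose[OF tendsto_power_div_exp_0[of "Suc k"] this]
      show "((\<lambda>h::real. inverse h ^ Suc k / exp (inverse h)) \<longlongrightarrow> 0) (at_right 0)" .
      show "\<forall>\<^sub>F h in at_right 0. inverse h ^ Suc k / exp (inverse h) = flat k h / h"
        unfolding eventually_at_right_field
        by (intro exI[of _ 1]) (auto simp: flat_def exp_minus field_simps)
    qed
    have **: "((\<lambda>h. flat k h / h) \<longlongrightarrow> 0) (at_left 0)"
    proof (rule Lim_transform_eventually)
      show "((\<lambda>h::real. 0::real) \<longlongrightarrow> 0) (at_left 0)" by simp
      show "\<forall>\<^sub>F h in at_left 0. 0 = flat k h / h"
        unfolding eventually_at_left_field
        by (intro exI[of _ "-1"]) (auto simp: flat_def)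
    qed
    show ?thesis
      using * ** unfolding 3 DERIV_def filterlim_at_split by (simp add: flat_def)
  qed
qed

text \<open>A span that contains the bump function and is closed under differentiation, so that all its members
  are smooth; moreover all of them vanish outside \<open>[-1, 1]\<close>.\<close>

inductive_set bump_span :: "(real \<Rightarrow> real) set" where
  base: "(\<lambda>x. C * flat i (1 + x) * flat j (1 - x)) \<in> bump_span"
| add: "f \<in> bump_span \<Longrightarrow> g \<in> bump_span \<Longrightarrow> (\<lambda>x. f x + g x) \<in> bump_span"

lemma bump_span_derivative:
  assumes "f \<in> bump_span"
  shows "\<exists>f'\<in>bump_span. \<forall>x. (f has_real_derivative f' x) (at x)"
  using assms
proof induction
  case (base C i j)
  have 1: "((\<lambda>x. flat i (1 + x)) has_real_derivative
              flat (i + 2) (1 + x) - real i * flat (i + 1) (1 + x)) (at x)" for x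
    using DERIV_chain2[OF flat_has_derivative[of i "1 + x"] DERIV_add[OF DERIV_const DERIV_ident]]
    by simp
  have 2: "((\<lambda>x. flat j (1 - x)) has_real_derivative
              - (flat (j + 2) (1 - x) - real j * flat (j + 1) (1 - x))) (at x)" for x
    using DERIV_chain2[OF flat_has_derivative[of j "1 - x"] DERIV_diff[OF DERIV_const DERIV_ident]]
    by simp
  let ?f' = "\<lambda>x. ((C * flat (i + 2) (1 + x) * flat j (1 - x)
       + (- C * real i) * flat (i + 1) (1 + x) * flat j (1 - x))
       + ((- C) * flat i (1 + x) * flat (j + 2) (1 - x)
       + (C * real j) * flat i (1 + x) * flat (j + 1) (1 - x)))"
  have "?f' \<in> bump_span"
    by (intro bump_span.intros)
  moreover have "((\<lambda>x. C * flat i (1 + x) * flat j (1 - x)) has_real_derivative ?f' x) (at x)" for x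
    by (rule derivative_eq_intros 1 2 refl)+ (simp add: algebra_simps)
  ultimately show ?case by (intro bexI[of _ ?f'] allI)
next
  case (add f g)
  then obtain f' g' where "f' \<in> bump_span" "g' \<in> bump_span"
    "\<forall>x. (f has_real_derivative f' x) (at x)" "\<forall>x. (g has_real_derivative g' x) (at x)" by blast
  then show ?case
    by (intro bexI[of _ "\<lambda>x. f' x + g' x"]) (auto intro: bump_span.intros DERIV_add)
qed

definition bump :: "nat \<Rightarrow> real \<Rightarrow> real" where
  "bump n = (deriv ^^ n) (\<lambda>x. flat 0 (1 + x) * flat 0 (1 - x))"

lemma bump_in_bump_span: "bump n \<in> bump_span"
proof (induction n)
  case 0
  show ?case using bump_span.base[of 1 0 0] by (simp add: bump_def)
next
  case (Suc n)
  then obtain f' where f': "f' \<in> bump_span" "\<And>x. (bump n has_real_derivative f' x) (at x)"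
    using bump_span_derivative by blast
  then have "deriv (bump n) = f'" by (intro ext DERIV_imp_deriv)
  then show ?case using f' by (simp add: bump_def)
qed

lemma bump_has_derivative: "(bump n has_real_derivative bump (Suc n) x) (at x)"
proof -
  obtain f' where f': "\<And>x. (bump n has_real_derivative f' x) (at x)"
    using bump_span_derivative[OF bump_in_bump_span] by blast
  then have "deriv (bump n) = f'" by (intro ext DERIV_imp_deriv)
  then show ?thesis using f' by (simp add: bump_def)
qed

lemma bump_eq_0: "\<bar>x\<bar> \<ge> 1 \<Longrightarrow> bump n x = 0"
proof -
  have "f x = 0" if "f \<in> bump_span" "\<bar>x\<bar> \<ge> 1" for f x
    using that by induction (auto simp: flat_def abs_if split: if_splits)
  then show "\<bar>x\<bar> \<ge> 1 \<Longrightarrow> bump n x = 0" using bump_in_bump_span by blast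
qed

lemma continuous_on_bump: "continuous_on S (bump n)"
  using bump_has_derivative by (intro DERIV_continuous_on) (blast intro: has_field_derivative_at_within)

lemma bump_nonneg: "bump 0 x \<ge> 0"
  by (simp add: bump_def flat_def)

lemma bump_pos: "\<bar>x\<bar> < 1 \<Longrightarrow> bump 0 x > 0"
  by (simp add: bump_def flat_def)

section \<open>Second order jets as limits of smooth functions\<close>

text \<open>A second order jet with Lipschitz continuous top order, in the sense of Whitney: \<open>D i j\<close> stands for
  the derivative of order \<open>i\<close> in \<open>x\<close> and \<open>j\<close> in \<open>y\<close>. Inequalities for Taylor remainders instead of
  derivatives survive pointwise limits and make sense up to the boundary.\<close>

definition jet :: "real \<Rightarrow> real \<Rightarrow> real \<Rightarrow> real \<Rightarrow> real \<Rightarrow> (nat \<Rightarrow> nat \<Rightarrow> real \<Rightarrow> real \<Rightarrow> real) \<Rightarrow> bool" where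
  "jet K a b c d D \<longleftrightarrow> (\<forall>x\<in>{a..b}. \<forall>y\<in>{c..d}.
     (\<forall>i j. i + j \<le> 2 \<longrightarrow> \<bar>D i j x y\<bar> \<le> K
        \<and> (\<forall>x'\<in>{a..b}. \<bar>D i j x' y - D i j x y\<bar> \<le> K * \<bar>x' - x\<bar>)
        \<and> (\<forall>y'\<in>{c..d}. \<bar>D i j x y' - D i j x y\<bar> \<le> K * \<bar>y' - y\<bar>)) \<and>
     (\<forall>i j. i + j \<le> 1 \<longrightarrow>
          (\<forall>x'\<in>{a..b}. \<bar>D i j x' y - D i j x y - (x' - x) * D (Suc i) j x y\<bar> \<le> K * (x' - x)\<^sup>2)
        \<and> (\<forall>y'\<in>{c..d}. \<bar>D i j x y' - D i j x y - (y' - y) * D i (Suc j) x y\<bar> \<le> K * (y' - y)\<^sup>2)))"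

lemma lipschitz_of_derivative_bound:
  fixes \<alpha> \<beta> :: "real \<Rightarrow> real"
  assumes "\<And>s. (\<alpha> has_real_derivative \<beta> s) (at s)" "\<And>s. s \<in> {a..b} \<Longrightarrow> \<bar>\<beta> s\<bar> \<le> K"
    "x \<in> {a..b}" "x' \<in> {a..b}"
  shows "\<bar>\<alpha> x' - \<alpha> x\<bar> \<le> K * \<bar>x' - x\<bar>"
  using field_differentiable_bound[of "{a..b}" \<alpha> \<beta> K x' x] assms
  by (auto intro: has_field_derivative_at_within)

lemma taylor_of_derivative_bound:
  fixes \<alpha> \<beta> \<gamma> :: "real \<Rightarrow> real"
  assumes \<alpha>: "\<And>s. (\<alpha> has_real_derivative \<beta> s) (at s)" and \<beta>: "\<And>s. (\<beta> has_real_derivative \<gamma> s) (at s)"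
    and \<gamma>: "\<And>s. s \<in> {a..b} \<Longrightarrow> \<bar>\<gamma> s\<bar> \<le> K" and x: "x \<in> {a..b}" "x' \<in> {a..b}"
  shows "\<bar>\<alpha> x' - \<alpha> x - (x' - x) * \<beta> x\<bar> \<le> K * (x' - x)\<^sup>2"
proof -
  have K: "K \<ge> 0" using \<gamma>[OF x(1)] by linarith
  let ?g = "\<lambda>s. \<alpha> s - s * \<beta> x"
  have "norm (?g x' - ?g x) \<le> (K * \<bar>x' - x\<bar>) * norm (x' - x)"
  proof (rule field_differentiable_bound[of "closed_segment x x'" ?g "\<lambda>s. \<beta> s - \<beta> x"])
    show "(?g has_field_derivative \<beta> s - \<beta> x) (at s within closed_segment x x')" for s
      by (rule has_field_derivative_at_within) (auto intro!: derivative_eq_intros \<alpha>)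
    show "norm (\<beta> s - \<beta> x) \<le> K * \<bar>x' - x\<bar>" if "s \<in> closed_segment x x'" for s
    proof -
      have s: "s \<in> {a..b}" "\<bar>s - x\<bar> \<le> \<bar>x' - x\<bar>"
        using that x by (auto simp: closed_segment_eq_real_ivl split: if_splits)
      have "\<bar>\<beta> s - \<beta> x\<bar> \<le> K * \<bar>s - x\<bar>"
        by (rule lipschitz_of_derivative_bound[OF \<beta> \<gamma>]) (use s x in auto)
      also have "\<dots> \<le> K * \<bar>x' - x\<bar>" using s K by (intro mult_left_mono)
      finally show ?thesis by simp
    qed
  qed auto
  moreover have "?g x' - ?g x = \<alpha> x' - \<alpha> x - (x' - x) * \<beta> x" by (simp add: algebra_simps)
  moreover have "(K * \<bar>x' - x\<bar>) * norm (x' - x) = K * (x' - x)\<^sup>2"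
    by (simp add: power2_eq_square)
  ultimately show ?thesis by (simp only: real_norm_def)
qed

text \<open>A uniform Taylor remainder makes \<open>\<beta> n\<close> a difference quotient of \<open>\<alpha> n\<close> up to \<open>K \<bar>x' - x\<bar>\<close>. For a fixed
  point \<open>x'\<close> close to \<open>x\<close> these quotients converge, so \<open>\<beta>\<close> is a Cauchy sequence.\<close>

lemma convergent_of_quotients:
  fixes \<alpha> :: "nat \<Rightarrow> real \<Rightarrow> real" and \<beta> :: "nat \<Rightarrow> real"
  assumes T: "\<And>n x'. x' \<in> {a..b} \<Longrightarrow> \<bar>\<alpha> n x' - \<alpha> n x - (x' - x) * \<beta> n\<bar> \<le> K * (x' - x)\<^sup>2"
    and conv: "\<And>x'. x' \<in> {a..b} \<Longrightarrow> convergent (\<lambda>n. \<alpha> n x')" and x: "x \<in> {a..b}" "a < b"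
  shows "convergent \<beta>"
proof -
  have "Cauchy \<beta>"
  proof (rule metric_CauchyI)
    fix e :: real assume e: "e > 0"
    define K' where "K' = \<bar>K\<bar> + 1"
    \<comment> \<open>the second bound leaves room for a step of length \<open>\<tau>\<close> inside \<open>[a, b]\<close>\<close>
    define \<tau> where "\<tau> = min (e / (4 * K')) ((b - a) / 2)"
    have K': "K' > 0" "K \<le> K'" by (auto simp: K'_def)
    have \<tau>: "\<tau> > 0" "\<tau> \<le> e / (4 * K')" "\<tau> \<le> (b - a) / 2"
      using e x K' unfolding \<tau>_def by (simp_all only: min.cobounded1 min.cobounded2 min_less_iff_conj) simp
    obtain x' where x': "x' \<in> {a..b}" "\<bar>x' - x\<bar> = \<tau>"
    proof (cases "x \<le> (a + b) / 2")
      case True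
      then show ?thesis using that[of "x + \<tau>"] \<tau> x by (auto simp: field_simps)
    next
      case False
      then show ?thesis using that[of "x - \<tau>"] \<tau> x by (auto simp: field_simps)
    qed
    have Cau: "Cauchy (\<lambda>n. \<alpha> n x' - \<alpha> n x)"
      using conv x x' by (intro convergent_Cauchy convergent_diff) auto
    then obtain N where N: "\<And>m n. m \<ge> N \<Longrightarrow> n \<ge> N \<Longrightarrow>
        dist (\<alpha> m x' - \<alpha> m x) (\<alpha> n x' - \<alpha> n x) < \<tau> * (e / 4)"
      using metric_CauchyD[OF Cau, of "\<tau> * (e / 4)"] \<tau>(1) e by auto
    have "dist (\<beta> m) (\<beta> n) < e" if "m \<ge> N" "n \<ge> N" for m n
    proof -
      have 1: "\<bar>\<alpha> k x' - \<alpha> k x - (x' - x) * \<beta> k\<bar> \<le> K' * \<tau> * \<tau>" for k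
      proof -
        have "K * (x' - x)\<^sup>2 \<le> K' * (x' - x)\<^sup>2" using K' by (intro mult_right_mono) auto
        also have "\<dots> = K' * \<tau> * \<tau>" using x'(2) by (metis power2_abs power2_eq_square mult.assoc)
        finally show ?thesis using T[OF x'(1), of k] by linarith
      qed
      have "\<tau> * \<bar>\<beta> m - \<beta> n\<bar> = \<bar>(x' - x) * \<beta> m - (x' - x) * \<beta> n\<bar>"
        using x'(2) by (simp add: abs_mult flip: right_diff_distrib)
      also have "\<dots> < \<tau> * (e / 4) + 2 * (K' * \<tau> * \<tau>)"
        using 1[of m] 1[of n] N[OF that] unfolding dist_real_def by linarith
      also have "\<dots> = \<tau> * (e / 4 + 2 * K' * \<tau>)" by (simp add: algebra_simps)
      also have "\<dots> \<le> \<tau> * (e / 4 + e / 2)"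
        using \<tau>(1,2) K' by (intro mult_left_mono) (auto simp: field_simps)
      finally have "\<bar>\<beta> m - \<beta> n\<bar> < e / 4 + e / 2"
        using \<tau>(1) by simp
      then show ?thesis using e by (simp add: dist_real_def)
    qed
    then show "\<exists>N. \<forall>m\<ge>N. \<forall>n\<ge>N. dist (\<beta> m) (\<beta> n) < e" by blast
  qed
  then show ?thesis by (simp add: Cauchy_convergent_iff)
qed

lemma LIMSEQ_abs_le:
  fixes X :: "nat \<Rightarrow> real"
  assumes "X \<longlonglongrightarrow> L" "\<And>n. \<bar>X n\<bar> \<le> B"
  shows "\<bar>L\<bar> \<le> B"
  by (rule LIMSEQ_le_const2[OF tendsto_rabs[OF assms(1)]]) (use assms(2) in blast)

text \<open>It suffices that the functions themselves converge pointwise: convergence climbs from each order of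
  derivatives to the next, and the inequalities that define a jet hold for the approximations and pass
  to the limit.\<close>

lemma jet_of_smooth_approximations:
  fixes A :: "nat \<Rightarrow> nat \<Rightarrow> nat \<Rightarrow> real \<Rightarrow> real \<Rightarrow> real" and f :: "real \<Rightarrow> real \<Rightarrow> real"
  assumes ab: "a < b" "c < d"
    and dx: "\<And>n i j x y. ((\<lambda>s. A n i j s y) has_real_derivative A n (Suc i) j x y) (at x)"
    and dy: "\<And>n i j x y. ((\<lambda>s. A n i j x s) has_real_derivative A n i (Suc j) x y) (at y)"
    and bd: "\<And>n i j x y. i + j \<le> 3 \<Longrightarrow> x \<in> {a..b} \<Longrightarrow> y \<in> {c..d} \<Longrightarrow> \<bar>A n i j x y\<bar> \<le> K"
    and lim: "\<And>x y. x \<in> {a..b} \<Longrightarrow> y \<in> {c..d} \<Longrightarrow> (\<lambda>n. A n 0 0 x y) \<longlonglongrightarrow> f x y"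
  shows "\<exists>D. jet K a b c d D \<and> (\<forall>x\<in>{a..b}. \<forall>y\<in>{c..d}. D 0 0 x y = f x y)"
proof -
  have lipx: "\<bar>A n i j x' y - A n i j x y\<bar> \<le> K * \<bar>x' - x\<bar>"
    if "i + j \<le> 2" "x \<in> {a..b}" "x' \<in> {a..b}" "y \<in> {c..d}" for n i j x x' y
    using that(2,3)
    by (rule lipschitz_of_derivative_bound[where \<alpha> = "\<lambda>s. A n i j s y" and \<beta> = "\<lambda>s. A n (Suc i) j s y", rotated 2])
       (rule dx, rule bd, use that in simp_all)
  have lipy: "\<bar>A n i j x y' - A n i j x y\<bar> \<le> K * \<bar>y' - y\<bar>"
    if "i + j \<le> 2" "x \<in> {a..b}" "y \<in> {c..d}" "y' \<in> {c..d}" for n i j x y y'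
    using that(3,4)
    by (rule lipschitz_of_derivative_bound[where \<alpha> = "\<lambda>s. A n i j x s" and \<beta> = "\<lambda>s. A n i (Suc j) x s", rotated 2])
       (rule dy, rule bd, use that in simp_all)
  have tayx: "\<bar>A n i j x' y - A n i j x y - (x' - x) * A n (Suc i) j x y\<bar> \<le> K * (x' - x)\<^sup>2"
    if "i + j \<le> 1" "x \<in> {a..b}" "x' \<in> {a..b}" "y \<in> {c..d}" for n i j x x' y
    using that(2,3)
    by (rule taylor_of_derivative_bound[where \<alpha> = "\<lambda>s. A n i j s y" and \<beta> = "\<lambda>s. A n (Suc i) j s y"
          and \<gamma> = "\<lambda>s. A n (Suc (Suc i)) j s y", rotated 3])
       (rule dx, rule dx, rule bd, use that in simp_all)
  have tayy: "\<bar>A n i j x y' - A n i j x y - (y' - y) * A n i (Suc j) x y\<bar> \<le> K * (y' - y)\<^sup>2"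
    if "i + j \<le> 1" "x \<in> {a..b}" "y \<in> {c..d}" "y' \<in> {c..d}" for n i j x y y'
    using that(3,4)
    by (rule taylor_of_derivative_bound[where \<alpha> = "\<lambda>s. A n i j x s" and \<beta> = "\<lambda>s. A n i (Suc j) x s"
          and \<gamma> = "\<lambda>s. A n i (Suc (Suc j)) x s", rotated 3])
       (rule dy, rule dy, rule bd, use that in simp_all)
  have stepx: "\<forall>x\<in>{a..b}. \<forall>y\<in>{c..d}. convergent (\<lambda>n. A n (Suc i) j x y)"
    if "\<forall>x\<in>{a..b}. \<forall>y\<in>{c..d}. convergent (\<lambda>n. A n i j x y)" "i + j \<le> 1" for i j
  proof (intro ballI)
    fix x y assume "x \<in> {a..b}" "y \<in> {c..d}"
    then show "convergent (\<lambda>n. A n (Suc i) j x y)"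
      using that(1) by (intro convergent_of_quotients[OF tayx[OF that(2)] _ _ ab(1)]) blast+
  qed
  have stepy: "\<forall>x\<in>{a..b}. \<forall>y\<in>{c..d}. convergent (\<lambda>n. A n i (Suc j) x y)"
    if "\<forall>x\<in>{a..b}. \<forall>y\<in>{c..d}. convergent (\<lambda>n. A n i j x y)" "i + j \<le> 1" for i j
  proof (intro ballI)
    fix x y assume "x \<in> {a..b}" "y \<in> {c..d}"
    then show "convergent (\<lambda>n. A n i (Suc j) x y)"
      using that(1) by (intro convergent_of_quotients[OF tayy[OF that(2)] _ _ ab(2)]) blast+
  qed
  have c0: "\<forall>x\<in>{a..b}. \<forall>y\<in>{c..d}. convergent (\<lambda>n. A n 0 0 x y)"
    using lim unfolding convergent_def by blast
  have c1: "\<forall>x\<in>{a..b}. \<forall>y\<in>{c..d}. convergent (\<lambda>n. A n 1 0 x y)"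
    "\<forall>x\<in>{a..b}. \<forall>y\<in>{c..d}. convergent (\<lambda>n. A n 0 1 x y)"
    using stepx[OF c0] stepy[OF c0] by simp_all
  have c2: "\<forall>x\<in>{a..b}. \<forall>y\<in>{c..d}. convergent (\<lambda>n. A n 2 0 x y)"
    "\<forall>x\<in>{a..b}. \<forall>y\<in>{c..d}. convergent (\<lambda>n. A n 1 1 x y)"
    "\<forall>x\<in>{a..b}. \<forall>y\<in>{c..d}. convergent (\<lambda>n. A n 0 2 x y)"
    using stepx[OF c1(1)] stepy[OF c1(1)] stepy[OF c1(2)] by (simp_all add: numeral_2_eq_2)
  have conv: "convergent (\<lambda>n. A n i j x y)" if "i + j \<le> 2" "x \<in> {a..b}" "y \<in> {c..d}" for i j x y
  proof -
    have "(i = 0 \<and> j = 0) \<or> (i = 1 \<and> j = 0) \<or> (i = 0 \<and> j = 1) \<or>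
          (i = 2 \<and> j = 0) \<or> (i = 1 \<and> j = 1) \<or> (i = 0 \<and> j = 2)"
      using that(1) by presburger
    then show ?thesis using c0 c1 c2 that(2,3) by (elim disjE conjE) simp_all
  qed
  define D where "D i j x y = lim (\<lambda>n. A n i j x y)" for i j x y
  have D: "(\<lambda>n. A n i j x y) \<longlonglongrightarrow> D i j x y" if "i + j \<le> 2" "x \<in> {a..b}" "y \<in> {c..d}" for i j x y
    using conv[OF that] unfolding D_def convergent_LIMSEQ_iff .
  have "jet K a b c d D"
    unfolding jet_def
  proof (intro ballI conjI allI impI)
    fix x y i j assume *: "x \<in> {a..b}" "y \<in> {c..d}" "i + j \<le> (2::nat)"
    show "\<bar>D i j x y\<bar> \<le> K"
      by (rule LIMSEQ_abs_le[OF D bd]) (use * in simp_all)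
    show "\<bar>D i j x' y - D i j x y\<bar> \<le> K * \<bar>x' - x\<bar>" if "x' \<in> {a..b}" for x'
      using * that by (intro LIMSEQ_abs_le[OF tendsto_diff[OF D D] lipx])
    show "\<bar>D i j x y' - D i j x y\<bar> \<le> K * \<bar>y' - y\<bar>" if "y' \<in> {c..d}" for y'
      using * that by (intro LIMSEQ_abs_le[OF tendsto_diff[OF D D] lipy])
  next
    fix x y i j assume *: "x \<in> {a..b}" "y \<in> {c..d}" "i + j \<le> (1::nat)"
    then have **: "i + j \<le> 2" "Suc i + j \<le> 2" "i + Suc j \<le> 2" by simp_all
    show "\<bar>D i j x' y - D i j x y - (x' - x) * D (Suc i) j x y\<bar> \<le> K * (x' - x)\<^sup>2"
      if "x' \<in> {a..b}" for x'
      using * ** that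
      by (intro LIMSEQ_abs_le[OF tendsto_diff[OF tendsto_diff[OF D D] tendsto_mult[OF tendsto_const D]] tayx])
    show "\<bar>D i j x y' - D i j x y - (y' - y) * D i (Suc j) x y\<bar> \<le> K * (y' - y)\<^sup>2"
      if "y' \<in> {c..d}" for y'
      using * ** that
      by (intro LIMSEQ_abs_le[OF tendsto_diff[OF tendsto_diff[OF D D] tendsto_mult[OF tendsto_const D]] tayy])
  qed
  moreover have "D 0 0 x y = f x y" if "x \<in> {a..b}" "y \<in> {c..d}" for x y
    using LIMSEQ_unique[OF D[of 0 0 x y] lim[OF that]] that by simp
  ultimately show ?thesis by blast
qed

section \<open>Mollification\<close>

lemma box_eq_Times: "box (a, c) (b, d) = {a<..<b} \<times> {c<..<d::real}" for a :: real
  by (force simp: mem_box Basis_prod_def)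

lemma cbox_eq_Times: "cbox (a, c) (b, d) = {a..b} \<times> {c..d::real}" for a :: real
  by (simp add: cbox_Pair_eq)

lemma LINT_open_box:
  fixes g :: "real \<times> real \<Rightarrow> real"
  assumes "continuous_on (cbox u v) g"
  shows "integrable (lebesgue_on (box u v)) g"
    and "(LINT p|lebesgue_on (box u v). g p) = integral (cbox u v) g"
proof -
  have "g absolutely_integrable_on cbox u v"
    using assms by (rule absolutely_integrable_continuous)
  then have "g absolutely_integrable_on box u v"
    by (rule set_integrable_subset) (auto simp: box_subset_cbox)
  then show *: "integrable (lebesgue_on (box u v)) g"
    by (simp add: integrable_restrict_space set_integrable_def)
  show "(LINT p|lebesgue_on (box u v). g p) = integral (cbox u v) g"
    using lebesgue_integral_eq_integral[OF *] by (simp add: integral_open_interval)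
qed

lemma scaled_bump_has_derivative:
  "((\<lambda>x. bump n ((x - z) / r)) has_real_derivative bump (Suc n) ((x - z) / r) / r) (at x)"
  using DERIV_chain2[OF bump_has_derivative DERIV_cdivide[OF DERIV_diff[OF DERIV_ident DERIV_const]]]
  by simp

text \<open>The tensor product bump of radius \<open>r\<close> centred at \<open>(x, y)\<close>; for positive \<open>i\<close> or \<open>j\<close> its factors
  are differentiated, without the powers of \<open>1 / r\<close> from the chain rule.\<close>

definition bump2 :: "real \<Rightarrow> nat \<Rightarrow> nat \<Rightarrow> real \<Rightarrow> real \<Rightarrow> real \<times> real \<Rightarrow> real" where
  "bump2 r i j x y p = bump i ((fst p - x) / r) * bump j ((snd p - y) / r)"

lemma mixed_partial_bump2:
  "mixed_partial i j (bump2 r 0 0 x y) = (\<lambda>p. (1 / r) ^ (i + j) * bump2 r i j x y p)"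
proof -
  have y: "(partial_y UNIV ^^ j) (bump2 r 0 0 x y) = (\<lambda>p. (1 / r) ^ j * bump2 r 0 j x y p)"
  proof (induction j)
    case (Suc j)
    have "((\<lambda>s. (1 / r) ^ j * bump2 r 0 j x y (fst p, s)) has_vector_derivative
            (1 / r) ^ Suc j * bump2 r 0 (Suc j) x y p) (at (snd p))" for p
      unfolding bump2_def has_real_derivative_iff_has_vector_derivative[symmetric] fst_conv snd_conv
      by (rule DERIV_cong[OF DERIV_cmult[OF DERIV_cmult[OF scaled_bump_has_derivative]]]) simp
    then show ?case
      unfolding funpow.simps o_apply Suc.IH by (simp add: partial_y_def fun_eq_iff vector_derivative_at)
  qed simp
  have "(partial_x UNIV ^^ i) (\<lambda>p. (1 / r) ^ j * bump2 r 0 j x y p)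
          = (\<lambda>p. (1 / r) ^ (i + j) * bump2 r i j x y p)"
  proof (induction i)
    case (Suc i)
    have "((\<lambda>s. (1 / r) ^ (i + j) * bump2 r i j x y (s, snd p)) has_vector_derivative
            (1 / r) ^ (Suc i + j) * bump2 r (Suc i) j x y p) (at (fst p))" for p
      unfolding bump2_def has_real_derivative_iff_has_vector_derivative[symmetric] fst_conv snd_conv
      by (rule DERIV_cong[OF DERIV_cmult[OF DERIV_mult[OF scaled_bump_has_derivative DERIV_const]]]) simp
    then show ?case
      unfolding funpow.simps o_apply Suc.IH by (simp add: partial_x_def fun_eq_iff vector_derivative_at)
  qed simp
  then show ?thesis by (simp add: mixed_partial_def y)
qed

lemma continuous_on_bump2: "continuous_on S (bump2 r i j x y)"
  unfolding bump2_def divide_inverse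
  by (intro continuous_intros continuous_on_compose2[OF continuous_on_bump[of UNIV]]) auto

lemma bump2_differentiable: "bump2 r i j x y differentiable (at p)"
proof -
  have b: "(\<lambda>x. bump n ((x - z) / r)) differentiable (at s)" for n z s
    using scaled_bump_has_derivative unfolding has_field_derivative_def by (rule differentiableI)
  have 1: "(\<lambda>p. bump n ((fst p - z) / r)) differentiable (at p)" for n z
    by (rule differentiable_chain_at[OF bounded_linear_imp_differentiable[OF bounded_linear_fst] b, unfolded o_def])
  have 2: "(\<lambda>p. bump n ((snd p - z) / r)) differentiable (at p)" for n z
    by (rule differentiable_chain_at[OF bounded_linear_imp_differentiable[OF bounded_linear_snd] b, unfolded o_def])
  show ?thesis unfolding bump2_def by (intro differentiable_mult 1 2)
qed

lemma bump2_eq_0: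
  assumes "r > 0" "p \<notin> cbox (x - r, y - r) (x + r, y + r)"
  shows "bump2 r i j x y p = 0"
proof -
  have "\<bar>(fst p - x) / r\<bar> \<ge> 1 \<or> \<bar>(snd p - y) / r\<bar> \<ge> 1"
    using assms by (cases p) (auto simp: field_simps abs_if)
  then show ?thesis by (auto simp: bump2_def bump_eq_0)
qed

lemma bump2_test_function:
  assumes "r > 0" "cbox (x - r, y - r) (x + r, y + r) \<subseteq> \<Omega>"
  shows "bump2 r 0 0 x y \<in> test_functions \<Omega>"
proof -
  have sub: "closure {p. bump2 r 0 0 x y p \<noteq> 0} \<subseteq> cbox (x - r, y - r) (x + r, y + r)"
    using bump2_eq_0[OF assms(1)] by (intro closure_minimal closed_cbox) blast
  have "mixed_partial i j (bump2 r 0 0 x y) differentiable_on UNIV" for i j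
    unfolding mixed_partial_bump2 differentiable_on_def
    by (intro ballI differentiable_mult differentiable_const bump2_differentiable differentiable_at_withinI)
  moreover have "compact (closure {p. bump2 r 0 0 x y p \<noteq> 0})"
    using compact_Int_closed[OF compact_cbox closed_closure] sub by (metis inf.absorb_iff2)
  ultimately show ?thesis unfolding test_functions_def using sub assms(2) by blast
qed

lemma bump2_nonneg: "bump2 r 0 0 x y p \<ge> 0"
  by (simp add: bump2_def bump_nonneg)

text \<open>Scaling and translation reduce the mass to that of the unit bump, which is positive because the bump is
  continuous, nonnegative and positive at its centre.\<close>

lemma bump2_mass:
  "\<exists>I>0. \<forall>r>0. \<forall>x y u v. cbox (x - r, y - r) (x + r, y + r) \<subseteq> cbox u v \<longrightarrow>
       (bump2 r 0 0 x y has_integral r\<^sup>2 * I) (cbox u v)"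
proof -
  let ?B = "cbox (-1, -1) (1, 1) :: (real \<times> real) set"
  define I where "I = integral ?B (bump2 1 0 0 0 0)"
  have hI: "(bump2 1 0 0 0 0 has_integral I) ?B"
    unfolding I_def by (intro integrable_integral integrable_continuous continuous_on_bump2)
  have "I \<ge> 0" by (rule has_integral_nonneg[OF hI bump2_nonneg])
  moreover have "I \<noteq> 0"
  proof
    assume "I = 0"
    then have "bump2 1 0 0 0 0 (0, 0) = 0"
      using hI by (intro has_integral_0_cbox_imp_0[of "(-1, -1)" "(1, 1)" "bump2 1 0 0 0 0"])
        (auto intro: continuous_on_bump2 bump2_nonneg simp: box_ne_empty Basis_prod_def)
    then show False using bump_pos[of 0] by (simp add: bump2_def)
  qed
  ultimately have I: "I > 0" by simp
  have "(bump2 r 0 0 x y has_integral r\<^sup>2 * I) (cbox u v)"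
    if r: "r > 0" and sub: "cbox (x - r, y - r) (x + r, y + r) \<subseteq> cbox u v" for r x y u v
  proof -
    have eq: "bump2 1 0 0 0 0 ((1 / r) *\<^sub>R p + (- x / r, - y / r)) = bump2 r 0 0 x y p" for p
      by (cases p) (simp add: bump2_def diff_divide_distrib)
    have "(bump2 r 0 0 x y has_integral I /\<^sub>R (1 / r) ^ DIM(real \<times> real))
        (cbox (((-1, -1) - (- x / r, - y / r)) /\<^sub>R (1 / r)) (((1, 1) - (- x / r, - y / r)) /\<^sub>R (1 / r)))"
      using has_integral_affinity'[OF hI, of "1 / r" "(- x / r, - y / r)"] r unfolding eq by simp
    moreover have "I /\<^sub>R (1 / r) ^ DIM(real \<times> real) = r\<^sup>2 * I"
      using r by (simp add: field_simps power2_eq_square)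
    moreover have "((-1, -1) - (- x / r, - y / r)) /\<^sub>R (1 / r) = (x - r, y - r)"
      "((1, 1) - (- x / r, - y / r)) /\<^sub>R (1 / r) = (x + r, y + r)"
      using r by (simp_all add: field_simps)
    ultimately have "(bump2 r 0 0 x y has_integral r\<^sup>2 * I) (cbox (x - r, y - r) (x + r, y + r))"
      by (simp only:)
    then show ?thesis
      by (rule has_integral_on_superset[OF _ _ sub]) (use bump2_eq_0[OF r] in auto)
  qed
  then show ?thesis using I by blast
qed

text \<open>The convolution with the bump, where \<open>i\<close> and \<open>j\<close> count the derivatives put on the bump; the factor
  \<open>(- 1 / r) ^ (i + j)\<close> of a true derivative is left out.\<close>

definition mollify :: "(real \<times> real) set \<Rightarrow> (real \<times> real \<Rightarrow> real) \<Rightarrow> real \<Rightarrow> nat \<Rightarrow> nat \<Rightarrow> real \<Rightarrow> real \<Rightarrow> real" where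
  "mollify S f r i j x y = integral S (\<lambda>p. f p * bump2 r i j x y p)"

lemma integral_mult_has_derivative:
  fixes g g' :: "real \<Rightarrow> real \<times> real \<Rightarrow> real"
  assumes f: "continuous_on (cbox u v) f"
    and g: "\<And>s p. ((\<lambda>s. g s p) has_real_derivative - (g' s p / r)) (at s)"
    and g': "continuous_on (UNIV \<times> cbox u v) (\<lambda>(s, p). g' s p)"
    and cont: "\<And>s. continuous_on (cbox u v) (g s)"
  shows "((\<lambda>s. integral (cbox u v) (\<lambda>p. f p * g s p)) has_real_derivative
            - (1 / r) * integral (cbox u v) (\<lambda>p. f p * g' t p)) (at t)"
proof -
  let ?f' = "\<lambda>s p. - (1 / r) * (f p * g' s p)"
  have "((\<lambda>s. integral (cbox u v) (\<lambda>p. f p * g s p)) has_field_derivative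
           integral (cbox u v) (?f' t)) (at t within UNIV)"
  proof (rule leibniz_rule_field_derivative)
    fix s and p :: "real \<times> real"
    show "((\<lambda>s. f p * g s p) has_real_derivative ?f' s p) (at s within UNIV)"
      by (rule DERIV_cong[OF DERIV_cmult[OF g]]) simp
    show "(\<lambda>p. f p * g s p) integrable_on cbox u v"
      by (intro integrable_continuous continuous_on_mult f cont)
    show "continuous_on (UNIV \<times> cbox u v) (\<lambda>(s, p). ?f' s p)"
      unfolding case_prod_beta
      by (intro continuous_intros continuous_on_compose2[OF f] g'[unfolded case_prod_beta]) auto
  qed auto
  then show ?thesis by (simp only: integral_mult_right)
qed

lemma reflected_scaled_bump:
  "((\<lambda>s. bump n ((z - s) / r)) has_real_derivative - (bump (Suc n) ((z - s) / r) / r)) (at s)"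
  using DERIV_chain2[OF bump_has_derivative DERIV_cdivide[OF DERIV_diff[OF DERIV_const DERIV_ident]]]
  by simp

lemma mollify_has_derivative_x:
  assumes f: "continuous_on (cbox u v) f"
  shows "((\<lambda>s. mollify (cbox u v) f r i j s y) has_real_derivative
            - (1 / r) * mollify (cbox u v) f r (Suc i) j x y) (at x)"
  unfolding mollify_def
proof (rule integral_mult_has_derivative[OF f])
  fix s and p :: "real \<times> real"
  show "((\<lambda>s. bump2 r i j s y p) has_real_derivative - (bump2 r (Suc i) j s y p / r)) (at s)"
    unfolding bump2_def
    by (rule DERIV_cong[OF DERIV_mult[OF reflected_scaled_bump DERIV_const]]) simp
  show "continuous_on (UNIV \<times> cbox u v) (\<lambda>(s, p). bump2 r (Suc i) j s y p)"
    unfolding bump2_def divide_inverse case_prod_beta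
    by (intro continuous_intros continuous_on_compose2[OF continuous_on_bump[of UNIV]]) auto
qed (rule continuous_on_bump2)

lemma mollify_has_derivative_y:
  assumes f: "continuous_on (cbox u v) f"
  shows "((\<lambda>s. mollify (cbox u v) f r i j x s) has_real_derivative
            - (1 / r) * mollify (cbox u v) f r i (Suc j) x y) (at y)"
  unfolding mollify_def
proof (rule integral_mult_has_derivative[OF f])
  fix s and p :: "real \<times> real"
  show "((\<lambda>s. bump2 r i j x s p) has_real_derivative - (bump2 r i (Suc j) x s p / r)) (at s)"
    unfolding bump2_def
    by (rule DERIV_cong[OF DERIV_cmult[OF reflected_scaled_bump]]) simp
  show "continuous_on (UNIV \<times> cbox u v) (\<lambda>(s, p). bump2 r i (Suc j) x s p)"
    unfolding bump2_def divide_inverse case_prod_beta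
    by (intro continuous_intros continuous_on_compose2[OF continuous_on_bump[of UNIV]]) auto
qed (rule continuous_on_bump2)

text \<open>Up to sign and powers of \<open>r\<close>, the left-hand side is \<open>f\<close> tested with a derivative of the bump, hence the
  weak derivative tested with the bump itself, which is nonnegative.\<close>

lemma mollify_bound_of_weak_derivative:
  assumes f: "continuous_on (cbox u v) f" and weak: "weak_derivative (box u v) i j f g"
    and g: "AE p in lebesgue_on (box u v). \<bar>g p\<bar> \<le> K"
    and r: "r > 0" and sub: "cbox (x - r, y - r) (x + r, y + r) \<subseteq> box u v"
    and mass: "(bump2 r 0 0 x y has_integral c) (cbox u v)"
  shows "\<bar>mollify (cbox u v) f r i j x y\<bar> \<le> r ^ (i + j) * (K * c)"
proof -
  let ?M = "lebesgue_on (box u v)"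
  have cont: "continuous_on (cbox u v) (\<lambda>p. f p * bump2 r i j x y p)"
    by (intro continuous_on_mult f continuous_on_bump2)
  have "(1 / r) ^ (i + j) * mollify (cbox u v) f r i j x y
      = (LINT p|?M. (1 / r) ^ (i + j) * (f p * bump2 r i j x y p))"
    unfolding mollify_def LINT_open_box(2)[OF cont, symmetric] by simp
  also have "\<dots> = (LINT p|?M. f p * mixed_partial i j (bump2 r 0 0 x y) p)"
    unfolding mixed_partial_bump2 by (simp add: mult.left_commute)
  also have "\<dots> = (-1) ^ (i + j) * (LINT p|?M. g p * bump2 r 0 0 x y p)"
    using weak bump2_test_function[OF r sub] unfolding weak_derivative_def by blast
  finally have "\<bar>(1 / r) ^ (i + j) * mollify (cbox u v) f r i j x y\<bar>
      = \<bar>LINT p|?M. g p * bump2 r 0 0 x y p\<bar>"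
    by (simp add: abs_mult)
  also have "\<dots> \<le> (LINT p|?M. \<bar>g p * bump2 r 0 0 x y p\<bar>)"
    by (rule integral_abs_bound)
  also have "\<dots> \<le> (LINT p|?M. K * bump2 r 0 0 x y p)"
  proof (rule integral_mono_AE')
    show "integrable ?M (\<lambda>p. K * bump2 r 0 0 x y p)"
      by (intro integrable_mult_right LINT_open_box(1) continuous_on_bump2)
    show "AE p in ?M. \<bar>g p * bump2 r 0 0 x y p\<bar> \<le> K * bump2 r 0 0 x y p"
      using g by eventually_elim (simp add: abs_mult bump2_nonneg mult_right_mono)
    then show "AE p in ?M. 0 \<le> K * bump2 r 0 0 x y p"
      by eventually_elim linarith
  qed
  also have "\<dots> = K * c"
    using LINT_open_box(2)[OF continuous_on_bump2] integral_unique[OF mass] by simp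
  finally show ?thesis
    using r by (simp add: abs_mult field_simps)
qed

lemma mollify_close:
  assumes f: "continuous_on (cbox u v) f" and r: "r > 0"
    and mass: "(bump2 r 0 0 x y has_integral c) (cbox u v)"
    and close: "\<And>p. p \<in> cbox u v \<Longrightarrow> p \<in> cbox (x - r, y - r) (x + r, y + r) \<Longrightarrow> \<bar>f p - w\<bar> \<le> e"
  shows "\<bar>mollify (cbox u v) f r 0 0 x y - c * w\<bar> \<le> e * c"
proof -
  have 1: "((\<lambda>p. (f p - w) * bump2 r 0 0 x y p) has_integral (mollify (cbox u v) f r 0 0 x y - c * w)) (cbox u v)"
  proof -
    have "((\<lambda>p. f p * bump2 r 0 0 x y p) has_integral mollify (cbox u v) f r 0 0 x y) (cbox u v)"
      unfolding mollify_def
      by (intro integrable_integral integrable_continuous continuous_on_mult f continuous_on_bump2)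
    from has_integral_diff[OF this has_integral_mult_left[OF mass, of w]]
    show ?thesis by (simp add: algebra_simps)
  qed
  have 2: "((\<lambda>p. e * bump2 r 0 0 x y p) has_integral e * c) (cbox u v)"
    using has_integral_mult_right[OF mass] .
  have "norm (integral (cbox u v) (\<lambda>p. (f p - w) * bump2 r 0 0 x y p)) \<le> integral (cbox u v) (\<lambda>p. e * bump2 r 0 0 x y p)"
  proof (rule Henstock_Kurzweil_Integration.integral_norm_bound_integral)
    fix p assume p: "p \<in> cbox u v"
    show "norm ((f p - w) * bump2 r 0 0 x y p) \<le> e * bump2 r 0 0 x y p"
      using close[OF p] bump2_eq_0[OF r, of p x y 0 0] bump2_nonneg[of r x y p]
      by (cases "p \<in> cbox (x - r, y - r) (x + r, y + r)") (auto simp: abs_mult intro!: mult_right_mono)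
  qed (use 1 2 in \<open>auto simp: integrable_on_def\<close>)
  then show ?thesis by (simp only: integral_unique[OF 1] integral_unique[OF 2] real_norm_def)
qed

section \<open>Regularity up to the boundary\<close>

text \<open>Mollification alone is possible only at a distance from the boundary. Contracting the rectangle
  towards its centre by the factor \<open>1 - t\<close> and mollifying with a radius proportional to \<open>t\<close> keeps the support
  inside \<open>\<Omega>\<close> even for boundary points, so that a single limit \<open>t \<rightarrow> 0\<close> gives the jet on the closed
  rectangle.\<close>

lemma sobolev_inf_jet:
  assumes ab: "a < b" "c < d" and f: "f \<in> sobolev_inf 3 ({a<..<b} \<times> {c<..<d})"
    and cont: "continuous_on ({a..b} \<times> {c..d}) f"
  shows "\<exists>K D. jet K a b c d D \<and> (\<forall>x\<in>{a..b}. \<forall>y\<in>{c..d}. D 0 0 x y = f (x, y))"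
proof -
  define \<Omega> where "\<Omega> = box (a, c) (b, d)"
  define S where "S = cbox (a, c) (b, d)"
  have \<Omega>: "\<Omega> = {a<..<b} \<times> {c<..<d}" and S: "S = {a..b} \<times> {c..d}"
    by (simp_all add: \<Omega>_def S_def box_eq_Times cbox_eq_Times)
  have fS: "continuous_on S f" using cont by (simp add: S)
  have "\<forall>i j. \<exists>g K. i + j \<le> 3 \<longrightarrow> weak_derivative \<Omega> i j f g \<and> (AE p in lebesgue_on \<Omega>. \<bar>g p\<bar> \<le> K)"
    using f unfolding sobolev_inf_def essentially_bounded_def \<Omega> by blast
  then obtain g L where gL: "\<And>i j. i + j \<le> 3 \<Longrightarrow> weak_derivative \<Omega> i j f (g i j)"
    "\<And>i j. i + j \<le> 3 \<Longrightarrow> AE p in lebesgue_on \<Omega>. \<bar>g i j p\<bar> \<le> L i j"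
    by metis
  define K where "K = (\<Sum>q\<in>{..3}\<times>{..3}. \<bar>L (fst q) (snd q)\<bar>)"
  have K: "AE p in lebesgue_on \<Omega>. \<bar>g i j p\<bar> \<le> K" if ij: "i + j \<le> 3" for i j
  proof -
    have "L i j \<le> \<bar>L (fst (i, j)) (snd (i, j))\<bar>" by simp
    also have "\<dots> \<le> K" unfolding K_def
      by (rule member_le_sum[of "(i, j)" "{..3}\<times>{..3}" "\<lambda>q. \<bar>L (fst q) (snd q)\<bar>"]) (use ij in auto)
    finally show ?thesis using gL(2)[OF ij] by (auto elim!: eventually_mono)
  qed
  obtain I where I: "I > 0" and mass: "\<forall>r>0. \<forall>x y u v. cbox (x - r, y - r) (x + r, y + r) \<subseteq> cbox u v \<longrightarrow>
       (bump2 r 0 0 x y has_integral r\<^sup>2 * I) (cbox u v)"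
    using bump2_mass by (elim exE conjE)
  \<comment> \<open>contraction by \<open>l n = 1 - t n\<close> leaves a margin of at least \<open>t n * w\<close>; the radius \<open>r n\<close> uses half of it\<close>
  define w where "w = min (b - a) (d - c) / 2"
  define t where "t n = 1 / real (n + 2)" for n :: nat
  define r where "r n = t n * w / 2" for n
  define l where "l n = 1 - t n" for n
  define X where "X n x = (a + b) / 2 + l n * (x - (a + b) / 2)" for n x
  define Y where "Y n y = (c + d) / 2 + l n * (y - (c + d) / 2)" for n y
  define A where "A n i j x y = (l n / r n) ^ (i + j) * (-1) ^ (i + j) / ((r n)\<^sup>2 * I)
       * mollify S f (r n) i j (X n x) (Y n y)" for n i j x y
  have w: "w > 0" "w \<le> (b - a) / 2" "w \<le> (d - c) / 2"
    using ab unfolding w_def min_def by (simp_all split: if_splits)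
  have t: "t n > 0" "t n < 1" for n by (auto simp: t_def)
  have r: "r n > 0" for n using t w by (simp add: r_def)
  have l: "0 < l n" "l n < 1" for n using t by (simp_all add: l_def)
  have inside: "q + l n * (x - q) - r n > q - s" "q + l n * (x - q) + r n < q + s"
    if "q - s \<le> x" "x \<le> q + s" "w \<le> s" for n q s x
  proof -
    have "l n * (x - q) \<le> l n * s" by (rule mult_left_mono) (use that l[of n] in simp_all)
    moreover have "l n * (- s) \<le> l n * (x - q)" by (rule mult_left_mono) (use that l[of n] in simp_all)
    moreover have "r n < t n * s"
    proof -
      have "t n * w \<le> t n * s" using t[of n] that by (intro mult_left_mono) auto
      moreover have "t n * w > 0" using t[of n] w by simp
      ultimately show ?thesis by (simp add: r_def)
    qed
    moreover have "l n * s = s - t n * s" by (simp add: l_def algebra_simps)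
    ultimately show "q + l n * (x - q) - r n > q - s" "q + l n * (x - q) + r n < q + s" by simp_all
  qed
  have sub: "cbox (X n x - r n, Y n y - r n) (X n x + r n, Y n y + r n) \<subseteq> \<Omega>"
    if "x \<in> {a..b}" "y \<in> {c..d}" for n x y
  proof -
    have "X n x - r n > a" "X n x + r n < b"
      using inside[of "(a + b) / 2" "(b - a) / 2" x n] that w by (simp_all add: X_def field_simps)
    moreover have "Y n y - r n > c" "Y n y + r n < d"
      using inside[of "(c + d) / 2" "(d - c) / 2" y n] that w by (simp_all add: Y_def field_simps)
    ultimately show ?thesis by (auto simp: cbox_eq_Times \<Omega>)
  qed
  have subS: "\<Omega> \<subseteq> S" by (auto simp: \<Omega> S)
  have mass': "(bump2 (r n) 0 0 (X n x) (Y n y) has_integral (r n)\<^sup>2 * I) S"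
    if "x \<in> {a..b}" "y \<in> {c..d}" for n x y
    using mass[rule_format, OF r, OF order_trans[OF sub[OF that] subS, unfolded S_def]]
    unfolding S_def .
  have dX: "(X n has_real_derivative l n) (at x)" and dY: "(Y n has_real_derivative l n) (at x)" for n x
    unfolding X_def Y_def by (auto intro!: derivative_eq_intros)
  have "\<exists>D. jet K a b c d D \<and> (\<forall>x\<in>{a..b}. \<forall>y\<in>{c..d}. D 0 0 x y = f (x, y))"
  proof (rule jet_of_smooth_approximations[of a b c d A K "\<lambda>x y. f (x, y)"])
    fix n i j x y
    show "((\<lambda>s. A n i j s y) has_real_derivative A n (Suc i) j x y) (at x)"
      unfolding A_def
      by (rule DERIV_cong[OF DERIV_cmult[OF DERIV_chain2[OF
            mollify_has_derivative_x[OF fS[unfolded S_def], folded S_def] dX]]]) (simp add: field_simps)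
    show "((\<lambda>s. A n i j x s) has_real_derivative A n i (Suc j) x y) (at y)"
      unfolding A_def
      by (rule DERIV_cong[OF DERIV_cmult[OF DERIV_chain2[OF
            mollify_has_derivative_y[OF fS[unfolded S_def], folded S_def] dY]]]) (simp add: field_simps)
  next
    fix n i j x y assume ij: "i + j \<le> (3::nat)" and xy: "x \<in> {a..b}" "y \<in> {c..d}"
    have "\<bar>mollify S f (r n) i j (X n x) (Y n y)\<bar> \<le> r n ^ (i + j) * (K * ((r n)\<^sup>2 * I))"
      unfolding S_def
      by (rule mollify_bound_of_weak_derivative[OF fS[unfolded S_def] gL(1)[OF ij, unfolded \<Omega>_def]
            K[OF ij, unfolded \<Omega>_def] r])
         (use sub[OF xy] mass'[OF xy] in \<open>auto simp: S_def \<Omega>_def\<close>)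
    then have "\<bar>A n i j x y\<bar> \<le> (l n / r n) ^ (i + j) / ((r n)\<^sup>2 * I) * (r n ^ (i + j) * (K * ((r n)\<^sup>2 * I)))"
      using r[of n] l[of n] I unfolding A_def abs_mult by (intro mult_mono) (auto simp: abs_mult power_abs)
    also have "\<dots> = l n ^ (i + j) * K"
      using r[of n] I by (simp add: power_divide)
    also have "\<dots> \<le> 1 * K"
      using l[of n] by (intro mult_right_mono power_le_one) (auto simp: K_def sum_nonneg)
    finally show "\<bar>A n i j x y\<bar> \<le> K" by simp
  next
    fix x y assume xy: "x \<in> {a..b}" "y \<in> {c..d}"
    have tr: "(\<lambda>n. r n + t n * (b - a)) \<longlonglongrightarrow> 0" "(\<lambda>n. r n + t n * (d - c)) \<longlonglongrightarrow> 0"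
    proof -
      have "t \<longlonglongrightarrow> 0"
        using LIMSEQ_ignore_initial_segment[OF lim_1_over_n, of 2] unfolding t_def .
      from tendsto_mult_left_zero[OF this] have *: "(\<lambda>n. t n * k) \<longlonglongrightarrow> 0" for k .
      show "(\<lambda>n. r n + t n * (b - a)) \<longlonglongrightarrow> 0" "(\<lambda>n. r n + t n * (d - c)) \<longlonglongrightarrow> 0"
        using *[of "w / 2 + (b - a)"] *[of "w / 2 + (d - c)"] by (simp_all add: r_def algebra_simps)
    qed
    show "(\<lambda>n. A n 0 0 x y) \<longlonglongrightarrow> f (x, y)"
    proof (rule metric_LIMSEQ_I)
      fix e :: real assume e: "e > 0"
      obtain \<delta> where \<delta>: "\<delta> > 0" "\<And>p. p \<in> S \<Longrightarrow> dist p (x, y) < \<delta> \<Longrightarrow> dist (f p) (f (x, y)) < e / 2"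
        using fS xy e unfolding continuous_on_iff S by (metis half_gt_zero mem_Sigma_iff)
      have "\<forall>\<^sub>F n in sequentially. r n + t n * (b - a) < \<delta> / 2 \<and> r n + t n * (d - c) < \<delta> / 2"
        using \<delta>(1) order_tendstoD(2)[OF tr(1), of "\<delta> / 2"] order_tendstoD(2)[OF tr(2), of "\<delta> / 2"]
        by (auto simp: eventually_conj_iff)
      then obtain N where N: "\<And>n. n \<ge> N \<Longrightarrow> r n + t n * (b - a) < \<delta> / 2 \<and> r n + t n * (d - c) < \<delta> / 2"
        unfolding eventually_sequentially by blast
      have "dist (A n 0 0 x y) (f (x, y)) < e" if n: "n \<ge> N" for n
      proof -
        have X: "\<bar>X n x - x\<bar> \<le> t n * (b - a)" and Y: "\<bar>Y n y - y\<bar> \<le> t n * (d - c)"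
        proof -
          have "X n x - x = t n * ((a + b) / 2 - x)" "Y n y - y = t n * ((c + d) / 2 - y)"
          proof -
            have "q + (1 - s) * (z - q) - z = s * (q - z)" for q s z :: real by (simp add: algebra_simps)
            then show "X n x - x = t n * ((a + b) / 2 - x)" "Y n y - y = t n * ((c + d) / 2 - y)"
              unfolding X_def Y_def l_def by blast+
          qed
          moreover have "\<bar>(a + b) / 2 - x\<bar> \<le> b - a" "\<bar>(c + d) / 2 - y\<bar> \<le> d - c"
            using xy by (auto simp: abs_le_iff field_simps)
          ultimately show "\<bar>X n x - x\<bar> \<le> t n * (b - a)" "\<bar>Y n y - y\<bar> \<le> t n * (d - c)"
            using t[of n] by (simp_all add: abs_mult)
        qed
        have "\<bar>mollify S f (r n) 0 0 (X n x) (Y n y) - ((r n)\<^sup>2 * I) * f (x, y)\<bar> \<le> e / 2 * ((r n)\<^sup>2 * I)"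
          unfolding S_def
        proof (rule mollify_close[OF fS[unfolded S_def] r mass'[OF xy, unfolded S_def]])
          fix p assume p: "p \<in> cbox (a, c) (b, d)"
            "p \<in> cbox (X n x - r n, Y n y - r n) (X n x + r n, Y n y + r n)"
          obtain p1 p2 where pp: "p = (p1, p2)" by (cases p)
          have "X n x - r n \<le> p1" "p1 \<le> X n x + r n" "Y n y - r n \<le> p2" "p2 \<le> Y n y + r n"
            using p(2) unfolding pp cbox_eq_Times by auto
          then have "\<bar>p1 - x\<bar> < \<delta> / 2" "\<bar>p2 - y\<bar> < \<delta> / 2"
            using N[OF n] X Y by linarith+
          then have "dist p (x, y) < \<delta>"
            using sqrt_sum_squares_le_sum_abs[of "p1 - x" "p2 - y"]
            unfolding pp dist_Pair_Pair dist_real_def by simp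
          then show "\<bar>f p - f (x, y)\<bar> \<le> e / 2"
            using \<delta>(2)[of p] p(1) unfolding S_def dist_real_def by linarith
        qed
        moreover have pos: "(r n)\<^sup>2 * I > 0" using r[of n] I by simp
        moreover have "A n 0 0 x y - f (x, y)
            = (mollify S f (r n) 0 0 (X n x) (Y n y) - ((r n)\<^sup>2 * I) * f (x, y)) / ((r n)\<^sup>2 * I)"
          using r[of n] I by (simp add: A_def diff_divide_distrib)
        ultimately have "\<bar>A n 0 0 x y - f (x, y)\<bar> \<le> e / 2"
          by (simp only: abs_divide abs_of_pos pos_divide_le_eq)
        then show ?thesis using e by (simp add: dist_real_def)
      qed
      then show "\<exists>N. \<forall>n\<ge>N. dist (A n 0 0 x y) (f (x, y)) < e" by blast
    qed
  qed (use ab in auto)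
  then show ?thesis by blast
qed

section \<open>Functions with quadratically small second differences\<close>

text \<open>A form of \<open>C\<^sup>1\<^sup>,\<^sup>1\<close> regularity that refers to values only. It is what the midpoint estimates use, and it is
  stable under products, so that nonlinear terms need no derivatives of their own.\<close>

definition second_order :: "real \<Rightarrow> real set \<Rightarrow> real set \<Rightarrow> (real \<Rightarrow> real \<Rightarrow> real) \<Rightarrow> bool" where
  "second_order \<kappa> I J F \<longleftrightarrow>
     (\<forall>x\<in>I. \<forall>y\<in>J. \<bar>F x y\<bar> \<le> \<kappa>) \<and>
     (\<forall>x\<in>I. \<forall>x'\<in>I. \<forall>y\<in>J. \<forall>y'\<in>J. \<bar>F x' y' - F x y\<bar> \<le> \<kappa> * (\<bar>x' - x\<bar> + \<bar>y' - y\<bar>)) \<and>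
     (\<forall>x\<in>I. \<forall>y\<in>J. \<forall>s t. x + s \<in> I \<longrightarrow> x - s \<in> I \<longrightarrow> y + t \<in> J \<longrightarrow> y - t \<in> J \<longrightarrow>
        \<bar>F (x + s) (y + t) + F (x - s) (y - t) - 2 * F x y\<bar> \<le> \<kappa> * (\<bar>s\<bar> + \<bar>t\<bar>)\<^sup>2)"

lemma second_orderD:
  assumes "second_order \<kappa> I J F" "x \<in> I" "y \<in> J"
  shows second_order_bound: "\<bar>F x y\<bar> \<le> \<kappa>"
    and second_order_lipschitz:
      "x' \<in> I \<Longrightarrow> y' \<in> J \<Longrightarrow> \<bar>F x' y' - F x y\<bar> \<le> \<kappa> * (\<bar>x' - x\<bar> + \<bar>y' - y\<bar>)"
    and second_order_difference:
      "x + s \<in> I \<Longrightarrow> x - s \<in> I \<Longrightarrow> y + t \<in> J \<Longrightarrow> y - t \<in> J \<Longrightarrow>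
        \<bar>F (x + s) (y + t) + F (x - s) (y - t) - 2 * F x y\<bar> \<le> \<kappa> * (\<bar>s\<bar> + \<bar>t\<bar>)\<^sup>2"
  using assms unfolding second_order_def by blast+

lemma second_order_swap:
  assumes F: "second_order \<kappa> I J F"
  shows "second_order \<kappa> J I (\<lambda>y x. F x y)"
  unfolding second_order_def
proof (intro conjI ballI allI impI)
  fix y x assume yx: "y \<in> J" "x \<in> I"
  show "\<bar>F x y\<bar> \<le> \<kappa>" by (rule second_order_bound[OF F yx(2,1)])
  fix t s assume "y + t \<in> J" "y - t \<in> J" "x + s \<in> I" "x - s \<in> I"
  then show "\<bar>F (x + s) (y + t) + F (x - s) (y - t) - 2 * F x y\<bar> \<le> \<kappa> * (\<bar>t\<bar> + \<bar>s\<bar>)\<^sup>2"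
    unfolding add.commute[of "\<bar>t\<bar>"] by (intro second_order_difference[OF F yx(2,1)])
next
  fix y y' x x' assume "y \<in> J" "y' \<in> J" "x \<in> I" "x' \<in> I"
  then show "\<bar>F x' y' - F x y\<bar> \<le> \<kappa> * (\<bar>y' - y\<bar> + \<bar>x' - x\<bar>)"
    unfolding add.commute[of "\<bar>y' - y\<bar>"] by (intro second_order_lipschitz[OF F])
qed

lemma second_order_add:
  assumes F: "second_order \<kappa> I J F" and G: "second_order \<mu> I J G"
  shows "second_order (\<kappa> + \<mu>) I J (\<lambda>x y. F x y + G x y)"
  unfolding second_order_def
proof (intro conjI ballI allI impI)
  fix x y assume xy: "x \<in> I" "y \<in> J"
  show "\<bar>F x y + G x y\<bar> \<le> \<kappa> + \<mu>"
    using second_order_bound[OF F xy] second_order_bound[OF G xy] by linarith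
  fix s t assume st: "x + s \<in> I" "x - s \<in> I" "y + t \<in> J" "y - t \<in> J"
  have eq: "(F (x + s) (y + t) + G (x + s) (y + t)) + (F (x - s) (y - t) + G (x - s) (y - t))
         - 2 * (F x y + G x y)
      = (F (x + s) (y + t) + F (x - s) (y - t) - 2 * F x y)
        + (G (x + s) (y + t) + G (x - s) (y - t) - 2 * G x y)" by simp
  show "\<bar>(F (x + s) (y + t) + G (x + s) (y + t)) + (F (x - s) (y - t) + G (x - s) (y - t))
         - 2 * (F x y + G x y)\<bar> \<le> (\<kappa> + \<mu>) * (\<bar>s\<bar> + \<bar>t\<bar>)\<^sup>2"
    unfolding eq distrib_right
    by (intro order_trans[OF abs_triangle_ineq] add_mono second_order_difference[OF F xy st]
        second_order_difference[OF G xy st])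
next
  fix x x' y y' assume xy: "x \<in> I" "x' \<in> I" "y \<in> J" "y' \<in> J"
  define q where "q = \<bar>x' - x\<bar> + \<bar>y' - y\<bar>"
  show "\<bar>F x' y' + G x' y' - (F x y + G x y)\<bar> \<le> (\<kappa> + \<mu>) * (\<bar>x' - x\<bar> + \<bar>y' - y\<bar>)"
    using second_order_lipschitz[OF F xy(1,3,2,4)] second_order_lipschitz[OF G xy(1,3,2,4)]
    unfolding q_def[symmetric] distrib_right by linarith
qed

lemma abs_mult_le:
  fixes x y :: real
  assumes "\<bar>x\<bar> \<le> X" "\<bar>y\<bar> \<le> Y"
  shows "\<bar>x * y\<bar> \<le> X * Y"
  unfolding abs_mult by (rule mult_mono[OF assms _ abs_ge_zero]) (rule order_trans[OF abs_ge_zero assms(1)])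

text \<open>The second difference of a product is \<open>F\<close> times the second difference of \<open>G\<close>, plus the same with the roles
  exchanged, plus two products of first differences.\<close>

lemma second_order_mult:
  assumes F: "second_order \<kappa> I J F" and G: "second_order \<mu> I J G" and nn: "\<kappa> \<ge> 0" "\<mu> \<ge> 0"
  shows "second_order (4 * \<kappa> * \<mu>) I J (\<lambda>x y. F x y * G x y)"
  unfolding second_order_def
proof (intro conjI ballI allI impI)
  have nn2: "0 \<le> \<kappa> * \<mu>" using nn by (rule mult_nonneg_nonneg)
  fix x y assume xy: "x \<in> I" "y \<in> J"
  have "\<bar>F x y * G x y\<bar> \<le> \<kappa> * \<mu>"
    by (intro abs_mult_le second_order_bound[OF F xy] second_order_bound[OF G xy])
  then show "\<bar>F x y * G x y\<bar> \<le> 4 * \<kappa> * \<mu>" using nn2 by linarith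
  fix s t assume st: "x + s \<in> I" "x - s \<in> I" "y + t \<in> J" "y - t \<in> J"
  define q where "q = \<bar>s\<bar> + \<bar>t\<bar>"
  have qp: "\<bar>x + s - x\<bar> + \<bar>y + t - y\<bar> = q" and qm: "\<bar>x - s - x\<bar> + \<bar>y - t - y\<bar> = q"
    by (simp_all add: q_def)
  let ?Fp = "F (x + s) (y + t)" and ?Fm = "F (x - s) (y - t)" and ?F = "F x y"
  let ?Gp = "G (x + s) (y + t)" and ?Gm = "G (x - s) (y - t)" and ?G = "G x y"
  note lF = second_order_lipschitz[OF F xy st(1,3), unfolded qp] second_order_lipschitz[OF F xy st(2,4), unfolded qm]
  note lG = second_order_lipschitz[OF G xy st(1,3), unfolded qp] second_order_lipschitz[OF G xy st(2,4), unfolded qm]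
  have "?Fp * ?Gp + ?Fm * ?Gm - 2 * (?F * ?G)
     = ?F * (?Gp + ?Gm - 2 * ?G) + ?G * (?Fp + ?Fm - 2 * ?F)
       + (?Fp - ?F) * (?Gp - ?G) + (?Fm - ?F) * (?Gm - ?G)"
    by (simp add: algebra_simps)
  also have "\<bar>\<dots>\<bar> \<le> \<kappa> * (\<mu> * q\<^sup>2) + \<mu> * (\<kappa> * q\<^sup>2) + (\<kappa> * q) * (\<mu> * q) + (\<kappa> * q) * (\<mu> * q)"
    by (intro order_trans[OF abs_triangle_ineq] add_mono abs_mult_le lF lG
        second_order_difference[OF F xy st, folded q_def] second_order_difference[OF G xy st, folded q_def]
        second_order_bound[OF F xy] second_order_bound[OF G xy])
  also have "\<dots> = 4 * \<kappa> * \<mu> * q\<^sup>2" by (simp add: power2_eq_square)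
  finally show "\<bar>?Fp * ?Gp + ?Fm * ?Gm - 2 * (?F * ?G)\<bar> \<le> 4 * \<kappa> * \<mu> * (\<bar>s\<bar> + \<bar>t\<bar>)\<^sup>2"
    unfolding q_def .
next
  fix x x' y y' assume xy: "x \<in> I" "x' \<in> I" "y \<in> J" "y' \<in> J"
  define q where "q = \<bar>x' - x\<bar> + \<bar>y' - y\<bar>"
  have "0 \<le> \<kappa> * \<mu> * q" using nn by (simp add: q_def)
  have "F x' y' * G x' y' - F x y * G x y = F x' y' * (G x' y' - G x y) + (F x' y' - F x y) * G x y"
    by (simp add: algebra_simps)
  also have "\<bar>\<dots>\<bar> \<le> \<kappa> * (\<mu> * q) + (\<kappa> * q) * \<mu>"
    by (intro order_trans[OF abs_triangle_ineq] add_mono abs_mult_le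
        second_order_lipschitz[OF F xy(1,3,2,4), folded q_def] second_order_lipschitz[OF G xy(1,3,2,4), folded q_def]
        second_order_bound[OF F xy(2,4)] second_order_bound[OF G xy(1,3)])
  also have "\<dots> = 2 * (\<kappa> * \<mu> * q)" by simp
  also have "\<dots> \<le> 4 * \<kappa> * \<mu> * q" using \<open>0 \<le> \<kappa> * \<mu> * q\<close> by simp
  finally show "\<bar>F x' y' * G x' y' - F x y * G x y\<bar> \<le> 4 * \<kappa> * \<mu> * (\<bar>x' - x\<bar> + \<bar>y' - y\<bar>)"
    unfolding q_def .
qed

lemma jetD:
  assumes "jet K a b c d D" "x \<in> {a..b}" "y \<in> {c..d}"
  shows jet_bound: "i + j \<le> 2 \<Longrightarrow> \<bar>D i j x y\<bar> \<le> K"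
    and jet_lipschitz_x: "i + j \<le> 2 \<Longrightarrow> x' \<in> {a..b} \<Longrightarrow> \<bar>D i j x' y - D i j x y\<bar> \<le> K * \<bar>x' - x\<bar>"
    and jet_lipschitz_y: "i + j \<le> 2 \<Longrightarrow> y' \<in> {c..d} \<Longrightarrow> \<bar>D i j x y' - D i j x y\<bar> \<le> K * \<bar>y' - y\<bar>"
    and jet_taylor_x: "i + j \<le> 1 \<Longrightarrow> x' \<in> {a..b} \<Longrightarrow>
        \<bar>D i j x' y - D i j x y - (x' - x) * D (Suc i) j x y\<bar> \<le> K * (x' - x)\<^sup>2"
    and jet_taylor_y: "i + j \<le> 1 \<Longrightarrow> y' \<in> {c..d} \<Longrightarrow>
        \<bar>D i j x y' - D i j x y - (y' - y) * D i (Suc j) x y\<bar> \<le> K * (y' - y)\<^sup>2"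
  using assms unfolding jet_def by blast+

lemma jet_swap:
  assumes "jet K a b c d D"
  shows "jet K c d a b (\<lambda>i j y x. D j i x y)"
  unfolding jet_def
proof (intro ballI conjI allI impI)
  fix y x i j assume yx: "y \<in> {c..d}" "x \<in> {a..b}"
  note D = jetD[OF assms yx(2,1), of j i]
  show "\<bar>D j i x y\<bar> \<le> K" if "i + j \<le> 2" using D(1) that by simp
  show "\<bar>D j i x y' - D j i x y\<bar> \<le> K * \<bar>y' - y\<bar>" if "i + j \<le> 2" "y' \<in> {c..d}" for y'
    using D(3) that by simp
  show "\<bar>D j i x' y - D j i x y\<bar> \<le> K * \<bar>x' - x\<bar>" if "i + j \<le> 2" "x' \<in> {a..b}" for x'
    using D(2) that by simp
  show "\<bar>D j i x y' - D j i x y - (y' - y) * D j (Suc i) x y\<bar> \<le> K * (y' - y)\<^sup>2"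
    if "i + j \<le> 1" "y' \<in> {c..d}" for y'
    using D(5) that by simp
  show "\<bar>D j i x' y - D j i x y - (x' - x) * D (Suc j) i x y\<bar> \<le> K * (x' - x)\<^sup>2"
    if "i + j \<le> 1" "x' \<in> {a..b}" for x'
    using D(4) that by simp
qed

lemma jet_mono:
  assumes "jet K a b c d D" "K \<le> K'"
  shows "jet K' a b c d D"
proof -
  have m: "K * \<bar>z\<bar> \<le> K' * \<bar>z\<bar>" "K * z\<^sup>2 \<le> K' * z\<^sup>2" for z
    by (rule mult_right_mono[OF assms(2)], simp)+
  show ?thesis
    unfolding jet_def
  proof (intro ballI conjI allI impI)
    fix x y i j assume xy: "x \<in> {a..b}" "y \<in> {c..d}"
    note D = jetD[OF assms(1) xy, of i j]
    show "\<bar>D i j x y\<bar> \<le> K'" if "i + j \<le> 2"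
      by (rule order_trans[OF D(1)[OF that] assms(2)])
    show "\<bar>D i j x' y - D i j x y\<bar> \<le> K' * \<bar>x' - x\<bar>" if "i + j \<le> 2" "x' \<in> {a..b}" for x'
      by (rule order_trans[OF D(2)[OF that] m(1)])
    show "\<bar>D i j x y' - D i j x y\<bar> \<le> K' * \<bar>y' - y\<bar>" if "i + j \<le> 2" "y' \<in> {c..d}" for y'
      by (rule order_trans[OF D(3)[OF that] m(1)])
    show "\<bar>D i j x' y - D i j x y - (x' - x) * D (Suc i) j x y\<bar> \<le> K' * (x' - x)\<^sup>2"
      if "i + j \<le> 1" "x' \<in> {a..b}" for x'
      by (rule order_trans[OF D(4)[OF that] m(2)])
    show "\<bar>D i j x y' - D i j x y - (y' - y) * D i (Suc j) x y\<bar> \<le> K' * (y' - y)\<^sup>2"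
      if "i + j \<le> 1" "y' \<in> {c..d}" for y'
      by (rule order_trans[OF D(5)[OF that] m(2)])
  qed
qed

text \<open>In the symmetric difference the linear parts of the two Taylor expansions cancel.\<close>

lemma jet_second_order:
  assumes jet: "jet K a b c d D" and ij: "i + j \<le> 1" and ne: "a \<le> b" "c \<le> d"
  shows "second_order (2 * K) {a..b} {c..d} (D i j)"
proof -
  have K: "K \<ge> 0"
  proof -
    have "a \<in> {a..b}" "c \<in> {c..d}" using ne by simp_all
    from order_trans[OF abs_ge_zero jet_bound[OF jet this, of 0 0]] show ?thesis by simp
  qed
  have ij2: "i + j \<le> 2" "i + Suc j \<le> 2" using ij by simp_all
  have lip: "\<bar>D i j x' y' - D i j x y\<bar> \<le> K * (\<bar>x' - x\<bar> + \<bar>y' - y\<bar>)"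
    if "x \<in> {a..b}" "x' \<in> {a..b}" "y \<in> {c..d}" "y' \<in> {c..d}" for x x' y y'
    using jet_lipschitz_x[OF jet that(1,4) ij2(1) that(2)] jet_lipschitz_y[OF jet that(1,3) ij2(1) that(4)]
    unfolding distrib_left by linarith
  have tay: "\<bar>D i j (x + s) (y + t) - D i j x y - s * D (Suc i) j x y - t * D i (Suc j) x y\<bar>
      \<le> K * (\<bar>s\<bar> + \<bar>t\<bar>)\<^sup>2"
    if "x \<in> {a..b}" "x + s \<in> {a..b}" "y \<in> {c..d}" "y + t \<in> {c..d}" for x y s t
  proof -
    have 1: "\<bar>D i j (x + s) y - D i j x y - s * D (Suc i) j x y\<bar> \<le> K * s\<^sup>2"
      using jet_taylor_x[OF jet that(1,3) ij that(2)] by simp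
    have 2: "\<bar>D i j (x + s) (y + t) - D i j (x + s) y - t * D i (Suc j) (x + s) y\<bar> \<le> K * t\<^sup>2"
      using jet_taylor_y[OF jet that(2,3) ij that(4)] by simp
    have "\<bar>t * D i (Suc j) (x + s) y - t * D i (Suc j) x y\<bar>
        = \<bar>t\<bar> * \<bar>D i (Suc j) (x + s) y - D i (Suc j) x y\<bar>"
      by (simp add: abs_mult flip: right_diff_distrib)
    also have "\<dots> \<le> \<bar>t\<bar> * (K * \<bar>s\<bar>)"
      using jet_lipschitz_x[OF jet that(1,3) ij2(2) that(2)] by (intro mult_left_mono) simp_all
    finally have 3: "\<bar>t * D i (Suc j) (x + s) y - t * D i (Suc j) x y\<bar> \<le> \<bar>t\<bar> * (K * \<bar>s\<bar>)" .
    have 4: "K * s\<^sup>2 + (K * t\<^sup>2 + \<bar>t\<bar> * (K * \<bar>s\<bar>)) \<le> K * (\<bar>s\<bar> + \<bar>t\<bar>)\<^sup>2"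
      using mult_nonneg_nonneg[OF K, of "\<bar>s\<bar> * \<bar>t\<bar>"] by (simp add: power2_sum algebra_simps)
    define P where "P = K * s\<^sup>2"
    define Q where "Q = K * t\<^sup>2"
    define R where "R = \<bar>t\<bar> * (K * \<bar>s\<bar>)"
    show ?thesis
      using 1 2 3 4 unfolding P_def[symmetric] Q_def[symmetric] R_def[symmetric] by linarith
  qed
  show ?thesis
    unfolding second_order_def
  proof (intro conjI ballI allI impI)
    fix x y assume xy: "x \<in> {a..b}" "y \<in> {c..d}"
    show "\<bar>D i j x y\<bar> \<le> 2 * K" using jet_bound[OF jet xy ij2(1)] K by linarith
    fix s t assume st: "x + s \<in> {a..b}" "x - s \<in> {a..b}" "y + t \<in> {c..d}" "y - t \<in> {c..d}"
    have "\<bar>D i j (x - s) (y - t) - D i j x y + s * D (Suc i) j x y + t * D i (Suc j) x y\<bar>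
      \<le> K * (\<bar>s\<bar> + \<bar>t\<bar>)\<^sup>2"
      using tay[of x "- s" y "- t"] xy st by simp
    with tay[OF xy(1) st(1) xy(2) st(3)]
    show "\<bar>D i j (x + s) (y + t) + D i j (x - s) (y - t) - 2 * D i j x y\<bar> \<le> 2 * K * (\<bar>s\<bar> + \<bar>t\<bar>)\<^sup>2"
      by linarith
  next
    fix x x' y y' assume "x \<in> {a..b}" "x' \<in> {a..b}" "y \<in> {c..d}" "y' \<in> {c..d}"
    from lip[OF this] show "\<bar>D i j x' y' - D i j x y\<bar> \<le> 2 * K * (\<bar>x' - x\<bar> + \<bar>y' - y\<bar>)"
      using mult_nonneg_nonneg[OF K, of "\<bar>x' - x\<bar> + \<bar>y' - y\<bar>"] by simp
  qed
qed

lemma has_derivative_of_quadratic_bound: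
  fixes g :: "real \<Rightarrow> real"
  assumes "\<And>z. z \<in> S \<Longrightarrow> \<bar>g z - g x - (z - x) * D\<bar> \<le> K * (z - x)\<^sup>2"
  shows "(g has_real_derivative D) (at x within S)"
  unfolding has_field_derivative_iff
proof (rule LIM_zero_cancel, rule Lim_null_comparison)
  have "((\<lambda>z. K * \<bar>z - x\<bar>) \<longlongrightarrow> K * \<bar>x - x\<bar>) (at x within S)"
    by (intro tendsto_intros)
  then show "((\<lambda>z. K * \<bar>z - x\<bar>) \<longlongrightarrow> 0) (at x within S)" by simp
  show "\<forall>\<^sub>F z in at x within S. norm ((g z - g x) / (z - x) - D) \<le> K * \<bar>z - x\<bar>"
    unfolding eventually_at_filter
  proof (rule always_eventually, intro allI impI)
    fix z assume z: "z \<noteq> x" "z \<in> S"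
    have "\<bar>(g z - g x) / (z - x) - D\<bar> = \<bar>g z - g x - (z - x) * D\<bar> / \<bar>z - x\<bar>"
    proof -
      have "(g z - g x) / (z - x) - D = (g z - g x - (z - x) * D) / (z - x)"
        using z by (simp add: diff_divide_distrib)
      then show ?thesis by (simp only: abs_divide)
    qed
    also have "\<dots> \<le> K * (z - x)\<^sup>2 / \<bar>z - x\<bar>"
      using assms[OF z(2)] by (intro divide_right_mono) auto
    also have "\<dots> = K * \<bar>z - x\<bar>"
    proof -
      have "(z - x)\<^sup>2 / \<bar>z - x\<bar> = \<bar>z - x\<bar>"
        using z by (simp add: divide_eq_eq power2_eq_square)
      then show ?thesis by (simp only: times_divide_eq_right[symmetric])
    qed
    finally show "norm ((g z - g x) / (z - x) - D) \<le> K * \<bar>z - x\<bar>" by simp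
  qed
qed

lemma jet_derivative_x:
  assumes "jet K a b c d D" "i + j \<le> 1" "x \<in> {a..b}" "y \<in> {c..d}"
  shows "((\<lambda>s. D i j s y) has_real_derivative D (Suc i) j x y) (at x within {a..b})"
  by (rule has_derivative_of_quadratic_bound) (rule jet_taylor_x[OF assms(1,3,4,2)])

lemma jet_derivative_y:
  assumes "jet K a b c d D" "i + j \<le> 1" "x \<in> {a..b}" "y \<in> {c..d}"
  shows "((\<lambda>s. D i j x s) has_real_derivative D i (Suc j) x y) (at y within {c..d})"
  by (rule has_derivative_of_quadratic_bound) (rule jet_taylor_y[OF assms(1,3,4,2)])

lemma second_order_continuous_on:
  assumes F: "second_order \<kappa> I J F" and f: "\<And>x y. x \<in> I \<Longrightarrow> y \<in> J \<Longrightarrow> f (x, y) = F x y"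
  shows "continuous_on (I \<times> J) f"
proof (cases "I \<times> J = {}")
  case False
  then obtain x y where xy: "x \<in> I" "y \<in> J" by auto
  have \<kappa>: "0 \<le> \<kappa>" by (rule order_trans[OF abs_ge_zero second_order_bound[OF F xy]])
  have "(2 * \<kappa>)-lipschitz_on (I \<times> J) f"
  proof (rule lipschitz_onI)
    fix p p' assume p: "p \<in> I \<times> J" "p' \<in> I \<times> J"
    obtain x y x' y' where pp: "p = (x, y)" "p' = (x', y')" by (cases p, cases p')
    have "\<bar>F x y - F x' y'\<bar> \<le> \<kappa> * (\<bar>x - x'\<bar> + \<bar>y - y'\<bar>)"
      by (rule second_order_lipschitz[OF F]) (use p in \<open>auto simp: pp\<close>)
    also have "\<dots> \<le> \<kappa> * (2 * dist p p')"
    proof (rule mult_left_mono[OF _ \<kappa>])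
      have "\<bar>x - x'\<bar> \<le> dist p p'" "\<bar>y - y'\<bar> \<le> dist p p'"
        using dist_fst_le[of p p'] dist_snd_le[of p p'] by (simp_all add: pp dist_real_def)
      then show "\<bar>x - x'\<bar> + \<bar>y - y'\<bar> \<le> 2 * dist p p'" by simp
    qed
    finally show "dist (f p) (f p') \<le> 2 * \<kappa> * dist p p'"
      using p f by (simp add: pp dist_real_def)
  qed (use \<kappa> in simp)
  then show ?thesis by (rule lipschitz_on_continuous_on)
qed auto

text \<open>The one-sided derivatives on the closed rectangle that occur in \<open>gradient\<close> and \<open>delta_h\<close> are read off
  from the jet. Applied twice, this also yields second derivatives.\<close>

lemma partial_of_jet:
  assumes ab: "a < b" "c < d" and jet: "jet K a b c d D" and ij: "i + j \<le> 1"
    and g: "\<And>x y. x \<in> {a..b} \<Longrightarrow> y \<in> {c..d} \<Longrightarrow> g (x, y) = D i j x y"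
    and xy: "x \<in> {a..b}" "y \<in> {c..d}"
  shows "partial_x ({a..b} \<times> {c..d}) g (x, y) = D (Suc i) j x y"
    and "partial_y ({a..b} \<times> {c..d}) g (x, y) = D i (Suc j) x y"
proof -
  have "((\<lambda>s. g (s, y)) has_real_derivative D (Suc i) j x y) (at x within {a..b})"
    by (rule has_field_derivative_transform_within[OF jet_derivative_x[OF jet ij xy] zero_less_one xy(1)])
       (use xy in \<open>simp add: g\<close>)
  moreover have "{s. (s, y) \<in> {a..b} \<times> {c..d}} = {a..b}" using xy by auto
  ultimately show "partial_x ({a..b} \<times> {c..d}) g (x, y) = D (Suc i) j x y"
    unfolding partial_x_def fst_conv snd_conv
    using vector_derivative_within_closed_interval[OF ab(1) xy(1)]
    by (simp add: has_real_derivative_iff_has_vector_derivative)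
  have "((\<lambda>s. g (x, s)) has_real_derivative D i (Suc j) x y) (at y within {c..d})"
    by (rule has_field_derivative_transform_within[OF jet_derivative_y[OF jet ij xy] zero_less_one xy(2)])
       (use xy in \<open>simp add: g\<close>)
  moreover have "{s. (x, s) \<in> {a..b} \<times> {c..d}} = {c..d}" using xy by auto
  ultimately show "partial_y ({a..b} \<times> {c..d}) g (x, y) = D i (Suc j) x y"
    unfolding partial_y_def fst_conv snd_conv
    using vector_derivative_within_closed_interval[OF ab(2) xy(2)]
    by (simp add: has_real_derivative_iff_has_vector_derivative)
qed

section \<open>Edge means\<close>

text \<open>The mean over \<open>[p, q]\<close>, parametrized in the same way as \<open>edge_integral\<close>.\<close>

definition eavg :: "real \<Rightarrow> real \<Rightarrow> (real \<Rightarrow> real) \<Rightarrow> real" where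
  "eavg p q g = integral {0..1} (\<lambda>s. g ((1 - s) * p + s * q))"

lemma segment_point:
  fixes p q s :: real
  assumes "p \<le> q" "s \<in> {0..1}"
  shows "(1 - s) * p + s * q \<in> {p..q}"
proof -
  have "(1 - s) * p + s * q = p + s * (q - p)" by (simp add: algebra_simps)
  moreover have "0 \<le> s * (q - p)" using assms by simp
  moreover have "s * (q - p) \<le> 1 * (q - p)" by (rule mult_right_mono) (use assms in simp_all)
  ultimately show ?thesis by simp
qed

lemma eavg_has_integral:
  assumes "continuous_on {p..q} g" "p \<le> q"
  shows "((\<lambda>s. g ((1 - s) * p + s * q)) has_integral eavg p q g) {0..1}"
  unfolding eavg_def
proof (intro integrable_integral integrable_continuous_interval)
  show "continuous_on {0..1} (\<lambda>s. g ((1 - s) * p + s * q))"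
    by (rule continuous_on_compose2[OF assms(1)]) (use segment_point[OF assms(2)] in \<open>auto intro!: continuous_intros\<close>)
qed

lemma eavg_bound:
  assumes "continuous_on {p..q} g" "p \<le> q" "\<And>z. z \<in> {p..q} \<Longrightarrow> \<bar>g z\<bar> \<le> B"
  shows "\<bar>eavg p q g\<bar> \<le> B"
proof -
  have B: "0 \<le> B" using assms(2) order_trans[OF abs_ge_zero assms(3)[of p]] by simp
  have "norm (eavg p q g) \<le> B * measure lborel {0..1::real}"
  proof (rule has_integral_bound_real[OF B finite.emptyI eavg_has_integral[OF assms(1,2)]])
    fix s :: real assume "s \<in> {0..1} - {}"
    then show "norm (g ((1 - s) * p + s * q)) \<le> B"
      using assms(3) segment_point[OF assms(2)] by simp
  qed
  then show ?thesis by simp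
qed

text \<open>Pairing the parameters \<open>s\<close> and \<open>1 - s\<close> turns the error into the mean of a symmetric second difference.\<close>

lemma eavg_near_midpoint:
  assumes g: "continuous_on {p..q} g" and pq: "p \<le> q" and \<kappa>: "\<kappa> \<ge> 0"
    and diff: "\<And>t. \<bar>t\<bar> \<le> (q - p) / 2 \<Longrightarrow>
      \<bar>g ((p + q) / 2 + t) + g ((p + q) / 2 - t) - 2 * g ((p + q) / 2)\<bar> \<le> \<kappa> * t\<^sup>2"
  shows "\<bar>eavg p q g - g ((p + q) / 2)\<bar> \<le> \<kappa> * (q - p)\<^sup>2"
proof -
  let ?h = "\<lambda>s. g ((1 - s) * p + s * q)" and ?m = "g ((p + q) / 2)"
  have 1: "(?h has_integral eavg p q g) {0..1}" by (rule eavg_has_integral[OF g pq])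
  have 2: "((\<lambda>s. ?h (1 - s)) has_integral eavg p q g) {0..1}"
    using has_integral_affinity[of ?h "eavg p q g" 0 1 "-1" 1] 1 by simp
  have 3: "((\<lambda>s. ?h s + ?h (1 - s) - 2 * ?m) has_integral (eavg p q g + eavg p q g - 2 * ?m)) {0..1}"
    using has_integral_diff[OF has_integral_add[OF 1 2] has_integral_const_real[of "2 * ?m" 0 1]] by simp
  have "norm (eavg p q g + eavg p q g - 2 * ?m) \<le> (\<kappa> * (q - p)\<^sup>2) * measure lborel {0..1::real}"
  proof (rule has_integral_bound_real[OF _ finite.emptyI 3])
    show "0 \<le> \<kappa> * (q - p)\<^sup>2" using \<kappa> by simp
    fix s :: real assume s: "s \<in> {0..1} - {}"
    define t where "t = (s - 1 / 2) * (q - p)"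
    have t: "\<bar>t\<bar> \<le> (q - p) / 2"
    proof -
      have "0 \<le> s" "s \<le> 1" using s by simp_all
      then have "\<bar>s - 1 / 2\<bar> \<le> 1 / 2" by linarith
      then have "\<bar>s - 1 / 2\<bar> * \<bar>q - p\<bar> \<le> 1 / 2 * \<bar>q - p\<bar>"
        by (rule mult_right_mono) simp
      then show ?thesis using pq by (simp add: t_def abs_mult)
    qed
    have e: "(1 - s) * p + s * q = (p + q) / 2 + t" "(1 - (1 - s)) * p + (1 - s) * q = (p + q) / 2 - t"
      by (simp_all add: t_def field_simps)
    have "\<bar>t\<bar>\<^sup>2 \<le> (q - p)\<^sup>2" by (rule power_mono) (use t pq in simp_all)
    then have "\<kappa> * t\<^sup>2 \<le> \<kappa> * (q - p)\<^sup>2" using \<kappa> by (intro mult_left_mono) simp_all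
    with diff[OF t] show "norm (?h s + ?h (1 - s) - 2 * ?m) \<le> \<kappa> * (q - p)\<^sup>2"
      unfolding e real_norm_def by (rule order_trans)
  qed
  then have "\<bar>eavg p q g + eavg p q g - 2 * ?m\<bar> \<le> \<kappa> * (q - p)\<^sup>2" by simp
  then show ?thesis by linarith
qed

lemma increment_eq_eavg:
  assumes "p \<le> q" and g: "\<And>z. z \<in> {p..q} \<Longrightarrow> (g has_real_derivative g' z) (at z within {p..q})"
  shows "g q - g p = (q - p) * eavg p q g'"
proof -
  let ?l = "\<lambda>s. (1 - s) * p + s * q"
  have "((\<lambda>s. g (?l s)) has_real_derivative g' (?l s) * (q - p)) (at s within {0..1})"
    if s: "s \<in> {0..1}" for s
  proof -
    have "(g has_real_derivative g' (?l s)) (at (?l s) within ?l ` {0..1})"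
      by (rule has_field_derivative_subset[OF g]) (use segment_point[OF assms(1)] s in auto)
    moreover have "(?l has_real_derivative (q - p)) (at s within {0..1})"
      by (auto intro!: derivative_eq_intros)
    ultimately show ?thesis using DERIV_image_chain by (fastforce simp: o_def)
  qed
  then have "((\<lambda>s. g' (?l s) * (q - p)) has_integral g (?l 1) - g (?l 0)) {0..1}"
    by (intro fundamental_theorem_of_calculus) (auto simp: has_real_derivative_iff_has_vector_derivative)
  then have "integral {0..1} (\<lambda>s. g' (?l s) * (q - p)) = g (?l 1) - g (?l 0)"
    by (rule integral_unique)
  then show ?thesis unfolding eavg_def by (simp add: mult.commute)
qed

lemma second_order_continuous_x:
  assumes "second_order \<kappa> I J F" "y \<in> J"
  shows "continuous_on I (\<lambda>x. F x y)"
proof (cases "I = {}")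
  case False
  then obtain x where "x \<in> I" by blast
  then have \<kappa>: "0 \<le> \<kappa>" using order_trans[OF abs_ge_zero second_order_bound[OF assms(1) _ assms(2)]] by blast
  have "\<kappa>-lipschitz_on I (\<lambda>x. F x y)"
  proof (rule lipschitz_onI[OF _ \<kappa>])
    fix x x' assume "x \<in> I" "x' \<in> I"
    from second_order_lipschitz[OF assms(1) this(2) assms(2) this(1) assms(2)]
    show "dist (F x y) (F x' y) \<le> \<kappa> * dist x x'" by (simp add: dist_real_def)
  qed
  then show ?thesis by (rule lipschitz_on_continuous_on)
qed simp

lemma second_order_continuous_y:
  "second_order \<kappa> I J F \<Longrightarrow> x \<in> I \<Longrightarrow> continuous_on J (F x)"
  using second_order_continuous_x[OF second_order_swap] by simp

lemma second_order_eavg_x: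
  assumes F: "second_order \<kappa> {a..b} J F" and "y \<in> J" "a \<le> p" "p \<le> q" "q \<le> b"
  shows "\<bar>eavg p q (\<lambda>x. F x y) - F ((p + q) / 2) y\<bar> \<le> \<kappa> * (q - p)\<^sup>2"
proof (rule eavg_near_midpoint)
  have m: "(p + q) / 2 \<in> {a..b}" using assms by simp
  show "continuous_on {p..q} (\<lambda>x. F x y)"
    by (rule continuous_on_subset[OF second_order_continuous_x[OF F assms(2)]]) (use assms in auto)
  show "0 \<le> \<kappa>" by (rule order_trans[OF abs_ge_zero second_order_bound[OF F m assms(2)]])
  show "\<bar>F ((p + q) / 2 + t) y + F ((p + q) / 2 - t) y - 2 * F ((p + q) / 2) y\<bar> \<le> \<kappa> * t\<^sup>2"
    if "\<bar>t\<bar> \<le> (q - p) / 2" for t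
  proof -
    have "-((q - p) / 2) \<le> t" "t \<le> (q - p) / 2" using that by linarith+
    then have "(p + q) / 2 + t \<in> {a..b}" "(p + q) / 2 - t \<in> {a..b}"
      using assms by (auto simp: field_simps)
    from second_order_difference[OF F m assms(2) this, of 0] assms(2) show ?thesis by simp
  qed
qed (rule assms)

lemma second_order_eavg_y:
  assumes "second_order \<kappa> I {c..d} F" "x \<in> I" "c \<le> p" "p \<le> q" "q \<le> d"
  shows "\<bar>eavg p q (F x) - F x ((p + q) / 2)\<bar> \<le> \<kappa> * (q - p)\<^sup>2"
  using second_order_eavg_x[OF second_order_swap[OF assms(1)] assms(2-)] by simp

lemma eavg_cong: "p \<le> q \<Longrightarrow> (\<And>z. z \<in> {p..q} \<Longrightarrow> f z = g z) \<Longrightarrow> eavg p q f = eavg p q g"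
  unfolding eavg_def by (rule integral_cong) (use segment_point in blast)

section \<open>Consistency on a single cell\<close>

text \<open>The weights of \<open>v0\<close> and \<open>v1\<close> are split into their symmetric and antisymmetric parts: \<open>I0\<close> and \<open>I1\<close> are the
  exact integrals over the two triangles, \<open>F\<close> is the flux difference and \<open>g0\<close>, \<open>g1\<close> are the cross terms. The
  symmetric parts agree to second order with \<open>c (f1 + f2)\<close>, the antisymmetric ones are of first
  order.\<close>

lemma cell_error_bound:
  fixes I0 I1 v0 v1 :: real
  assumes c: "0 \<le> c" "0 \<le> h" and C: "0 \<le> A" "0 \<le> A1" "0 \<le> A2" "0 \<le> B" "0 \<le> B2"
    and mean: "\<bar>I0 + I1 - c * (f1 + f2)\<bar> \<le> c * (A * h\<^sup>2)"
    and diff: "\<bar>I1 - I0\<bar> \<le> c * (B * h)"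
    and flux: "\<bar>F - c * f1\<bar> \<le> c * (A1 * h\<^sup>2)"
    and cross: "\<bar>(g0 + g1) / 2 - f2\<bar> \<le> A2 * h\<^sup>2" "\<bar>g1 - g0\<bar> \<le> B2 * h"
  shows "\<bar>I0 * v0 + I1 * v1 - (F * ((v0 + v1) / 2) + c / 2 * (g0 * v0 + g1 * v1))\<bar>
    \<le> (A + A1 + A2 + B + B2) * (c * (h\<^sup>2 * (\<bar>v0\<bar> + \<bar>v1\<bar>) + h * \<bar>v1 - v0\<bar>))"
proof -
  define s where "s = (v0 + v1) / 2"
  define t where "t = (v1 - v0) / 2"
  define V where "V = h\<^sup>2 * (\<bar>v0\<bar> + \<bar>v1\<bar>)"
  define D where "D = h * \<bar>v1 - v0\<bar>"
  have s: "\<bar>s\<bar> \<le> \<bar>v0\<bar> + \<bar>v1\<bar>" and t: "\<bar>t\<bar> \<le> \<bar>v1 - v0\<bar>" by (simp_all add: s_def t_def)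
  have eq: "I0 * v0 + I1 * v1 - (F * ((v0 + v1) / 2) + c / 2 * (g0 * v0 + g1 * v1))
     = (I0 + I1 - c * (f1 + f2)) * s + (F - c * f1) * (- s) + c * ((g0 + g1) / 2 - f2) * (- s)
       + (I1 - I0) * t + c * (g1 - g0) * (- t / 2)"
    by (simp add: s_def t_def field_simps)
  have cross': "\<bar>c * ((g0 + g1) / 2 - f2)\<bar> \<le> c * (A2 * h\<^sup>2)" "\<bar>c * (g1 - g0)\<bar> \<le> c * (B2 * h)"
    using cross c by (intro abs_mult_le; simp)+
  have s': "\<bar>- s\<bar> \<le> \<bar>v0\<bar> + \<bar>v1\<bar>" using s by simp
  have t': "\<bar>- t / 2\<bar> \<le> \<bar>v1 - v0\<bar>" using t by argo
  have "\<bar>I0 * v0 + I1 * v1 - (F * ((v0 + v1) / 2) + c / 2 * (g0 * v0 + g1 * v1))\<bar>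
     \<le> c * (A * h\<^sup>2) * (\<bar>v0\<bar> + \<bar>v1\<bar>) + c * (A1 * h\<^sup>2) * (\<bar>v0\<bar> + \<bar>v1\<bar>) + c * (A2 * h\<^sup>2) * (\<bar>v0\<bar> + \<bar>v1\<bar>)
       + c * (B * h) * \<bar>v1 - v0\<bar> + c * (B2 * h) * \<bar>v1 - v0\<bar>"
    unfolding eq
    by (intro order_trans[OF abs_triangle_ineq] add_mono abs_mult_le mean diff flux cross' s s' t t')
  also have "\<dots> = (A + A1 + A2) * (c * V) + (B + B2) * (c * D)"
    by (simp add: V_def D_def algebra_simps)
  also have "\<dots> \<le> (A + A1 + A2 + B + B2) * (c * (V + D))"
  proof -
    have "0 \<le> (A + A1 + A2) * (c * D) + (B + B2) * (c * V)"
      using c C by (simp add: V_def D_def)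
    then show ?thesis by (simp add: algebra_simps)
  qed
  finally show ?thesis by (simp add: V_def D_def)
qed

lemma mean_close:
  fixes p q m :: real
  assumes "\<bar>(p + q) / 2 - m\<bar> \<le> A" "\<bar>p' - p\<bar> \<le> B" "\<bar>q' - q\<bar> \<le> B"
  shows "\<bar>(p' + q') / 2 - m\<bar> \<le> A + B"
  using assms by argo

text \<open>A cell \<open>[x0, x1] \<times> [y0, y1]\<close> on which the component \<open>U\<close> is transported by the field \<open>(U, W)\<close>. For the second
  component of the velocity the coordinates and the roles of the two jets are exchanged.\<close>

locale transport_cell =
  fixes K L a b c d x0 x1 y0 y1 h :: real and DU DW :: "nat \<Rightarrow> nat \<Rightarrow> real \<Rightarrow> real \<Rightarrow> real"
  assumes jetU: "jet K a b c d DU" and jetW: "jet K a b c d DW"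
    and x: "a \<le> x0" "x0 < x1" "x1 \<le> b" and y: "c \<le> y0" "y0 < y1" "y1 \<le> d"
    and h: "x1 - x0 \<le> h" "y1 - y0 \<le> h" "h \<le> L"
begin

definition xm where "xm = (x0 + x1) / 2"
definition ym where "ym = (y0 + y1) / 2"

text \<open>The \<open>second_order\<close> constant of \<open>U\<close>, \<open>U\<^sub>x\<close>, \<open>U\<^sub>y\<close> and \<open>W\<close>, from \<open>jet_second_order\<close>.\<close>

definition "\<kappa> = 2 * K"
abbreviation "U \<equiv> DU 0 0"
abbreviation "U\<^sub>x \<equiv> DU 1 0"
abbreviation "U\<^sub>y \<equiv> DU 0 1"
abbreviation "U\<^sub>y\<^sub>y \<equiv> DU 0 2"
abbreviation "W \<equiv> DW 0 0"
abbreviation "W\<^sub>x\<^sub>x \<equiv> DW 2 0"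

text \<open>The corrected interpolants of \<open>U\<close> on the vertical edge at \<open>x\<close> and of \<open>W\<close> on the horizontal edge at \<open>y\<close>, and
  the interpolant of \<open>U\<^sub>y\<close> on the latter edge.\<close>

definition u_tilde where "u_tilde x = eavg y0 y1 (U x) - (y1 - y0)\<^sup>2 / 6 * U\<^sub>y\<^sub>y x ym"
definition w_tilde where "w_tilde y = eavg x0 x1 (\<lambda>x. W x y) - (x1 - x0)\<^sup>2 / 6 * W\<^sub>x\<^sub>x xm y"
definition s_tilde where "s_tilde y = eavg x0 x1 (\<lambda>x. U\<^sub>y x y)"

lemma mid_in: "xm \<in> {a..b}" "ym \<in> {c..d}"
  using x y by (simp_all add: xm_def ym_def)

lemma ends_in: "x0 \<in> {a..b}" "x1 \<in> {a..b}" "y0 \<in> {c..d}" "y1 \<in> {c..d}"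
  using x y by simp_all

lemma h_pos: "0 < h" and L_pos: "0 < L"
  using x h by linarith+

lemma so_fields: "second_order \<kappa> {a..b} {c..d} U" "second_order \<kappa> {a..b} {c..d} U\<^sub>x"
  "second_order \<kappa> {a..b} {c..d} U\<^sub>y" "second_order \<kappa> {a..b} {c..d} W"
  unfolding \<kappa>_def
  by (rule jet_second_order[OF jetU] jet_second_order[OF jetW]; use x y in simp)+

lemma K_nonneg: "0 \<le> K"
  using order_trans[OF abs_ge_zero jet_bound[OF jetU mid_in, of 0 0]] by simp

lemma \<kappa>_nonneg: "0 \<le> \<kappa>" and K_le_\<kappa>: "K \<le> \<kappa>"
  using K_nonneg by (simp_all add: \<kappa>_def)

lemma hx_sq: "(x1 - x0)\<^sup>2 \<le> h\<^sup>2" and hy_sq: "(y1 - y0)\<^sup>2 \<le> h\<^sup>2"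
  by (rule power_mono; use x y h in simp)+

lemma hx_sq_frac: "(x1 - x0)\<^sup>2 / 4 \<le> h\<^sup>2" "(x1 - x0)\<^sup>2 / 6 \<le> h\<^sup>2"
  and hy_sq_frac: "(y1 - y0)\<^sup>2 / 4 \<le> h\<^sup>2" "(y1 - y0)\<^sup>2 / 6 \<le> h\<^sup>2"
  using hx_sq hy_sq zero_le_power2[of "x1 - x0"] zero_le_power2[of "y1 - y0"] by linarith+

lemma h_sq_le: "h\<^sup>2 \<le> L\<^sup>2" and h_sq_le': "h\<^sup>2 \<le> L * h"
  using h_pos h by (auto simp: power2_eq_square intro: mult_right_mono mult_mono)

lemma \<kappa>_hx_sq: "\<kappa> * (x1 - x0)\<^sup>2 \<le> \<kappa> * h\<^sup>2" and \<kappa>_hy_sq: "\<kappa> * (y1 - y0)\<^sup>2 \<le> \<kappa> * h\<^sup>2"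
  by (rule mult_left_mono[OF hx_sq \<kappa>_nonneg], rule mult_left_mono[OF hy_sq \<kappa>_nonneg])

lemma mid_diff_x:
  assumes F: "second_order \<kappa> {a..b} {c..d} F" and z: "z \<in> {c..d}"
  shows "\<bar>(F x0 z + F x1 z) / 2 - F xm z\<bar> \<le> \<kappa> * h\<^sup>2"
proof -
  define t where "t = (x1 - x0) / 2"
  have e: "xm + t = x1" "xm - t = x0" by (simp_all add: t_def xm_def field_simps)
  have "\<bar>F x1 z + F x0 z - 2 * F xm z\<bar> \<le> \<kappa> * (\<bar>t\<bar> + \<bar>0\<bar>)\<^sup>2"
    using second_order_difference[OF F mid_in(1) z, of t 0] e ends_in z by simp
  also have "(\<bar>t\<bar> + \<bar>0\<bar>)\<^sup>2 = (x1 - x0)\<^sup>2 / 4" by (simp add: t_def power_divide)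
  also have "\<kappa> * ((x1 - x0)\<^sup>2 / 4) \<le> \<kappa> * h\<^sup>2"
    by (rule mult_left_mono[OF hx_sq_frac(1) \<kappa>_nonneg])
  finally show ?thesis by argo
qed

lemma mid_diff_y:
  assumes F: "second_order \<mu> {a..b} {c..d} F" and z: "z \<in> {a..b}"
  shows "\<bar>(F z y0 + F z y1) / 2 - F z ym\<bar> \<le> \<mu> * h\<^sup>2"
proof -
  have \<mu>: "0 \<le> \<mu>" by (rule order_trans[OF abs_ge_zero second_order_bound[OF F z mid_in(2)]])
  define t where "t = (y1 - y0) / 2"
  have e: "ym + t = y1" "ym - t = y0" by (simp_all add: t_def ym_def field_simps)
  have "\<bar>F z y1 + F z y0 - 2 * F z ym\<bar> \<le> \<mu> * (\<bar>0\<bar> + \<bar>t\<bar>)\<^sup>2"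
    using second_order_difference[OF F z mid_in(2), of 0 t] e ends_in z by simp
  also have "(\<bar>0\<bar> + \<bar>t\<bar>)\<^sup>2 = (y1 - y0)\<^sup>2 / 4" by (simp add: t_def power_divide)
  also have "\<mu> * ((y1 - y0)\<^sup>2 / 4) \<le> \<mu> * h\<^sup>2"
    by (rule mult_left_mono[OF hy_sq_frac(1) \<mu>])
  finally show ?thesis by argo
qed

lemma u_tilde_near: 
  assumes "z \<in> {a..b}"
  shows "\<bar>u_tilde z - U z ym\<bar> \<le> 2 * \<kappa> * h\<^sup>2"
proof -
  have 1: "\<bar>eavg y0 y1 (U z) - U z ym\<bar> \<le> \<kappa> * (y1 - y0)\<^sup>2"
    unfolding ym_def by (rule second_order_eavg_y[OF so_fields(1) assms]) (use y in simp_all)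
  have "\<bar>(y1 - y0)\<^sup>2 / 6 * U\<^sub>y\<^sub>y z ym\<bar> \<le> h\<^sup>2 * \<kappa>"
    by (rule abs_mult_le)
      (use hy_sq_frac(2) order_trans[OF jet_bound[OF jetU assms mid_in(2), of 0 2] K_le_\<kappa>] in simp_all)
  then show ?thesis using 1 \<kappa>_hy_sq unfolding u_tilde_def mult.commute[of "h\<^sup>2"] by linarith
qed

text \<open>The increment of the edge mean is \<open>x1 - x0\<close> times a mean of \<open>U\<^sub>x\<close> over the cell, which is close to the value at
  the midpoint. The correction term gains the factor \<open>x1 - x0\<close> from the Lipschitz continuity of
  \<open>U\<^sub>y\<^sub>y\<close>.\<close>

lemma u_tilde_increment:
  "\<bar>u_tilde x1 - u_tilde x0 - (x1 - x0) * U\<^sub>x xm ym\<bar> \<le> (x1 - x0) * (3 * \<kappa> * h\<^sup>2)"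
proof -
  have incr: "\<bar>U x1 z - U x0 z - (x1 - x0) * U\<^sub>x xm z\<bar> \<le> (x1 - x0) * (\<kappa> * h\<^sup>2)"
    if z: "z \<in> {y0..y1}" for z
  proof -
    have z': "z \<in> {c..d}" using z y by simp
    have "U x1 z - U x0 z = (x1 - x0) * eavg x0 x1 (\<lambda>x. U\<^sub>x x z)"
    proof (rule increment_eq_eavg)
      fix t assume "t \<in> {x0..x1}"
      then have "t \<in> {a..b}" using x by simp
      from jet_derivative_x[OF jetU _ this z', of 0 0]
      show "((\<lambda>t. U t z) has_real_derivative U\<^sub>x t z) (at t within {x0..x1})"
        using x by (auto intro: has_field_derivative_subset)
    qed (use x in simp)
    then have "U x1 z - U x0 z - (x1 - x0) * U\<^sub>x xm z = (x1 - x0) * (eavg x0 x1 (\<lambda>x. U\<^sub>x x z) - U\<^sub>x xm z)"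
      by (simp add: algebra_simps)
    also have "\<bar>\<dots>\<bar> \<le> (x1 - x0) * (\<kappa> * h\<^sup>2)"
    proof (rule abs_mult_le)
      have "\<bar>eavg x0 x1 (\<lambda>x. U\<^sub>x x z) - U\<^sub>x xm z\<bar> \<le> \<kappa> * (x1 - x0)\<^sup>2"
        unfolding xm_def by (rule second_order_eavg_x[OF so_fields(2) z']) (use x in simp_all)
      then show "\<bar>eavg x0 x1 (\<lambda>x. U\<^sub>x x z) - U\<^sub>x xm z\<bar> \<le> \<kappa> * h\<^sup>2" using \<kappa>_hx_sq by linarith
    qed (use x in simp)
    finally show ?thesis .
  qed
  have cont: "continuous_on {y0..y1} (F z)" if "second_order \<kappa> {a..b} {c..d} F" "z \<in> {a..b}" for F z
    by (rule continuous_on_subset[OF second_order_continuous_y[OF that]]) (use y in simp)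
  let ?g = "\<lambda>z. U x1 z - U x0 z - (x1 - x0) * U\<^sub>x xm z"
  have cont_g: "continuous_on {y0..y1} ?g"
    by (intro continuous_intros cont so_fields ends_in mid_in)
  have "eavg y0 y1 ?g = eavg y0 y1 (U x1) - eavg y0 y1 (U x0) - (x1 - x0) * eavg y0 y1 (U\<^sub>x xm)"
  proof (rule has_integral_unique[OF eavg_has_integral])
    show "continuous_on {y0..y1} ?g" by (rule cont_g)
    show "y0 \<le> y1" using y by simp
    then show "((\<lambda>s. ?g ((1 - s) * y0 + s * y1)) has_integral
        eavg y0 y1 (U x1) - eavg y0 y1 (U x0) - (x1 - x0) * eavg y0 y1 (U\<^sub>x xm)) {0..1}"
      by (intro has_integral_diff has_integral_mult_right eavg_has_integral cont so_fields ends_in mid_in)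
  qed
  moreover have "\<bar>eavg y0 y1 ?g\<bar> \<le> (x1 - x0) * (\<kappa> * h\<^sup>2)"
    by (rule eavg_bound[OF cont_g _ incr]) (use y in simp_all)
  moreover have "\<bar>(x1 - x0) * (eavg y0 y1 (U\<^sub>x xm) - U\<^sub>x xm ym)\<bar> \<le> (x1 - x0) * (\<kappa> * h\<^sup>2)"
  proof (rule abs_mult_le)
    have "\<bar>eavg y0 y1 (U\<^sub>x xm) - U\<^sub>x xm ym\<bar> \<le> \<kappa> * (y1 - y0)\<^sup>2"
      unfolding ym_def by (rule second_order_eavg_y[OF so_fields(2) mid_in(1)]) (use y in simp_all)
    then show "\<bar>eavg y0 y1 (U\<^sub>x xm) - U\<^sub>x xm ym\<bar> \<le> \<kappa> * h\<^sup>2" using \<kappa>_hy_sq by linarith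
  qed (use x in simp)
  moreover have "\<bar>(y1 - y0)\<^sup>2 / 6 * (U\<^sub>y\<^sub>y x1 ym - U\<^sub>y\<^sub>y x0 ym)\<bar> \<le> h\<^sup>2 * (\<kappa> * (x1 - x0))"
  proof (rule abs_mult_le)
    have "\<bar>U\<^sub>y\<^sub>y x1 ym - U\<^sub>y\<^sub>y x0 ym\<bar> \<le> K * (x1 - x0)"
      using jet_lipschitz_x[OF jetU ends_in(1) mid_in(2) _ ends_in(2), of 0 2] x by simp
    also have "K * (x1 - x0) \<le> \<kappa> * (x1 - x0)" using K_le_\<kappa> x by (intro mult_right_mono) simp_all
    finally show "\<bar>U\<^sub>y\<^sub>y x1 ym - U\<^sub>y\<^sub>y x0 ym\<bar> \<le> \<kappa> * (x1 - x0)" .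
  qed (use hy_sq_frac(2) in simp)
  moreover have "h\<^sup>2 * (\<kappa> * (x1 - x0)) = (x1 - x0) * (\<kappa> * h\<^sup>2)" by simp
  moreover have "u_tilde x1 - u_tilde x0 - (x1 - x0) * U\<^sub>x xm ym
      = (eavg y0 y1 (U x1) - eavg y0 y1 (U x0) - (x1 - x0) * eavg y0 y1 (U\<^sub>x xm))
        + (x1 - x0) * (eavg y0 y1 (U\<^sub>x xm) - U\<^sub>x xm ym)
        - (y1 - y0)\<^sup>2 / 6 * (U\<^sub>y\<^sub>y x1 ym - U\<^sub>y\<^sub>y x0 ym)"
    unfolding u_tilde_def by (simp add: algebra_simps)
  moreover have "(x1 - x0) * (3 * \<kappa> * h\<^sup>2) = 3 * ((x1 - x0) * (\<kappa> * h\<^sup>2))" by simp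
  ultimately show ?thesis by linarith
qed

text \<open>Half the difference of squares is the mean times the increment of \<open>u_tilde\<close>, and both are known up to
  second order.\<close>

lemma flux_consistent:
  "\<bar>((u_tilde x1)\<^sup>2 - (u_tilde x0)\<^sup>2) / 2 - (x1 - x0) * (U xm ym * U\<^sub>x xm ym)\<bar>
     \<le> (x1 - x0) * (\<kappa>\<^sup>2 * (6 + 9 * L\<^sup>2) * h\<^sup>2)"
proof -
  define S where "S = (u_tilde x0 + u_tilde x1) / 2"
  define \<Delta> where "\<Delta> = u_tilde x1 - u_tilde x0"
  have S: "\<bar>S - U xm ym\<bar> \<le> 3 * \<kappa> * h\<^sup>2"
    using u_tilde_near[OF ends_in(1)] u_tilde_near[OF ends_in(2)] mid_diff_x[OF so_fields(1) mid_in(2)]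
    unfolding S_def by argo
  have Um: "\<bar>U xm ym\<bar> \<le> \<kappa>" "\<bar>U\<^sub>x xm ym\<bar> \<le> \<kappa>"
    using second_order_bound[OF so_fields(1) mid_in] second_order_bound[OF so_fields(2) mid_in] by simp_all
  have "3 * \<kappa> * h\<^sup>2 \<le> 3 * \<kappa> * L\<^sup>2" using h_sq_le \<kappa>_nonneg by (intro mult_left_mono) simp_all
  then have S': "\<bar>S\<bar> \<le> \<kappa> + 3 * \<kappa> * L\<^sup>2" using S Um(1) by linarith
  have "((u_tilde x1)\<^sup>2 - (u_tilde x0)\<^sup>2) / 2 = S * \<Delta>"
    by (simp add: S_def \<Delta>_def power2_eq_square algebra_simps)
  then have "((u_tilde x1)\<^sup>2 - (u_tilde x0)\<^sup>2) / 2 - (x1 - x0) * (U xm ym * U\<^sub>x xm ym)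
      = S * (\<Delta> - (x1 - x0) * U\<^sub>x xm ym) + (S - U xm ym) * ((x1 - x0) * U\<^sub>x xm ym)"
    by (simp add: algebra_simps)
  also have "\<bar>\<dots>\<bar> \<le> (\<kappa> + 3 * \<kappa> * L\<^sup>2) * ((x1 - x0) * (3 * \<kappa> * h\<^sup>2)) + (3 * \<kappa> * h\<^sup>2) * ((x1 - x0) * \<kappa>)"
    using x by (intro order_trans[OF abs_triangle_ineq] add_mono abs_mult_le S S'
        u_tilde_increment[folded \<Delta>_def] Um) simp
  also have "\<dots> = (x1 - x0) * (\<kappa>\<^sup>2 * (6 + 9 * L\<^sup>2) * h\<^sup>2)"
    by (simp add: power2_eq_square algebra_simps)
  finally show ?thesis .
qed

lemma cross_near:
  assumes z: "z \<in> {c..d}"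
  shows "\<bar>w_tilde z * s_tilde z - W xm z * U\<^sub>y xm z\<bar> \<le> \<kappa>\<^sup>2 * (3 + 2 * L\<^sup>2) * h\<^sup>2"
proof -
  have "\<bar>eavg x0 x1 (\<lambda>x. W x z) - W xm z\<bar> \<le> \<kappa> * (x1 - x0)\<^sup>2"
    unfolding xm_def by (rule second_order_eavg_x[OF so_fields(4) z]) (use x in simp_all)
  moreover have "\<bar>(x1 - x0)\<^sup>2 / 6 * W\<^sub>x\<^sub>x xm z\<bar> \<le> h\<^sup>2 * \<kappa>"
    by (rule abs_mult_le)
      (use hx_sq_frac(2) order_trans[OF jet_bound[OF jetW mid_in(1) z, of 2 0] K_le_\<kappa>] in simp_all)
  ultimately have w: "\<bar>w_tilde z - W xm z\<bar> \<le> 2 * \<kappa> * h\<^sup>2"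
    using \<kappa>_hx_sq unfolding w_tilde_def mult.commute[of "h\<^sup>2"] by linarith
  have "\<bar>s_tilde z - U\<^sub>y xm z\<bar> \<le> \<kappa> * (x1 - x0)\<^sup>2"
    unfolding xm_def s_tilde_def by (rule second_order_eavg_x[OF so_fields(3) z]) (use x in simp_all)
  then have s: "\<bar>s_tilde z - U\<^sub>y xm z\<bar> \<le> \<kappa> * h\<^sup>2" using \<kappa>_hx_sq by linarith
  have m: "\<bar>W xm z\<bar> \<le> \<kappa>" "\<bar>U\<^sub>y xm z\<bar> \<le> \<kappa>"
    using second_order_bound[OF so_fields(4) mid_in(1) z] second_order_bound[OF so_fields(3) mid_in(1) z] by simp_all
  have "2 * \<kappa> * h\<^sup>2 \<le> 2 * \<kappa> * L\<^sup>2" using h_sq_le \<kappa>_nonneg by (intro mult_left_mono) simp_all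
  then have w': "\<bar>w_tilde z\<bar> \<le> \<kappa> + 2 * \<kappa> * L\<^sup>2" using w m(1) by linarith
  have "w_tilde z * s_tilde z - W xm z * U\<^sub>y xm z
      = w_tilde z * (s_tilde z - U\<^sub>y xm z) + (w_tilde z - W xm z) * U\<^sub>y xm z"
    by (simp add: algebra_simps)
  also have "\<bar>\<dots>\<bar> \<le> (\<kappa> + 2 * \<kappa> * L\<^sup>2) * (\<kappa> * h\<^sup>2) + (2 * \<kappa> * h\<^sup>2) * \<kappa>"
    by (intro order_trans[OF abs_triangle_ineq] add_mono abs_mult_le w w' s m)
  also have "\<dots> = \<kappa>\<^sup>2 * (3 + 2 * L\<^sup>2) * h\<^sup>2" by (simp add: power2_eq_square algebra_simps)
  finally show ?thesis .
qed

lemma cross_so: "second_order (4 * \<kappa> * \<kappa>) {a..b} {c..d} (\<lambda>x y. W x y * U\<^sub>y x y)"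
  using \<kappa>_nonneg by (intro second_order_mult so_fields) simp_all

lemma cross_mean_consistent:
  "\<bar>(w_tilde y0 * s_tilde y0 + w_tilde y1 * s_tilde y1) / 2 - W xm ym * U\<^sub>y xm ym\<bar>
     \<le> \<kappa>\<^sup>2 * (7 + 2 * L\<^sup>2) * h\<^sup>2"
proof -
  have "(4 * \<kappa> * \<kappa>) * h\<^sup>2 + \<kappa>\<^sup>2 * (3 + 2 * L\<^sup>2) * h\<^sup>2 = \<kappa>\<^sup>2 * (7 + 2 * L\<^sup>2) * h\<^sup>2"
    by (simp add: power2_eq_square algebra_simps)
  then show ?thesis
    using mean_close[OF mid_diff_y[OF cross_so mid_in(1)] cross_near[OF ends_in(3)] cross_near[OF ends_in(4)]]
    by (simp only:)
qed

lemma cross_increment: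
  "\<bar>w_tilde y1 * s_tilde y1 - w_tilde y0 * s_tilde y0\<bar> \<le> \<kappa>\<^sup>2 * (4 + 6 * L + 4 * L ^ 3) * h"
proof -
  have "\<bar>W xm y1 * U\<^sub>y xm y1 - W xm y0 * U\<^sub>y xm y0\<bar> \<le> 4 * \<kappa> * \<kappa> * (\<bar>xm - xm\<bar> + \<bar>y1 - y0\<bar>)"
    by (rule second_order_lipschitz[OF cross_so mid_in(1) ends_in(3) mid_in(1) ends_in(4)])
  also have "\<dots> \<le> 4 * \<kappa> * \<kappa> * h"
    using y h \<kappa>_nonneg by (intro mult_left_mono) simp_all
  finally have 1: "\<bar>W xm y1 * U\<^sub>y xm y1 - W xm y0 * U\<^sub>y xm y0\<bar> \<le> 4 * \<kappa> * \<kappa> * h" .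
  have "\<kappa>\<^sup>2 * (3 + 2 * L\<^sup>2) * h\<^sup>2 \<le> \<kappa>\<^sup>2 * (3 + 2 * L\<^sup>2) * (L * h)"
    using h_sq_le' by (intro mult_left_mono) simp_all
  moreover have "4 * \<kappa> * \<kappa> * h + 2 * (\<kappa>\<^sup>2 * (3 + 2 * L\<^sup>2) * (L * h)) = \<kappa>\<^sup>2 * (4 + 6 * L + 4 * L ^ 3) * h"
    by (simp add: power2_eq_square power3_eq_cube algebra_simps)
  ultimately show ?thesis
    using 1 cross_near[OF ends_in(3)] cross_near[OF ends_in(4)] by linarith
qed

end

text \<open>The five summands belong to the mean and the difference of the two exact integrals (first and fourth, with
  \<open>8 k\<close> as \<open>second_order\<close> constant of the convection term), to the flux, and to the mean and the
  increment of the cross term; \<open>L\<close> bounds the mesh size.\<close>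

definition consistency_const :: "real \<Rightarrow> real \<Rightarrow> real" where
  "consistency_const K L = (let k = (2 * K)\<^sup>2 in
     8 * k + k * (6 + 9 * L\<^sup>2) + k * (7 + 2 * L\<^sup>2) + 2 * (8 * k) + k * (4 + 6 * L + 4 * L ^ 3))"

lemma (in transport_cell) total_error:
  assumes mean: "\<bar>I0 + I1 - (x1 - x0) * (y1 - y0) * (U xm ym * U\<^sub>x xm ym + W xm ym * U\<^sub>y xm ym)\<bar>
            \<le> (x1 - x0) * (y1 - y0) * (8 * (2 * K)\<^sup>2 * h\<^sup>2)"
    and diff: "\<bar>I1 - I0\<bar> \<le> (x1 - x0) * (y1 - y0) * (2 * (8 * (2 * K)\<^sup>2) * h)"
  shows "\<bar>I0 * v0 + I1 * v1 -
      ((y1 - y0) * (((u_tilde x1)\<^sup>2 - (u_tilde x0)\<^sup>2) / 2) * ((v0 + v1) / 2)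
       + (x1 - x0) * (y1 - y0) / 2 * (w_tilde y0 * s_tilde y0 * v0 + w_tilde y1 * s_tilde y1 * v1))\<bar>
    \<le> consistency_const K L * ((x1 - x0) * (y1 - y0) * (h\<^sup>2 * (\<bar>v0\<bar> + \<bar>v1\<bar>) + h * \<bar>v1 - v0\<bar>))"
proof (unfold consistency_const_def Let_def \<kappa>_def[symmetric], rule cell_error_bound[where ?f1.0 = "U xm ym * U\<^sub>x xm ym" and ?f2.0 = "W xm ym * U\<^sub>y xm ym"])
  show "0 \<le> (x1 - x0) * (y1 - y0)" "0 \<le> h" using x y h_pos by simp_all
  show "0 \<le> 8 * \<kappa>\<^sup>2" "0 \<le> 2 * (8 * \<kappa>\<^sup>2)" "0 \<le> \<kappa>\<^sup>2 * (6 + 9 * L\<^sup>2)" "0 \<le> \<kappa>\<^sup>2 * (7 + 2 * L\<^sup>2)"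
    "0 \<le> \<kappa>\<^sup>2 * (4 + 6 * L + 4 * L ^ 3)"
    using L_pos by simp_all
  have "(y1 - y0) * (((u_tilde x1)\<^sup>2 - (u_tilde x0)\<^sup>2) / 2) - (x1 - x0) * (y1 - y0) * (U xm ym * U\<^sub>x xm ym)
      = (y1 - y0) * (((u_tilde x1)\<^sup>2 - (u_tilde x0)\<^sup>2) / 2 - (x1 - x0) * (U xm ym * U\<^sub>x xm ym))"
  proof -
    have "q * T - p * q * P = q * (T - p * P)" for p q T P :: real by (simp add: algebra_simps)
    then show ?thesis .
  qed
  also have "\<bar>\<dots>\<bar> \<le> (y1 - y0) * ((x1 - x0) * (\<kappa>\<^sup>2 * (6 + 9 * L\<^sup>2) * h\<^sup>2))"
    using y by (intro abs_mult_le flux_consistent) simp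
  also have "\<dots> = (x1 - x0) * (y1 - y0) * (\<kappa>\<^sup>2 * (6 + 9 * L\<^sup>2) * h\<^sup>2)" by simp
  finally show "\<bar>(y1 - y0) * (((u_tilde x1)\<^sup>2 - (u_tilde x0)\<^sup>2) / 2)
      - (x1 - x0) * (y1 - y0) * (U xm ym * U\<^sub>x xm ym)\<bar>
      \<le> (x1 - x0) * (y1 - y0) * (\<kappa>\<^sup>2 * (6 + 9 * L\<^sup>2) * h\<^sup>2)" .
qed (rule mean[folded \<kappa>_def] diff[folded \<kappa>_def] cross_mean_consistent cross_increment)+

section \<open>Integrals over the triangles of a cell\<close>

text \<open>The interiors of the two triangles of the cell \<open>[x0, x1] \<times> [y0, y1]\<close>; the last inequality tells on which
  side of the diagonal a point lies.\<close>

definition lower_tri :: "real \<Rightarrow> real \<Rightarrow> real \<Rightarrow> real \<Rightarrow> (real \<times> real) set" where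
  "lower_tri x0 x1 y0 y1 = {p. x0 < fst p \<and> y0 < snd p \<and>
     (y1 - y0) * fst p + (x1 - x0) * snd p < (y1 - y0) * x1 + (x1 - x0) * y0}"

definition upper_tri :: "real \<Rightarrow> real \<Rightarrow> real \<Rightarrow> real \<Rightarrow> (real \<times> real) set" where
  "upper_tri x0 x1 y0 y1 = {p. fst p < x1 \<and> snd p < y1 \<and>
     (y1 - y0) * x1 + (x1 - x0) * y0 < (y1 - y0) * fst p + (x1 - x0) * snd p}"

lemma interior_lower_tri:
  assumes "x0 < x1" "y0 < y1"
  shows "interior (convex hull {(x0, y0), (x1, y0), (x0, y1)}) = lower_tri x0 x1 y0 y1"
proof -
  define k where "k = (y1 - y0) * x1 + (x1 - x0) * y0"
  have "convex hull {(x0, y0), (x1, y0), (x0, y1)}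
      = {p. (-1, 0) \<bullet> p \<le> - x0} \<inter> {p. (0, -1) \<bullet> p \<le> - y0} \<inter> {p. (y1 - y0, x1 - x0) \<bullet> p \<le> k}"
    (is "?H = ?R")
  proof (rule equalityI)
    show "?H \<subseteq> ?R"
    proof (rule hull_minimal)
      have "0 < (x1 - x0) * (y1 - y0)" using assms by simp
      then show "{(x0, y0), (x1, y0), (x0, y1)} \<subseteq> ?R" using assms by (auto simp: k_def algebra_simps)
      show "convex ?R" by (intro convex_Int convex_halfspace_le)
    qed
    show "?R \<subseteq> ?H"
    proof
      fix p assume p: "p \<in> ?R"
      obtain x y where xy: "p = (x, y)" by (cases p)
      define v where "v = (x - x0) / (x1 - x0)"
      define w where "w = (y - y0) / (y1 - y0)"
      have vw: "0 \<le> v" "0 \<le> w" using p assms by (auto simp: xy v_def w_def)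
      have "v + w = ((y1 - y0) * (x - x0) + (x1 - x0) * (y - y0)) / ((x1 - x0) * (y1 - y0))"
        using assms by (simp add: v_def w_def add_divide_eq_iff divide_add_eq_iff mult.commute)
      also have "\<dots> \<le> 1"
      proof -
        have pos: "0 < (x1 - x0) * (y1 - y0)" using assms by simp
        have "(y1 - y0) * (x - x0) + (x1 - x0) * (y - y0) \<le> (x1 - x0) * (y1 - y0)"
          using p by (simp add: xy k_def algebra_simps)
        then show ?thesis by (simp only: divide_le_eq_1_pos[OF pos])
      qed
      finally have "v + w \<le> 1" .
      moreover have "p = (x0, y0) + v *\<^sub>R ((x1, y0) - (x0, y0)) + w *\<^sub>R ((x0, y1) - (x0, y0))"
        using assms by (simp add: xy v_def w_def)
      ultimately show "p \<in> ?H" unfolding convex_hull_3_alt using vw by blast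
    qed
  qed
  moreover have "(y1 - y0, x1 - x0) \<noteq> 0" using assms by (simp add: zero_prod_def)
  ultimately show ?thesis
    by (auto simp: interior_halfspace_le zero_prod_def lower_tri_def k_def)
qed

lemma mem_upper_tri_reflect:
  "(x0 + x1, y0 + y1) - p \<in> upper_tri x0 x1 y0 y1 \<longleftrightarrow> p \<in> lower_tri x0 x1 y0 y1"
  by (cases p) (simp add: lower_tri_def upper_tri_def algebra_simps)

lemma interior_upper_tri:
  assumes "x0 < x1" "y0 < y1"
  shows "interior (convex hull {(x1, y1), (x1, y0), (x0, y1)}) = upper_tri x0 x1 y0 y1"
proof -
  let ?s = "(x0 + x1, y0 + y1)" and ?H = "convex hull {(x0, y0), (x1, y0), (x0, y1)}"
  have "{(x1, y1), (x1, y0), (x0, y1)} = (+) ?s ` uminus ` {(x0, y0), (x1, y0), (x0, y1)}"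
    by (simp add: insert_commute)
  then have "convex hull {(x1, y1), (x1, y0), (x0, y1)} = (+) ?s ` uminus ` ?H"
    by (simp only: convex_hull_translation convex_hull_linear_image[OF linear_uminus])
  then have "interior (convex hull {(x1, y1), (x1, y0), (x0, y1)}) = (+) ?s ` uminus ` lower_tri x0 x1 y0 y1"
    by (simp only: interior_translation interior_negations interior_lower_tri[OF assms])
  also have "\<dots> = upper_tri x0 x1 y0 y1"
  proof (intro equalityI subsetI)
    fix p assume "p \<in> upper_tri x0 x1 y0 y1"
    then have "?s - p \<in> lower_tri x0 x1 y0 y1"
      using mem_upper_tri_reflect[of x0 x1 y0 y1 "?s - p"] by simp
    then show "p \<in> (+) ?s ` uminus ` lower_tri x0 x1 y0 y1"
      by (intro image_eqI[OF _ imageI[where x = "?s - p"]]) simp_all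
  next
    fix p assume "p \<in> (+) ?s ` uminus ` lower_tri x0 x1 y0 y1"
    then obtain q where q: "q \<in> lower_tri x0 x1 y0 y1" "p = ?s + - q" by blast
    show "p \<in> upper_tri x0 x1 y0 y1"
      unfolding q(2) add_uminus_conv_diff mem_upper_tri_reflect by (rule q(1))
  qed
  finally show ?thesis .
qed

lemma open_tri: "open (lower_tri x0 x1 y0 y1)" "open (upper_tri x0 x1 y0 y1)"
  unfolding lower_tri_def upper_tri_def
  by (intro open_Collect_conj open_Collect_less continuous_intros)+

lemma lower_tri_subset:
  assumes "x0 < x1" "y0 < y1"
  shows "lower_tri x0 x1 y0 y1 \<subseteq> {x0<..<x1} \<times> {y0<..<y1}"
proof
  fix p assume p: "p \<in> lower_tri x0 x1 y0 y1"
  obtain x y where xy: "p = (x, y)" by (cases p)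
  have l: "x0 < x" "y0 < y" "(y1 - y0) * x + (x1 - x0) * y < (y1 - y0) * x1 + (x1 - x0) * y0"
    using p by (simp_all add: xy lower_tri_def)
  have "(x1 - x0) * y0 < (x1 - x0) * y" using l assms by simp
  then have "(y1 - y0) * x < (y1 - y0) * x1" using l by linarith
  then have "x < x1" using assms by simp
  have "(y1 - y0) * x0 < (y1 - y0) * x" using l assms by simp
  then have "(y1 - y0) * x0 + (x1 - x0) * y < (y1 - y0) * x1 + (x1 - x0) * y0" using l by linarith
  then have "(x1 - x0) * y < (x1 - x0) * y1" by (simp add: algebra_simps)
  then have "y < y1" using assms by simp
  then show "p \<in> {x0<..<x1} \<times> {y0<..<y1}" using l \<open>x < x1\<close> by (simp add: xy)
qed

lemma upper_tri_subset:
  assumes "x0 < x1" "y0 < y1"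
  shows "upper_tri x0 x1 y0 y1 \<subseteq> {x0<..<x1} \<times> {y0<..<y1}"
proof
  fix p assume "p \<in> upper_tri x0 x1 y0 y1"
  then have "(x0 + x1, y0 + y1) - p \<in> {x0<..<x1} \<times> {y0<..<y1}"
    using lower_tri_subset[OF assms] mem_upper_tri_reflect[of x0 x1 y0 y1 "(x0 + x1, y0 + y1) - p"] by auto
  then show "p \<in> {x0<..<x1} \<times> {y0<..<y1}" by (cases p) auto
qed

lemma integrable_on_open_subset:
  fixes f :: "real \<times> real \<Rightarrow> real"
  assumes f: "continuous_on (cbox u v) f" and A: "open A" "A \<subseteq> cbox u v"
  shows "f absolutely_integrable_on A" "integrable (lebesgue_on A) f" "f integrable_on A"
proof -
  show 1: "f absolutely_integrable_on A"
    by (rule set_integrable_subset[OF absolutely_integrable_continuous[OF f]]) (use A in auto)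
  show "integrable (lebesgue_on A) f"
    using 1 A(1) by (simp add: integrable_restrict_space set_integrable_def)
  show "f integrable_on A" using 1 by (rule set_lebesgue_integral_eq_integral)
qed

lemma integral_triangles:
  fixes f :: "real \<times> real \<Rightarrow> real"
  assumes xy: "x0 < x1" "y0 < y1" and f: "continuous_on (cbox (x0, y0) (x1, y1)) f"
  shows "integral (lower_tri x0 x1 y0 y1) f + integral (upper_tri x0 x1 y0 y1) f
       = integral (cbox (x0, y0) (x1, y1)) f"
proof -
  let ?C = "cbox (x0, y0) (x1, y1)" and ?L = "lower_tri x0 x1 y0 y1" and ?U = "upper_tri x0 x1 y0 y1"
  let ?D = "{p. (y1 - y0, x1 - x0) \<bullet> p = (y1 - y0) * x1 + (x1 - x0) * y0}"
  have sub: "?L \<subseteq> ?C" "?U \<subseteq> ?C"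
    using lower_tri_subset[OF xy] upper_tri_subset[OF xy] by (auto simp: cbox_eq_Times)
  \<comment> \<open>the two open triangles miss only the diagonal and the boundary of the cell\<close>
  have "negligible ?D"
    using xy by (intro negligible_hyperplane) (simp add: zero_prod_def)
  then have N: "negligible (?D \<union> (?C - box (x0, y0) (x1, y1)))"
    by (intro negligible_Un negligible_frontier_interval)
  have "?L \<inter> ?U = {}" by (auto simp: lower_tri_def upper_tri_def)
  then have "(f has_integral integral ?L f + integral ?U f) (?L \<union> ?U)"
    by (intro has_integral_Un integrable_integral integrable_on_open_subset[OF f] open_tri sub) simp
  then have *: "((\<lambda>p. if p \<in> ?L \<union> ?U then f p else 0) has_integral integral ?L f + integral ?U f) ?C"
    by (subst has_integral_restrict) (use sub in simp_all)
  have "?C - (?D \<union> (?C - box (x0, y0) (x1, y1))) \<subseteq> ?L \<union> ?U"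
    by (auto simp: lower_tri_def upper_tri_def cbox_eq_Times box_eq_Times)
  then have "(f has_integral integral ?L f + integral ?U f) ?C"
    by (intro has_integral_spike[OF N _ *]) auto
  then show ?thesis by (simp add: integral_unique)
qed

lemma has_integral_reflect_cell:
  fixes g :: "real \<times> real \<Rightarrow> real"
  assumes "(g has_integral i) (cbox (x0, y0) (x1, y1))"
  shows "((\<lambda>p. g ((x0 + x1, y0 + y1) - p)) has_integral i) (cbox (x0, y0) (x1, y1))"
proof -
  have "(\<lambda>p. (x0 + x1, y0 + y1) - p) ` cbox (x0, y0) (x1, y1) = cbox (x0, y0) (x1, y1)"
  proof (intro equalityI subsetI)
    fix p assume "p \<in> cbox (x0, y0) (x1, y1)"
    then show "p \<in> (\<lambda>p. (x0 + x1, y0 + y1) - p) ` cbox (x0, y0) (x1, y1)"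
      by (intro image_eqI[of _ _ "(x0 + x1, y0 + y1) - p"]) (auto simp: cbox_eq_Times)
  qed (auto simp: cbox_eq_Times)
  then show ?thesis
    using has_integral_affinity[OF assms, of "-1" "(x0 + x1, y0 + y1)"]
    by (simp add: add.commute[of x1 x0] add.commute[of y1 y0])
qed

lemma integral_upper_tri_reflect:
  fixes f :: "real \<times> real \<Rightarrow> real"
  assumes xy: "x0 < x1" "y0 < y1" and f: "continuous_on (cbox (x0, y0) (x1, y1)) f"
  shows "((\<lambda>p. f ((x0 + x1, y0 + y1) - p)) has_integral integral (upper_tri x0 x1 y0 y1) f)
           (lower_tri x0 x1 y0 y1)"
proof -
  let ?C = "cbox (x0, y0) (x1, y1)" and ?L = "lower_tri x0 x1 y0 y1" and ?U = "upper_tri x0 x1 y0 y1"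
  have sub: "?L \<subseteq> ?C" "?U \<subseteq> ?C"
    using lower_tri_subset[OF xy] upper_tri_subset[OF xy] by (auto simp: cbox_eq_Times)
  have "(f has_integral integral ?U f) ?U"
    by (intro integrable_integral integrable_on_open_subset[OF f] open_tri sub)
  then have "((\<lambda>p. if p \<in> ?U then f p else 0) has_integral integral ?U f) ?C"
    using sub(2) by simp
  from has_integral_reflect_cell[OF this] show ?thesis
    unfolding mem_upper_tri_reflect using sub(1) by simp
qed

text \<open>The point reflection at the midpoint of the cell maps the cell to itself and exchanges the two triangles.
  Hence the sum of the two integrals is governed by second differences of \<open>F\<close>, and their difference by
  first differences.\<close>

lemma integral_triangles_bounds:
  assumes F: "second_order \<mu> {a..b} {c..d} F"
    and x: "a \<le> x0" "x0 < x1" "x1 \<le> b" and y: "c \<le> y0" "y0 < y1" "y1 \<le> d"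
    and h: "x1 - x0 \<le> h" "y1 - y0 \<le> h"
    and f: "continuous_on (cbox (x0, y0) (x1, y1)) f"
    and fF: "\<And>x y. x \<in> {x0..x1} \<Longrightarrow> y \<in> {y0..y1} \<Longrightarrow> f (x, y) = F x y"
  shows "\<bar>integral (lower_tri x0 x1 y0 y1) f + integral (upper_tri x0 x1 y0 y1) f
          - (x1 - x0) * (y1 - y0) * F ((x0 + x1) / 2) ((y0 + y1) / 2)\<bar>
         \<le> (x1 - x0) * (y1 - y0) * (\<mu> * h\<^sup>2)" (is ?mean)
    and "\<bar>integral (upper_tri x0 x1 y0 y1) f - integral (lower_tri x0 x1 y0 y1) f\<bar>
         \<le> (x1 - x0) * (y1 - y0) * (2 * \<mu> * h)" (is ?diff)
proof -
  let ?C = "cbox (x0, y0) (x1, y1)" and ?L = "lower_tri x0 x1 y0 y1" and ?U = "upper_tri x0 x1 y0 y1"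
  let ?m = "F ((x0 + x1) / 2) ((y0 + y1) / 2)" and ?r = "\<lambda>p. (x0 + x1, y0 + y1) - p"
  have m: "(x0 + x1) / 2 \<in> {a..b}" "(y0 + y1) / 2 \<in> {c..d}" using x y by simp_all
  have \<mu>: "0 \<le> \<mu>" by (rule order_trans[OF abs_ge_zero second_order_bound[OF F m]])
  have h0: "0 \<le> h" using x h by linarith
  have pts: "x0 + x1 - x \<in> {x0..x1}" "y0 + y1 - y \<in> {y0..y1}"
      "x \<in> {a..b}" "x0 + x1 - x \<in> {a..b}" "y \<in> {c..d}" "y0 + y1 - y \<in> {c..d}"
    if "x \<in> {x0..x1}" "y \<in> {y0..y1}" for x y
    using that assms(2-7) by auto
  have content: "measure lborel ?C = (x1 - x0) * (y1 - y0)"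
    using x y by (simp add: content_Pair)
  have fI: "(f has_integral integral ?C f) ?C"
    by (intro integrable_integral integrable_continuous f)
  have "((\<lambda>p. f p + f (?r p) - 2 * ?m) has_integral
          (integral ?C f + integral ?C f - measure lborel ?C *\<^sub>R (2 * ?m))) ?C"
    by (intro has_integral_diff has_integral_add fI has_integral_reflect_cell[OF fI] has_integral_const)
  moreover have "\<bar>f p + f (?r p) - 2 * ?m\<bar> \<le> \<mu> * h\<^sup>2" if p: "p \<in> ?C" for p
  proof -
    obtain x y where p_eq: "p = (x, y)" by (cases p)
    have xy: "x \<in> {x0..x1}" "y \<in> {y0..y1}" using p by (auto simp: p_eq cbox_eq_Times)
    define s where "s = x - (x0 + x1) / 2"
    define t where "t = y - (y0 + y1) / 2"
    have e: "(x0 + x1) / 2 + s = x" "(y0 + y1) / 2 + t = y"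
      "(x0 + x1) / 2 - s = x0 + x1 - x" "(y0 + y1) / 2 - t = y0 + y1 - y"
      by (simp_all add: s_def t_def field_simps)
    note r = pts(1,2)[OF xy] and in_S = pts(3-6)[OF xy]
    have "\<bar>s\<bar> \<le> (x1 - x0) / 2" "\<bar>t\<bar> \<le> (y1 - y0) / 2"
      using xy by (auto simp: s_def t_def abs_le_iff field_simps)
    then have st: "\<bar>s\<bar> + \<bar>t\<bar> \<le> h" using h by argo
    have "\<bar>F x y + F (x0 + x1 - x) (y0 + y1 - y) - 2 * ?m\<bar> \<le> \<mu> * (\<bar>s\<bar> + \<bar>t\<bar>)\<^sup>2"
      using second_order_difference[OF F m, of s t] unfolding e using in_S by blast
    also have "\<dots> \<le> \<mu> * h\<^sup>2" by (intro mult_left_mono power_mono st \<mu>) simp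
    finally show ?thesis using fF[OF xy] fF[OF r] by (simp add: p_eq)
  qed
  ultimately have "norm (integral ?C f + integral ?C f - measure lborel ?C *\<^sub>R (2 * ?m))
      \<le> (\<mu> * h\<^sup>2) * measure lborel ?C"
    by (intro has_integral_bound[of "\<mu> * h\<^sup>2"]) (use \<mu> in auto)
  then have *: "\<bar>integral ?C f + integral ?C f - 2 * ((x1 - x0) * (y1 - y0) * ?m)\<bar>
      \<le> (x1 - x0) * (y1 - y0) * (\<mu> * h\<^sup>2)"
    unfolding content by (simp add: mult.commute mult.left_commute)
  define J where "J = (x1 - x0) * (y1 - y0) * ?m"
  show ?mean
    using * unfolding integral_triangles[OF x(2) y(2) f] J_def[symmetric] by argo
  have sub: "?L \<subseteq> ?C" "?U \<subseteq> ?C"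
    using lower_tri_subset[OF x(2) y(2)] upper_tri_subset[OF x(2) y(2)] by (auto simp: cbox_eq_Times)
  have "((\<lambda>p. f (?r p) - f p) has_integral (integral ?U f - integral ?L f)) ?L"
    by (intro has_integral_diff integral_upper_tri_reflect x y f integrable_integral
        integrable_on_open_subset[OF f] open_tri sub)
  then have "((\<lambda>p. if p \<in> ?L then f (?r p) - f p else 0) has_integral (integral ?U f - integral ?L f)) ?C"
    using sub(1) by simp
  moreover have "norm (if p \<in> ?L then f (?r p) - f p else 0) \<le> 2 * \<mu> * h" if p: "p \<in> ?C" for p
  proof -
    obtain x y where p_eq: "p = (x, y)" by (cases p)
    have xy: "x \<in> {x0..x1}" "y \<in> {y0..y1}" using p by (auto simp: p_eq cbox_eq_Times)
    note r = pts(1,2)[OF xy] and in_S = pts(3-6)[OF xy]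
    have "\<bar>x0 + x1 - x - x\<bar> + \<bar>y0 + y1 - y - y\<bar> \<le> 2 * h"
      using xy h by auto
    then have "\<mu> * (\<bar>x0 + x1 - x - x\<bar> + \<bar>y0 + y1 - y - y\<bar>) \<le> \<mu> * (2 * h)"
      using \<mu> by (rule mult_left_mono)
    then have "\<bar>f (?r p) - f p\<bar> \<le> 2 * \<mu> * h"
      using second_order_lipschitz[OF F in_S(1,3,2,4)] fF[OF xy] fF[OF r] by (simp add: p_eq)
    then show ?thesis using \<mu> h0 by simp
  qed
  ultimately have "norm (integral ?U f - integral ?L f) \<le> (2 * \<mu> * h) * measure lborel ?C"
    by (intro has_integral_bound[of "2 * \<mu> * h"]) (use \<mu> h0 in auto)
  then show ?diff unfolding content by (simp add: mult.commute mult.left_commute)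
qed

text \<open>The reflection makes the two areas equal, and they add up to the area of the cell.\<close>

lemma measure_triangles:
  assumes xy: "x0 < x1" "y0 < y1"
  shows "integral (lower_tri x0 x1 y0 y1) (\<lambda>_. 1::real) = (x1 - x0) * (y1 - y0) / 2"
    and "integral (upper_tri x0 x1 y0 y1) (\<lambda>_. 1::real) = (x1 - x0) * (y1 - y0) / 2"
proof -
  have 1: "integral (lower_tri x0 x1 y0 y1) (\<lambda>_. 1::real) + integral (upper_tri x0 x1 y0 y1) (\<lambda>_. 1::real)
      = (x1 - x0) * (y1 - y0)"
    using integral_triangles[OF xy, of "\<lambda>_. 1"] xy by (simp add: content_Pair)
  have 2: "integral (lower_tri x0 x1 y0 y1) (\<lambda>_. 1::real) = integral (upper_tri x0 x1 y0 y1) (\<lambda>_. 1::real)"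
    using integral_upper_tri_reflect[OF xy, of "\<lambda>_. 1"] by (simp add: integral_unique)
  show "integral (lower_tri x0 x1 y0 y1) (\<lambda>_. 1::real) = (x1 - x0) * (y1 - y0) / 2"
    "integral (upper_tri x0 x1 y0 y1) (\<lambda>_. 1::real) = (x1 - x0) * (y1 - y0) / 2"
    using 1 2 by argo+
qed

section \<open>Piecewise constant fields on a mesh of a rectangle\<close>

lemma interval_index_unique:
  assumes "strict_mono_on {0..n} (Z :: nat \<Rightarrow> real)" "i < n" "i' < n"
    "Z i < z" "z < Z (Suc i)" "Z i' < z" "z < Z (Suc i')"
  shows "i = i'"
proof -
  have le: "Z k \<le> Z l" if "k \<le> l" "l \<le> n" for k l
    using strict_mono_onD[OF assms(1), of k l] that by (cases "k = l") auto
  show ?thesis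
  proof (rule ccontr)
    assume "i \<noteq> i'"
    then consider "Suc i \<le> i'" | "Suc i' \<le> i" by linarith
    then show False using le[of "Suc i" i'] le[of "Suc i'" i] assms by cases auto
  qed
qed

locale rectangle_mesh =
  fixes a b c d :: real and M :: mesh
  assumes ab: "a < b" "c < d" and mesh: "cartesian_mesh_of ({a<..<b} \<times> {c<..<d}) M"
begin

abbreviation "\<Omega> \<equiv> {a<..<b} \<times> {c<..<d}"
abbreviation "X \<equiv> xpt M"
abbreviation "Y \<equiv> ypt M"
abbreviation "lower i j \<equiv> lower_tri (X i) (X (Suc i)) (Y j) (Y (Suc j))"
abbreviation "upper i j \<equiv> upper_tri (X i) (X (Suc i)) (Y j) (Y (Suc j))"

lemma grid_mono: "strict_mono_on {0..nx M} X" "strict_mono_on {0..ny M} Y"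
  and n_pos: "0 < nx M" "0 < ny M" and domain: "mesh_domain M = \<Omega>"
  using mesh by (auto simp: cartesian_mesh_of_def)

lemma X_less: "i < j \<Longrightarrow> j \<le> nx M \<Longrightarrow> X i < X j"
  and Y_less: "i < j \<Longrightarrow> j \<le> ny M \<Longrightarrow> Y i < Y j"
  using strict_mono_onD[OF grid_mono(1), of i j] strict_mono_onD[OF grid_mono(2), of i j] by auto

lemma X_mono: "i \<le> j \<Longrightarrow> j \<le> nx M \<Longrightarrow> X i \<le> X j"
  and Y_mono: "i \<le> j \<Longrightarrow> j \<le> ny M \<Longrightarrow> Y i \<le> Y j"
  using X_less[of i j] Y_less[of i j] by (auto simp: le_less)

lemma extreme_points: "X 0 = a" "X (nx M) = b" "Y 0 = c" "Y (ny M) = d"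
proof -
  have "{X 0<..<X (nx M)} \<times> {Y 0<..<Y (ny M)} = {a<..<b} \<times> {c<..<d}"
    using domain by (simp add: mesh_domain_def)
  moreover have "{X 0<..<X (nx M)} \<noteq> {}" "{Y 0<..<Y (ny M)} \<noteq> {}"
    using X_less[of 0 "nx M"] Y_less[of 0 "ny M"] n_pos by simp_all
  ultimately have *: "{X 0<..<X (nx M)} = {a<..<b}" "{Y 0<..<Y (ny M)} = {c<..<d}"
    by (simp_all add: times_eq_iff)
  have eq: "p = r \<and> q = s" if "{p<..<q} = {r<..<s}" "p < q" "r < s" for p q r s :: real
  proof -
    have "Inf {p<..<q} = p" "Sup {p<..<q} = q" "Inf {r<..<s} = r" "Sup {r<..<s} = s"
      using that(2,3) by simp_all
    then show ?thesis using that(1) by metis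
  qed
  show "X 0 = a" "X (nx M) = b" "Y 0 = c" "Y (ny M) = d"
    using eq[OF *(1)] eq[OF *(2)] X_less[of 0 "nx M"] Y_less[of 0 "ny M"] n_pos ab by simp_all
qed

lemma X_in: "i \<le> nx M \<Longrightarrow> X i \<in> {a..b}" and Y_in: "j \<le> ny M \<Longrightarrow> Y j \<in> {c..d}"
  using X_mono[of 0 i] X_mono[of i "nx M"] Y_mono[of 0 j] Y_mono[of j "ny M"] by (simp_all add: extreme_points)

lemma hx_pos: "i < nx M \<Longrightarrow> 0 < hx M i" and hy_pos: "j < ny M \<Longrightarrow> 0 < hy M j"
  using X_less[of i "Suc i"] Y_less[of j "Suc j"] by (simp_all add: hx_def hy_def)

lemma sum_hx: "(\<Sum>i<nx M. hx M i) = b - a" and sum_hy: "(\<Sum>j<ny M. hy M j) = d - c"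
  unfolding hx_def hy_def by (simp_all add: sum_lessThan_telescope extreme_points)

lemma hx_le: "i < nx M \<Longrightarrow> hx M i \<le> mesh_size M" and hy_le: "j < ny M \<Longrightarrow> hy M j \<le> mesh_size M"
  unfolding mesh_size_def by (auto intro!: Max_ge)

lemma mesh_size_le: "mesh_size M \<le> (b - a) + (d - c)"
proof -
  have "hx M i \<le> (b - a) + (d - c)" if "i < nx M" for i
  proof -
    have "hx M i \<le> (\<Sum>i<nx M. hx M i)"
      by (rule member_le_sum) (use that hx_pos in \<open>auto intro: less_imp_le\<close>)
    then show ?thesis using ab by (simp add: sum_hx)
  qed
  moreover have "hy M j \<le> (b - a) + (d - c)" if "j < ny M" for j
  proof -
    have "hy M j \<le> (\<Sum>j<ny M. hy M j)"
      by (rule member_le_sum) (use that hy_pos in \<open>auto intro: less_imp_le\<close>)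
    then show ?thesis using ab by (simp add: sum_hy)
  qed
  ultimately show ?thesis
    unfolding mesh_size_def using n_pos by (intro Max.boundedI) auto
qed

lemma mem_triangles:
  "Lower i j \<in> triangles M \<longleftrightarrow> i < nx M \<and> j < ny M"
  "Upper i j \<in> triangles M \<longleftrightarrow> i < nx M \<and> j < ny M"
  by (auto simp: triangles_def)

lemma sum_triangles:
  "(\<Sum>T\<in>triangles M. \<phi> T) = (\<Sum>i<nx M. \<Sum>j<ny M. \<phi> (Lower i j) + \<phi> (Upper i j))"
proof -
  have "(\<Sum>T\<in>triangles M. \<phi> T)
      = (\<Sum>q\<in>{..<nx M} \<times> {..<ny M}. \<Sum>T\<in>{Lower (fst q) (snd q), Upper (fst q) (snd q)}. \<phi> T)"
  proof -
    have "triangles M = (\<Union>q\<in>{..<nx M} \<times> {..<ny M}. {Lower (fst q) (snd q), Upper (fst q) (snd q)})"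
      by (auto simp: triangles_def)
    then show ?thesis
      by (simp only:) (rule sum.UNION_disjoint, auto)
  qed
  also have "\<dots> = (\<Sum>q\<in>{..<nx M} \<times> {..<ny M}. \<phi> (Lower (fst q) (snd q)) + \<phi> (Upper (fst q) (snd q)))"
    by simp
  finally show ?thesis by (simp add: sum.cartesian_product case_prod_beta)
qed

lemma finite_triangles: "finite (triangles M)"
  by (auto simp: triangles_def)

lemma interior_tri_set:
  assumes "i < nx M" "j < ny M"
  shows "interior (tri_set M (Lower i j)) = lower i j"
    and "interior (tri_set M (Upper i j)) = upper i j"
  using X_less[of i "Suc i"] Y_less[of j "Suc j"] assms
  by (simp_all add: interior_lower_tri interior_upper_tri)

lemma interior_tri_cell:
  assumes "i < nx M" "j < ny M" "p \<in> interior (tri_set M (Lower i j)) \<or> p \<in> interior (tri_set M (Upper i j))"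
  shows "X i < fst p" "fst p < X (Suc i)" "Y j < snd p" "snd p < Y (Suc j)"
  using assms(3) lower_tri_subset[of "X i" "X (Suc i)" "Y j" "Y (Suc j)"]
    upper_tri_subset[of "X i" "X (Suc i)" "Y j" "Y (Suc j)"]
    X_less[of i "Suc i"] Y_less[of j "Suc j"] assms(1,2)
  unfolding interior_tri_set[OF assms(1,2)] by (auto simp: mem_Times_iff)

lemma interior_tri_disjoint:
  assumes T: "T \<in> triangles M" "T' \<in> triangles M"
    and p: "p \<in> interior (tri_set M T)" "p \<in> interior (tri_set M T')"
  shows "T = T'"
proof -
  obtain i j where ij: "i < nx M" "j < ny M" "T = Lower i j \<or> T = Upper i j"
    using T(1) by (cases T) (auto simp: mem_triangles)
  obtain i' j' where ij': "i' < nx M" "j' < ny M" "T' = Lower i' j' \<or> T' = Upper i' j'"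
    using T(2) by (cases T') (auto simp: mem_triangles)
  have c: "X i < fst p" "fst p < X (Suc i)" "Y j < snd p" "snd p < Y (Suc j)"
    using interior_tri_cell[OF ij(1,2), of p] ij(3) p by blast+
  have c': "X i' < fst p" "fst p < X (Suc i')" "Y j' < snd p" "snd p < Y (Suc j')"
    using interior_tri_cell[OF ij'(1,2), of p] ij'(3) p by blast+
  have eq: "i = i'" "j = j'"
    using interval_index_unique[OF grid_mono(1) ij(1) ij'(1) c(1,2) c'(1,2)]
      interval_index_unique[OF grid_mono(2) ij(2) ij'(2) c(3,4) c'(3,4)] by blast+
  have "lower i j \<inter> upper i j = {}"
    by (auto simp: lower_tri_def upper_tri_def)
  then show ?thesis
    using ij(3) ij'(3) p unfolding eq[symmetric]
    by (elim disjE) (auto simp: interior_tri_set[OF ij(1,2)] simp del: tri_set.simps)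
qed

lemma realize_inside:
  assumes "T \<in> triangles M" "p \<in> interior (tri_set M T)"
  shows "realize M w p = w T"
proof -
  have "realize M w p = (\<Sum>T'\<in>triangles M. if T' = T then w T else 0)"
    unfolding realize_def
  proof (rule sum.cong[OF refl])
    fix T' assume T': "T' \<in> triangles M"
    show "indicat_real (interior (tri_set M T')) p *\<^sub>R w T' = (if T' = T then w T else 0)"
    proof (cases "T' = T")
      case True
      then show ?thesis using assms(2) by (simp only: indicator_simps simp_thms if_True scaleR_one)
    next
      case False
      then have "p \<notin> interior (tri_set M T')"
        using interior_tri_disjoint[OF T' assms(1) _ assms(2)] by blast
      then have "indicat_real (interior (tri_set M T')) p = 0" by (rule indicator_simps(2))
      then show ?thesis using False by (simp only: simp_thms if_False scaleR_zero_left)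
    qed
  qed
  then show ?thesis
    using assms(1) finite_triangles by (simp only: sum.delta' sum.delta if_True)
qed

lemma realize_outside:
  assumes "\<And>T. T \<in> triangles M \<Longrightarrow> p \<notin> interior (tri_set M T)"
  shows "realize M w p = 0"
  unfolding realize_def
proof (intro sum.neutral ballI)
  fix T assume "T \<in> triangles M"
  from assms[OF this] have "indicat_real (interior (tri_set M T)) p = 0" by (rule indicator_simps(2))
  then show "indicat_real (interior (tri_set M T)) p *\<^sub>R w T = 0"
    by (simp only: scaleR_zero_left)
qed

lemma realize_nth: "realize M w p $ k = realize M (\<lambda>T. w T $ k) p"
  by (simp add: realize_def)

text \<open>The triangles have disjoint interiors, so at most one summand of \<open>realize\<close> is nonzero at any point.\<close>

lemma realize_mult: "realize M f p * realize M g p = realize M (\<lambda>T. f T * g T) p"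
  for f g :: "tri \<Rightarrow> real"
proof (cases "\<exists>T\<in>triangles M. p \<in> interior (tri_set M T)")
  case True
  then show ?thesis using realize_inside by metis
next
  case False
  then have "realize M w p = 0" for w :: "tri \<Rightarrow> real" by (intro realize_outside) blast
  then show ?thesis by (simp only: mult_zero_left)
qed

lemma interior_tri_subset:
  assumes "T \<in> triangles M"
  shows "interior (tri_set M T) \<subseteq> \<Omega>"
proof
  fix p assume p: "p \<in> interior (tri_set M T)"
  obtain i j where ij: "i < nx M" "j < ny M" "T = Lower i j \<or> T = Upper i j"
    using assms(1) by (cases T) (auto simp: mem_triangles)
  have c: "X i < fst p" "fst p < X (Suc i)" "Y j < snd p" "snd p < Y (Suc j)"
    using interior_tri_cell[OF ij(1,2), of p] ij(3) p by blast+
  have "X i \<ge> a" "X (Suc i) \<le> b" "Y j \<ge> c" "Y (Suc j) \<le> d"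
    using X_in[of i] X_in[of "Suc i"] Y_in[of j] Y_in[of "Suc j"] ij by auto
  then show "p \<in> \<Omega>" using c by (cases p) auto
qed

lemma integral_against_realize:
  fixes g :: "real \<times> real \<Rightarrow> real" and w :: "tri \<Rightarrow> real"
  assumes g: "continuous_on ({a..b} \<times> {c..d}) g"
  shows "integrable (lebesgue_on \<Omega>) (\<lambda>p. g p * realize M w p)"
    and "(LINT p|lebesgue_on \<Omega>. g p * realize M w p)
      = (\<Sum>i<nx M. \<Sum>j<ny M. w (Lower i j) * integral (lower i j) g
                          + w (Upper i j) * integral (upper i j) g)"
proof -
  let ?I = "\<lambda>T. interior (tri_set M T)"
  have g': "continuous_on (cbox (a, c) (b, d)) g" using g by (simp add: cbox_eq_Times)
  have \<Omega>: "\<Omega> = box (a, c) (b, d)" by (simp add: box_eq_Times)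
  have \<Omega>': "\<Omega> \<in> sets lebesgue" unfolding \<Omega> by simp
  have sub: "?I T \<subseteq> cbox (a, c) (b, d)" if "T \<in> triangles M" for T
    using interior_tri_subset[OF that] by (auto simp: cbox_eq_Times)
  have int: "integrable (lebesgue_on \<Omega>) (\<lambda>p. if p \<in> ?I T then g p else 0)" if T: "T \<in> triangles M" for T
  proof -
    have "(\<lambda>p. if p \<in> ?I T then g p else 0) absolutely_integrable_on UNIV"
      using integrable_on_open_subset(1)[OF g' open_interior sub[OF T]]
      by (simp only: absolutely_integrable_restrict_UNIV)
    then have "(\<lambda>p. if p \<in> ?I T then g p else 0) absolutely_integrable_on \<Omega>"
      by (rule set_integrable_subset) (use \<Omega>' in auto)
    then show ?thesis
      using \<Omega>' by (simp add: integrable_restrict_space set_integrable_def)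
  qed
  have val: "(LINT p|lebesgue_on \<Omega>. (if p \<in> ?I T then g p else 0)) = integral (?I T) g"
    if T: "T \<in> triangles M" for T
  proof -
    have "(LINT p|lebesgue_on \<Omega>. (if p \<in> ?I T then g p else 0)) = integral\<^sup>L (lebesgue_on (?I T)) g"
      by (rule Lebesgue_Measure.integral_restrict[OF interior_tri_subset[OF T] _ \<Omega>']) simp
    also have "\<dots> = integral (?I T) g"
      by (rule lebesgue_integral_eq_integral[OF integrable_on_open_subset(2)[OF g' open_interior sub[OF T]]]) simp
    finally show ?thesis .
  qed
  have eq: "(\<lambda>p. g p * realize M w p) = (\<lambda>p. \<Sum>T\<in>triangles M. w T * (if p \<in> ?I T then g p else 0))"
    unfolding realize_def sum_distrib_left by (intro ext sum.cong refl) (simp add: indicator_def)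
  show "integrable (lebesgue_on \<Omega>) (\<lambda>p. g p * realize M w p)"
    unfolding eq by (intro Bochner_Integration.integrable_sum integrable_mult_right int)
  have "(LINT p|lebesgue_on \<Omega>. g p * realize M w p) = (\<Sum>T\<in>triangles M. w T * integral (?I T) g)"
    unfolding eq by (subst Bochner_Integration.integral_sum) (auto intro: int simp: val)
  then show "(LINT p|lebesgue_on \<Omega>. g p * realize M w p)
      = (\<Sum>i<nx M. \<Sum>j<ny M. w (Lower i j) * integral (lower i j) g
                          + w (Upper i j) * integral (upper i j) g)"
    by (simp add: sum_triangles interior_tri_set del: tri_set.simps)
qed

lemma integral_realize:
  "(LINT p|lebesgue_on \<Omega>. realize M w p)
      = (\<Sum>i<nx M. \<Sum>j<ny M. hx M i * hy M j / 2 * (w (Lower i j) + w (Upper i j)))"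
  for w :: "tri \<Rightarrow> real"
proof -
  have "(LINT p|lebesgue_on \<Omega>. realize M w p)
      = (\<Sum>i<nx M. \<Sum>j<ny M. w (Lower i j) * integral (lower i j) (\<lambda>_. 1)
                          + w (Upper i j) * integral (upper i j) (\<lambda>_. 1))"
    using integral_against_realize(2)[of "\<lambda>_. 1" w] by simp
  also have "\<dots> = (\<Sum>i<nx M. \<Sum>j<ny M. hx M i * hy M j / 2 * (w (Lower i j) + w (Upper i j)))"
    by (intro sum.cong refl)
       (simp add: measure_triangles X_less Y_less distrib_left add_divide_distrib mult.commute mult.left_commute
          flip: hx_def hy_def)
  finally show ?thesis .
qed

end

section \<open>The interpolants\<close>

context rectangle_mesh
begin

lemma edge_len_H: "i < nx M \<Longrightarrow> edge_len M (HEdge i j) = hx M i"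
  and edge_len_V: "j < ny M \<Longrightarrow> edge_len M (VEdge i j) = hy M j"
  using hx_pos[of i] hy_pos[of j] by (simp_all add: edge_len_def dist_Pair_Pair dist_real_def hx_def hy_def)

lemma edge_len_D_pos: "i < nx M \<Longrightarrow> j < ny M \<Longrightarrow> 0 < edge_len M (DEdge i j)"
  using X_less[of i "Suc i"] by (simp add: edge_len_def)

lemma edge_integral_const: "edge_integral M e (\<lambda>p. k) = edge_len M e *\<^sub>R k"
  by (simp add: edge_integral_def)

lemma edge_integral_H:
  assumes "i < nx M"
  shows "edge_integral M (HEdge i j) f = hx M i * eavg (X i) (X (Suc i)) (\<lambda>x. f (x, Y j))"
proof -
  have "linepath (X i, Y j) (X (Suc i), Y j) s = ((1 - s) * X i + s * X (Suc i), Y j)" for s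
    by (simp add: linepath_def algebra_simps)
  then show ?thesis by (simp add: edge_integral_def eavg_def edge_len_H[OF assms])
qed

lemma edge_integral_V:
  assumes "j < ny M"
  shows "edge_integral M (VEdge i j) f = hy M j * eavg (Y j) (Y (Suc j)) (\<lambda>y. f (X i, y))"
proof -
  have "linepath (X i, Y j) (X i, Y (Suc j)) s = (X i, (1 - s) * Y j + s * Y (Suc j))" for s
    by (simp add: linepath_def algebra_simps)
  then show ?thesis by (simp add: edge_integral_def eavg_def edge_len_V[OF assms])
qed

definition V_mean :: "(real \<times> real \<Rightarrow> real) \<Rightarrow> nat \<Rightarrow> nat \<Rightarrow> real" where
  "V_mean f i j = eavg (Y j) (Y (Suc j)) (\<lambda>y. f (X i, y))"

definition H_mean :: "(real \<times> real \<Rightarrow> real) \<Rightarrow> nat \<Rightarrow> nat \<Rightarrow> real" where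
  "H_mean f i j = eavg (X i) (X (Suc i)) (\<lambda>x. f (x, Y j))"

lemma edge_condition_H:
  "i < nx M \<Longrightarrow> edge_integral M (HEdge i j) (\<lambda>p. k) = edge_integral M (HEdge i j) f \<longleftrightarrow> k = H_mean f i j"
  using hx_pos[of i] by (simp add: edge_integral_const edge_len_H edge_integral_H H_mean_def)

lemma edge_condition_V:
  "j < ny M \<Longrightarrow> edge_integral M (VEdge i j) (\<lambda>p. k) = edge_integral M (VEdge i j) f \<longleftrightarrow> k = V_mean f i j"
  using hy_pos[of j] by (simp add: edge_integral_const edge_len_V edge_integral_V V_mean_def)

lemma inner_normal_H: "w \<bullet> normal M (HEdge i j) = w $ 2"
  and inner_normal_V: "w \<bullet> normal M (VEdge i j) = w $ 1"
  by (simp_all add: inner_vec_def sum_2)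

lemma shear_H: "(\<tau> *v normal M (HEdge i j)) \<bullet> tangent M (HEdge i j) = \<tau> $ 1 $ 2"
  and shear_V: "(\<tau> *v normal M (VEdge i j)) \<bullet> tangent M (VEdge i j) = \<tau> $ 2 $ 1"
  by (simp_all add: inner_vec_def matrix_vector_mult_def sum_2)

text \<open>The pairs of a horizontal or vertical edge and an adjacent triangle, listed by triangle: each triangle has
  one edge of either kind.\<close>

lemma ball_adjacent_HV:
  "(\<forall>e\<in>hedges M \<union> vedges M. \<forall>T\<in>adjacent M e. P e T) \<longleftrightarrow>
     (\<forall>i<nx M. \<forall>j<ny M. P (HEdge i j) (Lower i j) \<and> P (HEdge i (Suc j)) (Upper i j) \<and>
                        P (VEdge i j) (Lower i j) \<and> P (VEdge (Suc i) j) (Upper i j))"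
  (is "?L \<longleftrightarrow> ?R")
proof
  assume L: ?L
  show ?R
  proof (intro allI impI conjI)
    fix i j assume ij: "i < nx M" "j < ny M"
    have e: "HEdge i j \<in> hedges M \<union> vedges M" "HEdge i (Suc j) \<in> hedges M \<union> vedges M"
      "VEdge i j \<in> hedges M \<union> vedges M" "VEdge (Suc i) j \<in> hedges M \<union> vedges M"
      using ij by (auto simp: hedges_def vedges_def)
    have a: "Lower i j \<in> adjacent M (HEdge i j)" "Upper i j \<in> adjacent M (HEdge i (Suc j))"
      "Lower i j \<in> adjacent M (VEdge i j)" "Upper i j \<in> adjacent M (VEdge (Suc i) j)"
      using ij by (auto simp: adjacent_def)
    show "P (HEdge i j) (Lower i j)" "P (HEdge i (Suc j)) (Upper i j)"
      "P (VEdge i j) (Lower i j)" "P (VEdge (Suc i) j) (Upper i j)"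
      using L e a by blast+
  qed
next
  assume R: ?R
  show ?L
  proof (intro ballI)
    fix e T assume e: "e \<in> hedges M \<union> vedges M" and T: "T \<in> adjacent M e"
    from e consider i j where "e = HEdge i j" "i < nx M" "j \<le> ny M"
      | i j where "e = VEdge i j" "i \<le> nx M" "j < ny M"
      by (auto simp: hedges_def vedges_def)
    then show "P e T"
    proof cases
      case (1 i j)
      then have "T = Lower i j \<and> j < ny M \<or> T = Upper i (j - 1) \<and> 0 < j"
        using T by (auto simp: adjacent_def split: if_splits)
      then show ?thesis using R 1 by (cases j) auto
    next
      case (2 i j)
      then have "T = Lower i j \<and> i < nx M \<or> T = Upper (i - 1) j \<and> 0 < i"
        using T by (auto simp: adjacent_def split: if_splits)
      then show ?thesis using R 2 by (cases i) auto
    qed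
  qed
qed

lemma piecewise_constant_eqI:
  assumes "f \<in> piecewise_constant M" "g \<in> piecewise_constant M"
    "\<And>i j. i < nx M \<Longrightarrow> j < ny M \<Longrightarrow> f (Lower i j) = g (Lower i j)"
    "\<And>i j. i < nx M \<Longrightarrow> j < ny M \<Longrightarrow> f (Upper i j) = g (Upper i j)"
  shows "f = g"
proof
  fix T
  show "f T = g T"
  proof (cases "T \<in> triangles M")
    case True
    then show ?thesis using assms(3,4) by (cases T) (auto simp: mem_triangles)
  next
    case False
    then show ?thesis using assms(1,2) by (auto simp: piecewise_constant_def)
  qed
qed

definition on_triangles :: "(nat \<Rightarrow> nat \<Rightarrow> 'a) \<Rightarrow> (nat \<Rightarrow> nat \<Rightarrow> 'a) \<Rightarrow> tri \<Rightarrow> 'a::zero" where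
  "on_triangles l u T =
     (if T \<in> triangles M then (case T of Lower i j \<Rightarrow> l i j | Upper i j \<Rightarrow> u i j) else 0)"

lemma on_triangles:
  "on_triangles l u \<in> piecewise_constant M"
  "i < nx M \<Longrightarrow> j < ny M \<Longrightarrow> on_triangles l u (Lower i j) = l i j"
  "i < nx M \<Longrightarrow> j < ny M \<Longrightarrow> on_triangles l u (Upper i j) = u i j"
  by (auto simp: on_triangles_def piecewise_constant_def mem_triangles)

lemma jump_interior_H:
  assumes "0 < j" "j < ny M"
  shows "jump M w (HEdge i j) = w (Upper i (j - 1)) - w (Lower i j)"
  using assms by (simp add: jump_def one_sided_trace_def)

lemma jump_interior_V:
  assumes "0 < i" "i < nx M"
  shows "jump M w (VEdge i j) = w (Upper (i - 1) j) - w (Lower i j)"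
  using assms by (simp add: jump_def one_sided_trace_def)

lemma jump_D: "jump M w (DEdge i j) = w (Lower i j) - w (Upper i j)"
  and avg_D: "avg M w (DEdge i j) = (1 / 2) *\<^sub>R (w (Lower i j) + w (Upper i j))"
  by (simp_all add: jump_def avg_def one_sided_trace_def)

text \<open>The horizontal edge of a triangle determines the second component and the vertical edge the first.\<close>

lemma interp_U_eq:
  "interp_U M u = on_triangles
     (\<lambda>i j. vector [V_mean (\<lambda>p. u p $ 1) i j, H_mean (\<lambda>p. u p $ 2) i j])
     (\<lambda>i j. vector [V_mean (\<lambda>p. u p $ 1) (Suc i) j, H_mean (\<lambda>p. u p $ 2) i (Suc j)])"
  (is "_ = ?w")
  unfolding interp_U_def ball_adjacent_HV inner_normal_H inner_normal_V
proof (rule the_equality, goal_cases)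
  case 1
  have w1: "?w (Upper i (j - 1)) $ 2 = ?w (Lower i j) $ 2" if "i < nx M" "0 < j" "j < ny M" for i j
    using that by (cases j) (simp_all add: on_triangles)
  have w2: "?w (Upper (i - 1) j) $ 1 = ?w (Lower i j) $ 1" if "0 < i" "i < nx M" "j < ny M" for i j
    using that by (cases i) (simp_all add: on_triangles)
  have "?w \<in> U_h M"
    using w1 w2 by (auto simp: U_h_def on_triangles(1) interior_hedges_def interior_vedges_def
        jump_interior_H jump_interior_V inner_normal_H inner_normal_V simp del: normal.simps)
  then show ?case
    by (simp add: edge_condition_H edge_condition_V on_triangles)
next
  case (2 w)
  then have c: "w (Lower i j) $ 2 = H_mean (\<lambda>p. u p $ 2) i j" "w (Upper i j) $ 2 = H_mean (\<lambda>p. u p $ 2) i (Suc j)"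
    "w (Lower i j) $ 1 = V_mean (\<lambda>p. u p $ 1) i j" "w (Upper i j) $ 1 = V_mean (\<lambda>p. u p $ 1) (Suc i) j"
    if "i < nx M" "j < ny M" for i j
    using that by (simp_all add: edge_condition_H edge_condition_V)
  have "w \<in> piecewise_constant M" using 2 by (simp add: U_h_def)
  then show ?case
    by (rule piecewise_constant_eqI[OF _ on_triangles(1)])
       (simp_all add: on_triangles c vec_eq_iff forall_2)
qed

text \<open>The horizontal and vertical edges of a triangle determine the off-diagonal entries. Existence requires in
  addition that the condition on the diagonal edge can be met, which holds because it is solvable for the two
  diagonal entries: neither component of the normal vanishes there.\<close>

lemma interp_Sigma_shear:
  assumes ij: "i < nx M" "j < ny M"
  shows "interp_Sigma M \<sigma> (Lower i j) $ 1 $ 2 = H_mean (\<lambda>p. \<sigma> p $ 1 $ 2) i j"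
    and "interp_Sigma M \<sigma> (Upper i j) $ 1 $ 2 = H_mean (\<lambda>p. \<sigma> p $ 1 $ 2) i (Suc j)"
    and "interp_Sigma M \<sigma> (Lower i j) $ 2 $ 1 = V_mean (\<lambda>p. \<sigma> p $ 2 $ 1) i j"
    and "interp_Sigma M \<sigma> (Upper i j) $ 2 $ 1 = V_mean (\<lambda>p. \<sigma> p $ 2 $ 1) (Suc i) j"
proof -
  define s where "s i j = (1 / edge_len M (DEdge i j)) *\<^sub>R edge_integral M (DEdge i j) (\<lambda>p. \<sigma> p *v normal M (DEdge i j))" for i j
  define n where "n i j = normal M (DEdge i j)" for i j
  have n_pos: "0 < n i j $ 1" "0 < n i j $ 2" if "i < nx M" "j < ny M" for i j
    using hx_pos[of i] hy_pos[of j] edge_len_D_pos that by (simp_all add: n_def)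
  define tensor :: "real \<Rightarrow> real \<Rightarrow> real^2 \<Rightarrow> real^2 \<Rightarrow> real^2^2" where
    "tensor \<alpha> \<beta> n s = vector [vector [(s $ 1 - \<alpha> * n $ 2) / n $ 1, \<alpha>], vector [\<beta>, (s $ 2 - \<beta> * n $ 1) / n $ 2]]" for \<alpha> \<beta> n s
  define \<alpha> where "\<alpha> = H_mean (\<lambda>p. \<sigma> p $ 1 $ 2)"
  define \<beta> where "\<beta> = V_mean (\<lambda>p. \<sigma> p $ 2 $ 1)"
  define \<tau> where "\<tau> = on_triangles (\<lambda>i j. tensor (\<alpha> i j) (\<beta> i j) (n i j) (s i j))
                                     (\<lambda>i j. tensor (\<alpha> i (Suc j)) (\<beta> (Suc i) j) (n i j) (s i j))"
  have off: "tensor \<alpha> \<beta> n s $ 1 $ 2 = \<alpha>" "tensor \<alpha> \<beta> n s $ 2 $ 1 = \<beta>" for \<alpha> \<beta> n s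
    by (simp_all add: tensor_def)
  have tensor_n: "tensor \<alpha> \<beta> m s *v m = s" if "0 < m $ 1" "0 < m $ 2" for \<alpha> \<beta> m s
    using that by (simp add: tensor_def vec_eq_iff forall_2 matrix_vector_mult_def sum_2)
  have tensor_unique: "A = tensor (A $ 1 $ 2) (A $ 2 $ 1) m (A *v m)" if "0 < m $ 1" "0 < m $ 2" for A m
    using that by (simp add: tensor_def vec_eq_iff forall_2 matrix_vector_mult_def sum_2)
  have normal_n: "normal M (DEdge i j) = n i j" for i j by (simp add: n_def)
  have ball_D: "(\<forall>e\<in>dedges M. \<forall>T\<in>adjacent M e. P e T) \<longleftrightarrow>
     (\<forall>i<nx M. \<forall>j<ny M. P (DEdge i j) (Lower i j) \<and> P (DEdge i j) (Upper i j))" for P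
    by (auto simp: dedges_def adjacent_def)
  have cond_D: "edge_integral M (DEdge i j) (\<lambda>p. k) = edge_integral M (DEdge i j) (\<lambda>p. \<sigma> p *v n i j) \<longleftrightarrow> k = s i j"
    if "i < nx M" "j < ny M" for i j k
  proof -
    have "l *\<^sub>R k = E \<longleftrightarrow> k = (1 / l) *\<^sub>R E" if "0 < l" for l E
      using that by auto
    from this[OF edge_len_D_pos[OF that]] show ?thesis
      unfolding edge_integral_const s_def normal_n .
  qed
  have "interp_Sigma M \<sigma> = \<tau>"
    unfolding interp_Sigma_def ball_adjacent_HV ball_D shear_H shear_V normal_n
  proof (rule the_equality, goal_cases)
    case 1
    have t1: "\<tau> (Upper i (j - 1)) $ 1 $ 2 = \<tau> (Lower i j) $ 1 $ 2" if "i < nx M" "0 < j" "j < ny M" for i j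
      using that by (cases j) (simp_all add: on_triangles \<tau>_def off)
    have t2: "\<tau> (Upper (i - 1) j) $ 2 $ 1 = \<tau> (Lower i j) $ 2 $ 1" if "0 < i" "i < nx M" "j < ny M" for i j
      using that by (cases i) (simp_all add: on_triangles \<tau>_def off)
    have t3: "\<tau> (Lower i j) *v n i j = s i j" "\<tau> (Upper i j) *v n i j = s i j" if "i < nx M" "j < ny M" for i j
      using that n_pos[OF that] by (simp_all add: on_triangles \<tau>_def tensor_n)
    have "\<tau> \<in> piecewise_constant M" by (simp add: \<tau>_def on_triangles)
    moreover have "\<forall>e\<in>interior_hedges M \<union> interior_vedges M.
       jump M (\<lambda>T. (\<tau> T *v normal M e) \<bullet> tangent M e) e = 0"
      using t1 t2 by (auto simp: interior_hedges_def interior_vedges_def jump_interior_H jump_interior_V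
          shear_H shear_V simp del: normal.simps tangent.simps)
    moreover have "\<forall>e\<in>dedges M. jump M (\<lambda>T. \<tau> T *v normal M e) e = 0"
      using t3 by (auto simp: dedges_def jump_D normal_n simp del: normal.simps)
    ultimately have "\<tau> \<in> Sigma_h M" by (simp add: Sigma_h_def)
    moreover have "\<tau> (Lower i j) $ 1 $ 2 = \<alpha> i j" "\<tau> (Upper i j) $ 1 $ 2 = \<alpha> i (Suc j)"
      "\<tau> (Lower i j) $ 2 $ 1 = \<beta> i j" "\<tau> (Upper i j) $ 2 $ 1 = \<beta> (Suc i) j" if "i < nx M" "j < ny M" for i j
      using that by (simp_all add: on_triangles \<tau>_def off)
    ultimately show ?case
      using t3 by (simp add: edge_condition_H edge_condition_V cond_D \<alpha>_def \<beta>_def)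
  next
    case (2 \<tau>')
    then have c: "\<tau>' (Lower i j) $ 1 $ 2 = \<alpha> i j" "\<tau>' (Upper i j) $ 1 $ 2 = \<alpha> i (Suc j)"
      "\<tau>' (Lower i j) $ 2 $ 1 = \<beta> i j" "\<tau>' (Upper i j) $ 2 $ 1 = \<beta> (Suc i) j"
      "\<tau>' (Lower i j) *v n i j = s i j" "\<tau>' (Upper i j) *v n i j = s i j"
      if "i < nx M" "j < ny M" for i j
      using that by (simp_all add: edge_condition_H edge_condition_V cond_D \<alpha>_def \<beta>_def)
    have "\<tau>' \<in> piecewise_constant M" using 2 by (simp add: Sigma_h_def)
    moreover have "\<tau>' (Lower i j) = \<tau> (Lower i j)" "\<tau>' (Upper i j) = \<tau> (Upper i j)"
      if "i < nx M" "j < ny M" for i j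
      using tensor_unique[OF n_pos[OF that], of "\<tau>' (Lower i j)"]
        tensor_unique[OF n_pos[OF that], of "\<tau>' (Upper i j)"] c[OF that] that
      by (simp_all add: \<tau>_def on_triangles)
    ultimately show ?case
      by (intro piecewise_constant_eqI) (simp_all add: \<tau>_def on_triangles(1))
  qed
  then show "interp_Sigma M \<sigma> (Lower i j) $ 1 $ 2 = H_mean (\<lambda>p. \<sigma> p $ 1 $ 2) i j"
    "interp_Sigma M \<sigma> (Upper i j) $ 1 $ 2 = H_mean (\<lambda>p. \<sigma> p $ 1 $ 2) i (Suc j)"
    "interp_Sigma M \<sigma> (Lower i j) $ 2 $ 1 = V_mean (\<lambda>p. \<sigma> p $ 2 $ 1) i j"
    "interp_Sigma M \<sigma> (Upper i j) $ 2 $ 1 = V_mean (\<lambda>p. \<sigma> p $ 2 $ 1) (Suc i) j"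
    using ij by (simp_all add: \<tau>_def on_triangles off \<alpha>_def \<beta>_def)
qed

end

section \<open>The convection form and the discrete norm as sums over cells\<close>

context rectangle_mesh
begin

lemma sum_dedges: "(\<Sum>e\<in>dedges M. \<phi> e) = (\<Sum>i<nx M. \<Sum>j<ny M. \<phi> (DEdge i j))"
proof -
  have "dedges M = (\<lambda>q. DEdge (fst q) (snd q)) ` ({..<nx M} \<times> {..<ny M})"
    by (auto simp: dedges_def image_iff)
  moreover have "inj_on (\<lambda>q. DEdge (fst q) (snd q)) ({..<nx M} \<times> {..<ny M})"
    by (auto simp: inj_on_def)
  ultimately show ?thesis
    by (simp add: sum.reindex sum.cartesian_product case_prod_beta)
qed

text \<open>The part of the norm that belongs to the diagonal edges; the rest is nonnegative.\<close>

lemma H1h_norm_bound: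
  "(\<Sum>i<nx M. \<Sum>j<ny M. (v (Upper i j) $ k - v (Lower i j) $ k)\<^sup>2) \<le> (H1h_norm M v)\<^sup>2"
  and H1h_norm_nonneg: "0 \<le> H1h_norm M v"
proof -
  define A where "A = (\<Sum>e\<in>hedges M \<union> vedges M.
        inverse (edge_len M e) * edge_integral M e (\<lambda>p. (jump M (\<lambda>T. v T \<bullet> tangent M e) e)\<^sup>2))"
  define B where "B = (\<Sum>e\<in>dedges M.
        inverse (edge_len M e) * edge_integral M e (\<lambda>p. (norm (jump M v e))\<^sup>2))"
  have A: "0 \<le> A"
    unfolding A_def by (intro sum_nonneg) (simp add: edge_integral_const edge_len_def)
  have "B = (\<Sum>i<nx M. \<Sum>j<ny M. (norm (jump M v (DEdge i j)))\<^sup>2)"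
    unfolding B_def sum_dedges
    by (intro sum.cong refl) (use edge_len_D_pos in \<open>simp add: edge_integral_const less_imp_neq[symmetric]\<close>)
  moreover have "(v (Upper i j) $ k - v (Lower i j) $ k)\<^sup>2 \<le> (norm (jump M v (DEdge i j)))\<^sup>2" for i j
  proof -
    have "\<bar>jump M v (DEdge i j) $ k\<bar> \<le> norm (jump M v (DEdge i j))" by (rule component_le_norm_cart)
    then have "\<bar>jump M v (DEdge i j) $ k\<bar>\<^sup>2 \<le> (norm (jump M v (DEdge i j)))\<^sup>2" by (rule power_mono) simp
    then show ?thesis by (simp add: jump_D power2_commute)
  qed
  ultimately have B: "(\<Sum>i<nx M. \<Sum>j<ny M. (v (Upper i j) $ k - v (Lower i j) $ k)\<^sup>2) \<le> B"
    by (simp add: sum_mono)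
  have "0 \<le> (\<Sum>i<nx M. \<Sum>j<ny M. (v (Upper i j) $ k - v (Lower i j) $ k)\<^sup>2)"
    by (intro sum_nonneg zero_le_power2)
  moreover have norm: "H1h_norm M v = sqrt (A + B)" by (simp add: H1h_norm_def A_def B_def)
  ultimately show "0 \<le> H1h_norm M v"
    "(\<Sum>i<nx M. \<Sum>j<ny M. (v (Upper i j) $ k - v (Lower i j) $ k)\<^sup>2) \<le> (H1h_norm M v)\<^sup>2"
    using A B by simp_all
qed

lemma L2_inner_realize_product:
  "L2_inner (mesh_domain M) (\<lambda>p. realize M w p $ k * realize M \<tau> p $ l $ m) (\<lambda>p. realize M v p $ n)
    = (\<Sum>i<nx M. \<Sum>j<ny M. hx M i * hy M j / 2 *
        (w (Lower i j) $ k * \<tau> (Lower i j) $ l $ m * v (Lower i j) $ n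
         + w (Upper i j) $ k * \<tau> (Upper i j) $ l $ m * v (Upper i j) $ n))"
proof -
  have "realize M w p $ k * realize M \<tau> p $ l $ m * realize M v p $ n
      = realize M (\<lambda>T. w T $ k * \<tau> T $ l $ m * v T $ n) p" for p
    by (simp only: realize_nth realize_mult)
  then show ?thesis
    unfolding L2_inner_def inner_real_def domain by (simp only: integral_realize)
qed

text \<open>On a diagonal edge, average times jump is half a difference of squares, and the length times a component of the
  normal is a side length of the cell. The products of piecewise constant fields are integrated triangle by
  triangle.\<close>

lemma c_h_eq:
  "c_h M \<tau> w v = (\<Sum>i<nx M. \<Sum>j<ny M.
     (hy M j * (((w (Upper i j) $ 1)\<^sup>2 - (w (Lower i j) $ 1)\<^sup>2) / 2)
          * ((v (Lower i j) $ 1 + v (Upper i j) $ 1) / 2)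
      + hx M i * hy M j / 2 *
          (w (Lower i j) $ 2 * \<tau> (Lower i j) $ 1 $ 2 * v (Lower i j) $ 1
           + w (Upper i j) $ 2 * \<tau> (Upper i j) $ 1 $ 2 * v (Upper i j) $ 1))
   + (hx M i * (((w (Upper i j) $ 2)\<^sup>2 - (w (Lower i j) $ 2)\<^sup>2) / 2)
          * ((v (Lower i j) $ 2 + v (Upper i j) $ 2) / 2)
      + hx M i * hy M j / 2 *
          (w (Lower i j) $ 1 * \<tau> (Lower i j) $ 2 $ 1 * v (Lower i j) $ 2
           + w (Upper i j) $ 1 * \<tau> (Upper i j) $ 2 $ 1 * v (Upper i j) $ 2)))"
proof -
  have D: "- (\<Sum>e\<in>dedges M. edge_integral M e
          (\<lambda>p. normal M e $ k * avg M (\<lambda>T. w T $ k) e * jump M (\<lambda>T. w T $ k) e * avg M (\<lambda>T. v T $ k) e))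
     = (\<Sum>i<nx M. \<Sum>j<ny M. q i j * (((w (Upper i j) $ k)\<^sup>2 - (w (Lower i j) $ k)\<^sup>2) / 2)
          * ((v (Lower i j) $ k + v (Upper i j) $ k) / 2))"
    if q: "\<And>i j. i < nx M \<Longrightarrow> j < ny M \<Longrightarrow> edge_len M (DEdge i j) * normal M (DEdge i j) $ k = q i j" for k q
    unfolding sum_dedges sum_negf[symmetric]
  proof (intro sum.cong refl)
    fix i j assume "i \<in> {..<nx M}" "j \<in> {..<ny M}"
    then have q': "edge_len M (DEdge i j) * normal M (DEdge i j) $ k = q i j" by (intro q) simp_all
    let ?e = "DEdge i j"
    let ?p = "avg M (\<lambda>T. w T $ k) ?e * jump M (\<lambda>T. w T $ k) ?e * avg M (\<lambda>T. v T $ k) ?e"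
    have "edge_integral M ?e (\<lambda>p. normal M ?e $ k * avg M (\<lambda>T. w T $ k) ?e * jump M (\<lambda>T. w T $ k) ?e
            * avg M (\<lambda>T. v T $ k) ?e) = (edge_len M ?e * normal M ?e $ k) * ?p"
      unfolding edge_integral_const real_scaleR_def by (simp only: mult.assoc)
    moreover have "- (q i j * ?p) = q i j * (((w (Upper i j) $ k)\<^sup>2 - (w (Lower i j) $ k)\<^sup>2) / 2)
          * ((v (Lower i j) $ k + v (Upper i j) $ k) / 2)"
      unfolding jump_D avg_D by (simp add: power2_eq_square algebra_simps)
    ultimately show "- edge_integral M ?e (\<lambda>p. normal M ?e $ k * avg M (\<lambda>T. w T $ k) ?e
            * jump M (\<lambda>T. w T $ k) ?e * avg M (\<lambda>T. v T $ k) ?e)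
        = q i j * (((w (Upper i j) $ k)\<^sup>2 - (w (Lower i j) $ k)\<^sup>2) / 2)
          * ((v (Lower i j) $ k + v (Upper i j) $ k) / 2)"
      unfolding q' by (simp only:)
  qed
  have len1: "edge_len M (DEdge i j) * normal M (DEdge i j) $ 1 = hy M j"
    and len2: "edge_len M (DEdge i j) * normal M (DEdge i j) $ 2 = hx M i"
    if "i < nx M" "j < ny M" for i j
    using edge_len_D_pos[OF that] by simp_all
  show ?thesis
    unfolding c_h_def L2_inner_realize_product minus_mult_minus
    using D[of 1 "\<lambda>i j. hy M j", OF len1] D[of 2 "\<lambda>i j. hx M i", OF len2]
    by (simp add: sum.distrib)
qed

lemma L2_inner_continuous:
  fixes G :: "real \<times> real \<Rightarrow> real^2" and G1 G2 :: "real \<times> real \<Rightarrow> real"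
  assumes G1: "continuous_on ({a..b} \<times> {c..d}) G1" and G2: "continuous_on ({a..b} \<times> {c..d}) G2"
    and G: "\<And>p. p \<in> \<Omega> \<Longrightarrow> G p $ 1 = G1 p" "\<And>p. p \<in> \<Omega> \<Longrightarrow> G p $ 2 = G2 p"
  shows "L2_inner \<Omega> G (realize M v) = (\<Sum>i<nx M. \<Sum>j<ny M.
      (v (Lower i j) $ 1 * integral (lower i j) G1
       + v (Upper i j) $ 1 * integral (upper i j) G1)
    + (v (Lower i j) $ 2 * integral (lower i j) G2
       + v (Upper i j) $ 2 * integral (upper i j) G2))"
proof -
  have "L2_inner \<Omega> G (realize M v)
      = (LINT p|lebesgue_on \<Omega>. G1 p * realize M (\<lambda>T. v T $ 1) p + G2 p * realize M (\<lambda>T. v T $ 2) p)"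
    unfolding L2_inner_def
    by (intro Bochner_Integration.integral_cong refl)
       (simp add: inner_vec_def sum_2 realize_nth G)
  also have "\<dots> = (LINT p|lebesgue_on \<Omega>. G1 p * realize M (\<lambda>T. v T $ 1) p)
                + (LINT p|lebesgue_on \<Omega>. G2 p * realize M (\<lambda>T. v T $ 2) p)"
    by (intro Bochner_Integration.integral_add integral_against_realize G1 G2)
  finally show ?thesis
    unfolding integral_against_realize(2)[OF G1] integral_against_realize(2)[OF G2]
    by (simp only: sum.distrib)
qed

text \<open>The conditions on vertical and horizontal edges say that the first component is indexed by the vertical edges
  and the second one by the horizontal edges, with the value \<open>0\<close> on the boundary.\<close>

lemma normal_component_values:
  assumes v: "v \<in> U_h0 M"
    and vx_def: "vx = (\<lambda>i j. if i < nx M then v (Lower i j) $ 1 else 0)"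
    and vy_def: "vy = (\<lambda>i j. if j < ny M then v (Lower i j) $ 2 else 0)"
  shows "i < nx M \<Longrightarrow> j < ny M \<Longrightarrow> v (Lower i j) $ 1 = vx i j"
    and "i < nx M \<Longrightarrow> j < ny M \<Longrightarrow> v (Upper i j) $ 1 = vx (Suc i) j"
    and "i < nx M \<Longrightarrow> j < ny M \<Longrightarrow> v (Lower i j) $ 2 = vy i j"
    and "i < nx M \<Longrightarrow> j < ny M \<Longrightarrow> v (Upper i j) $ 2 = vy i (Suc j)"
    and "j < ny M \<Longrightarrow> vx 0 j = 0"
    and "i < nx M \<Longrightarrow> vy i 0 = 0"
proof -
  note defs = boundary_edges_def vedges_def hedges_def interior_vedges_def interior_hedges_def adjacent_def
  have int: "jump M (\<lambda>T. v T \<bullet> normal M e) e = 0" if "e \<in> interior_hedges M \<union> interior_vedges M" for e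
    using v that by (auto simp: U_h0_def U_h_def)
  have bdry: "v T \<bullet> normal M e = 0" if "e \<in> boundary_edges M" "T \<in> adjacent M e" for e T
    using v that by (auto simp: U_h0_def)
  show "i < nx M \<Longrightarrow> j < ny M \<Longrightarrow> v (Lower i j) $ 1 = vx i j"
    "i < nx M \<Longrightarrow> j < ny M \<Longrightarrow> v (Lower i j) $ 2 = vy i j" by (simp_all add: vx_def vy_def)
  show "v (Upper i j) $ 1 = vx (Suc i) j" if ij: "i < nx M" "j < ny M"
  proof (cases "Suc i < nx M")
    case True
    then have "VEdge (Suc i) j \<in> interior_vedges M" using ij by (simp add: interior_vedges_def)
    then show ?thesis
      using int[of "VEdge (Suc i) j"] True
      by (simp only: Un_iff simp_thms jump_interior_V zero_less_Suc inner_normal_V vx_def if_True) simp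
  next
    case False
    then have "VEdge (Suc i) j \<in> boundary_edges M" "Upper i j \<in> adjacent M (VEdge (Suc i) j)"
      using ij by (auto simp: defs)
    from bdry[OF this] show ?thesis using False by (simp only: inner_normal_V vx_def if_False)
  qed
  show "v (Upper i j) $ 2 = vy i (Suc j)" if ij: "i < nx M" "j < ny M"
  proof (cases "Suc j < ny M")
    case True
    then have "HEdge i (Suc j) \<in> interior_hedges M" using ij by (simp add: interior_hedges_def)
    then show ?thesis
      using int[of "HEdge i (Suc j)"] True
      by (simp only: Un_iff simp_thms jump_interior_H zero_less_Suc inner_normal_H vy_def if_True) simp
  next
    case False
    then have "HEdge i (Suc j) \<in> boundary_edges M" "Upper i j \<in> adjacent M (HEdge i (Suc j))"
      using ij by (auto simp: defs)
    from bdry[OF this] show ?thesis using False by (simp only: inner_normal_H vy_def if_False)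
  qed
  show "vx 0 j = 0" if j: "j < ny M"
  proof -
    have "VEdge 0 j \<in> boundary_edges M" "Lower 0 j \<in> adjacent M (VEdge 0 j)"
      using j n_pos by (auto simp: defs)
    from bdry[OF this] show ?thesis using n_pos by (simp only: inner_normal_V vx_def if_True)
  qed
  show "vy i 0 = 0" if i: "i < nx M"
  proof -
    have "HEdge i 0 \<in> boundary_edges M" "Lower i 0 \<in> adjacent M (HEdge i 0)"
      using i n_pos by (auto simp: defs)
    from bdry[OF this] show ?thesis using n_pos by (simp only: inner_normal_H vy_def if_True)
  qed
qed

end

section \<open>A discrete Poincare inequality\<close>

lemma sum_abs_le_sqrt:
  fixes z w :: "'i \<Rightarrow> real"
  shows "(\<Sum>i\<in>A. w i * \<bar>z i\<bar>) \<le> sqrt (\<Sum>i\<in>A. (w i)\<^sup>2) * sqrt (\<Sum>i\<in>A. (z i)\<^sup>2)"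
proof -
  have "(\<Sum>i\<in>A. w i * \<bar>z i\<bar>)\<^sup>2 \<le> (\<Sum>i\<in>A. (w i)\<^sup>2) * (\<Sum>i\<in>A. \<bar>z i\<bar>\<^sup>2)"
    by (rule Cauchy_Schwarz_ineq_sum)
  then show ?thesis
    by (simp add: real_le_rsqrt flip: real_sqrt_mult)
qed

text \<open>Telescoping from the boundary bounds \<open>\<bar>V i j\<bar>\<close> by the sum of the increments in the row \<open>j\<close>, and the sum of
  \<open>q j\<close> times the increments is estimated by the Cauchy-Schwarz inequality. There the ratio condition converts
  \<open>(q j)\<^sup>2\<close> into areas of cells, whose sum is fixed. The term with \<open>h\<close> times an increment needs no telescoping,
  since \<open>p i \<le> h\<close> supplies the second power of \<open>h\<close>.\<close>

lemma discrete_poincare: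
  fixes p q :: "nat \<Rightarrow> real" and V :: "nat \<Rightarrow> nat \<Rightarrow> real"
  assumes p: "\<And>i. i < m \<Longrightarrow> 0 < p i" and q: "\<And>j. j < n \<Longrightarrow> 0 < q j"
    and hp: "\<And>i. i < m \<Longrightarrow> p i \<le> h"
    and ratio: "\<And>i j. i < m \<Longrightarrow> j < n \<Longrightarrow> q j \<le> r * p i"
    and P: "(\<Sum>i<m. p i) = P" and Q: "(\<Sum>j<n. q j) = Q"
    and zero: "\<And>j. j < n \<Longrightarrow> V 0 j = 0"
    and N: "(\<Sum>i<m. \<Sum>j<n. (V (Suc i) j - V i j)\<^sup>2) \<le> N\<^sup>2" "0 \<le> N"
  shows "(\<Sum>i<m. \<Sum>j<n. p i * q j * (h\<^sup>2 * (\<bar>V i j\<bar> + \<bar>V (Suc i) j\<bar>) + h * \<bar>V (Suc i) j - V i j\<bar>))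
       \<le> (2 * P + 1) * sqrt (r * (P * Q)) * h\<^sup>2 * N"
proof -
  define T where "T = (\<Sum>i<m. \<Sum>j<n. q j * \<bar>V (Suc i) j - V i j\<bar>)"
  have P0: "0 \<le> P" unfolding P[symmetric] using p by (intro sum_nonneg) (auto intro: less_imp_le)
  have V: "\<bar>V i j\<bar> \<le> (\<Sum>k<m. \<bar>V (Suc k) j - V k j\<bar>)" if "i \<le> m" "j < n" for i j
  proof -
    have "V i j = (\<Sum>k<i. V (Suc k) j - V k j)"
      using zero[OF that(2)] sum_lessThan_telescope[of "\<lambda>k. V k j" i] by simp
    also have "\<bar>\<dots>\<bar> \<le> (\<Sum>k<i. \<bar>V (Suc k) j - V k j\<bar>)" by (rule sum_abs)
    also have "\<dots> \<le> (\<Sum>k<m. \<bar>V (Suc k) j - V k j\<bar>)"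
      using that(1) by (intro sum_mono2) auto
    finally show ?thesis .
  qed
  have sumV: "(\<Sum>i<m. \<Sum>j<n. p i * q j * \<bar>V (f i) j\<bar>) \<le> P * T" if f: "\<And>i. i < m \<Longrightarrow> f i \<le> m" for f
  proof -
    have "(\<Sum>i<m. \<Sum>j<n. p i * q j * \<bar>V (f i) j\<bar>)
        \<le> (\<Sum>i<m. \<Sum>j<n. p i * q j * (\<Sum>k<m. \<bar>V (Suc k) j - V k j\<bar>))"
      using p q f by (intro sum_mono mult_left_mono V) (auto intro: less_imp_le)
    also have "\<dots> = (\<Sum>i<m. p i * (\<Sum>j<n. \<Sum>k<m. q j * \<bar>V (Suc k) j - V k j\<bar>))"
      by (simp add: sum_distrib_left mult.assoc)
    also have "\<dots> = P * T"
      unfolding T_def sum.swap[of _ "{..<n}"] by (simp add: P flip: sum_distrib_right)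
    finally show ?thesis .
  qed
  have diff: "(\<Sum>i<m. \<Sum>j<n. p i * q j * \<bar>V (Suc i) j - V i j\<bar>) \<le> h * T"
    unfolding T_def sum_distrib_left mult.assoc
    by (intro sum_mono mult_right_mono hp mult_nonneg_nonneg abs_ge_zero less_imp_le[OF q]) simp_all
  have "T \<le> sqrt (r * (P * Q)) * N"
  proof -
    let ?A = "{..<m} \<times> {..<n}"
    have "T = (\<Sum>k\<in>?A. q (snd k) * \<bar>V (Suc (fst k)) (snd k) - V (fst k) (snd k)\<bar>)"
      unfolding T_def by (simp add: sum.cartesian_product case_prod_beta)
    also have "\<dots> \<le> sqrt (\<Sum>k\<in>?A. (q (snd k))\<^sup>2) * sqrt (\<Sum>k\<in>?A. (V (Suc (fst k)) (snd k) - V (fst k) (snd k))\<^sup>2)"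
      by (rule sum_abs_le_sqrt)
    also have "\<dots> \<le> sqrt (r * (P * Q)) * N"
    proof (rule mult_mono)
      have "(\<Sum>k\<in>?A. (q (snd k))\<^sup>2) \<le> (\<Sum>k\<in>?A. r * (p (fst k) * q (snd k)))"
      proof (rule sum_mono)
        fix k assume "k \<in> ?A"
        then have "q (snd k) * q (snd k) \<le> (r * p (fst k)) * q (snd k)"
          using q by (intro mult_right_mono ratio) (auto intro: less_imp_le)
        then show "(q (snd k))\<^sup>2 \<le> r * (p (fst k) * q (snd k))" by (simp add: power2_eq_square mult.assoc)
      qed
      also have "\<dots> = r * (\<Sum>k\<in>?A. p (fst k) * q (snd k))" by (rule sum_distrib_left[symmetric])
      also have "(\<Sum>k\<in>?A. p (fst k) * q (snd k)) = P * Q"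
        unfolding P[symmetric] Q[symmetric] sum_product
        by (simp add: sum.cartesian_product case_prod_beta)
      finally have le: "(\<Sum>k\<in>?A. (q (snd k))\<^sup>2) \<le> r * (P * Q)" .
      then show "sqrt (\<Sum>k\<in>?A. (q (snd k))\<^sup>2) \<le> sqrt (r * (P * Q))" by simp
      have "(\<Sum>k\<in>?A. (V (Suc (fst k)) (snd k) - V (fst k) (snd k))\<^sup>2) \<le> N\<^sup>2"
        using N(1) by (simp add: sum.cartesian_product case_prod_beta)
      then show "sqrt (\<Sum>k\<in>?A. (V (Suc (fst k)) (snd k) - V (fst k) (snd k))\<^sup>2) \<le> N"
        using N(2) by (simp add: real_le_lsqrt)
      have "0 \<le> (\<Sum>k\<in>?A. (q (snd k))\<^sup>2)" by (intro sum_nonneg) simp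
      with le show "0 \<le> sqrt (r * (P * Q))" by simp
    qed (intro real_sqrt_ge_zero sum_nonneg zero_le_power2)
    finally show ?thesis .
  qed
  have "(\<Sum>i<m. \<Sum>j<n. p i * q j * (h\<^sup>2 * (\<bar>V i j\<bar> + \<bar>V (Suc i) j\<bar>) + h * \<bar>V (Suc i) j - V i j\<bar>))
      = h\<^sup>2 * (\<Sum>i<m. \<Sum>j<n. p i * q j * \<bar>V i j\<bar>) + h\<^sup>2 * (\<Sum>i<m. \<Sum>j<n. p i * q j * \<bar>V (Suc i) j\<bar>)
        + h * (\<Sum>i<m. \<Sum>j<n. p i * q j * \<bar>V (Suc i) j - V i j\<bar>)"
    by (simp add: sum_distrib_left sum.distrib[symmetric] algebra_simps)
  also have "\<dots> \<le> h\<^sup>2 * (P * T) + h\<^sup>2 * (P * T) + h * (h * T)"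
  proof (cases "m = 0")
    case True
    then show ?thesis by (simp add: T_def)
  next
    case False
    then have "0 \<le> h" using p[of 0] hp[of 0] by simp
    then show ?thesis
      using sumV[of "\<lambda>i. i"] sumV[of Suc] diff by (intro add_mono mult_left_mono) simp_all
  qed
  also have "\<dots> = ((2 * P + 1) * h\<^sup>2) * T" by (simp add: power2_eq_square algebra_simps)
  also have "\<dots> \<le> ((2 * P + 1) * h\<^sup>2) * (sqrt (r * (P * Q)) * N)"
    using P0 \<open>T \<le> _\<close> by (intro mult_left_mono) simp_all
  finally show ?thesis by (simp add: mult_ac)
qed

section \<open>Second order consistency\<close>

lemma convection_second_order:
  assumes ab: "a \<le> b" "c \<le> d" and U: "jet K a b c d DU" and W: "jet K a b c d DW" and P: "jet K a b c d DP"
  shows "second_order (8 * (2 * K)\<^sup>2) {a..b} {c..d}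
           (\<lambda>x y. DU 0 0 x y * DP 1 0 x y + DW 0 0 x y * DP 0 1 x y)"
proof -
  have "a \<in> {a..b}" "c \<in> {c..d}" using ab by simp_all
  from order_trans[OF abs_ge_zero jet_bound[OF U this, of 0 0]] have K: "0 \<le> 2 * K" by simp
  have "second_order (4 * (2 * K) * (2 * K) + 4 * (2 * K) * (2 * K)) {a..b} {c..d}
           (\<lambda>x y. DU 0 0 x y * DP 1 0 x y + DW 0 0 x y * DP 0 1 x y)"
    by (intro second_order_add second_order_mult jet_second_order[OF U] jet_second_order[OF W]
        jet_second_order[OF P] ab K) simp_all
  moreover have "4 * (2 * K) * (2 * K) + 4 * (2 * K) * (2 * K) = 8 * (2 * K)\<^sup>2"
    by (simp add: power2_eq_square)
  ultimately show ?thesis by (simp only:)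
qed

locale consistency_setting = rectangle_mesh +
  fixes K C1 C2 :: real and D1 D2 :: "nat \<Rightarrow> nat \<Rightarrow> real \<Rightarrow> real \<Rightarrow> real" and u :: "real \<times> real \<Rightarrow> real^2"
  assumes jets: "jet K a b c d D1" "jet K a b c d D2"
    and u1: "\<And>x y. x \<in> {a..b} \<Longrightarrow> y \<in> {c..d} \<Longrightarrow> u (x, y) $ 1 = D1 0 0 x y"
    and u2: "\<And>x y. x \<in> {a..b} \<Longrightarrow> y \<in> {c..d} \<Longrightarrow> u (x, y) $ 2 = D2 0 0 x y"
    and regular: "mesh_regular C1 C2 M" and C1_pos: "0 < C1"
begin

abbreviation "S \<equiv> {a..b} \<times> {c..d}"
abbreviation "h \<equiv> mesh_size M"
abbreviation "L \<equiv> (b - a) + (d - c)"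
abbreviation "\<sigma> \<equiv> gradient S u"
abbreviation "w \<equiv> \<lambda>T. interp_U M u T - delta_h M u T"
abbreviation "\<tau> \<equiv> interp_Sigma M \<sigma>"
abbreviation "F1 \<equiv> \<lambda>x y. D1 0 0 x y * D1 1 0 x y + D2 0 0 x y * D1 0 1 x y"
abbreviation "F2 \<equiv> \<lambda>x y. D1 0 0 x y * D2 1 0 x y + D2 0 0 x y * D2 0 1 x y"

lemma closure_domain: "closure (mesh_domain M) = S"
  using ab by (simp add: domain closure_Times)

lemma partials:
  assumes "x \<in> {a..b}" "y \<in> {c..d}"
  shows "partial_x S (\<lambda>p. u p $ 1) (x, y) = D1 1 0 x y" "partial_y S (\<lambda>p. u p $ 1) (x, y) = D1 0 1 x y"
    "partial_x S (\<lambda>p. u p $ 2) (x, y) = D2 1 0 x y" "partial_y S (\<lambda>p. u p $ 2) (x, y) = D2 0 1 x y"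
  using partial_of_jet[OF ab jets(1), of 0 0 "\<lambda>p. u p $ 1", OF _ u1 assms]
    partial_of_jet[OF ab jets(2), of 0 0 "\<lambda>p. u p $ 2", OF _ u2 assms] by simp_all

lemma second_partials:
  assumes "x \<in> {a..b}" "y \<in> {c..d}"
  shows "partial_y S (partial_y S (\<lambda>p. u p $ 1)) (x, y) = D1 0 2 x y"
    "partial_x S (partial_x S (\<lambda>p. u p $ 2)) (x, y) = D2 2 0 x y"
  using partial_of_jet(2)[OF ab jets(1), of 0 1 "partial_y S (\<lambda>p. u p $ 1)", OF _ partials(2) assms]
    partial_of_jet(1)[OF ab jets(2), of 1 0 "partial_x S (\<lambda>p. u p $ 2)", OF _ partials(3) assms]
  by (simp_all add: numeral_2_eq_2)

lemma gradient_entries: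
  assumes "x \<in> {a..b}" "y \<in> {c..d}"
  shows "\<sigma> (x, y) $ 1 $ 2 = D1 0 1 x y" "\<sigma> (x, y) $ 2 $ 1 = D2 1 0 x y"
    "(\<sigma> (x, y) *v u (x, y)) $ 1 = F1 x y" "(\<sigma> (x, y) *v u (x, y)) $ 2 = F2 x y"
  using partials[OF assms] u1[OF assms] u2[OF assms]
  by (simp_all add: gradient_def matrix_vector_mult_def sum_2)

lemma Y_interval: "j < ny M \<Longrightarrow> z \<in> {Y j..Y (Suc j)} \<Longrightarrow> z \<in> {c..d}"
  and X_interval: "i < nx M \<Longrightarrow> z \<in> {X i..X (Suc i)} \<Longrightarrow> z \<in> {a..b}"
  using Y_in[of j] Y_in[of "Suc j"] X_in[of i] X_in[of "Suc i"] by auto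

lemma mean_values:
  shows "i \<le> nx M \<Longrightarrow> j < ny M \<Longrightarrow> V_mean (\<lambda>p. u p $ 1) i j = eavg (Y j) (Y (Suc j)) (D1 0 0 (X i))"
    and "i < nx M \<Longrightarrow> j \<le> ny M \<Longrightarrow> H_mean (\<lambda>p. u p $ 2) i j = eavg (X i) (X (Suc i)) (\<lambda>x. D2 0 0 x (Y j))"
    and "i \<le> nx M \<Longrightarrow> j < ny M \<Longrightarrow> V_mean (\<lambda>p. \<sigma> p $ 2 $ 1) i j = eavg (Y j) (Y (Suc j)) (D2 1 0 (X i))"
    and "i < nx M \<Longrightarrow> j \<le> ny M \<Longrightarrow> H_mean (\<lambda>p. \<sigma> p $ 1 $ 2) i j = eavg (X i) (X (Suc i)) (\<lambda>x. D1 0 1 x (Y j))"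
  unfolding V_mean_def H_mean_def
  by (intro eavg_cong u1 u2 gradient_entries X_in Y_in X_interval[of i] Y_interval[of j] X_mono Y_mono; simp)+

lemma delta_values:
  shows "i \<le> nx M \<Longrightarrow> j < ny M \<Longrightarrow> delta_x M u i j
      = (Y (Suc j) - Y j)\<^sup>2 / 6 * D1 0 2 (X i) ((Y j + Y (Suc j)) / 2)"
    and "i < nx M \<Longrightarrow> j \<le> ny M \<Longrightarrow> delta_y M u i j
      = (X (Suc i) - X i)\<^sup>2 / 6 * D2 2 0 ((X i + X (Suc i)) / 2) (Y j)"
proof -
  show "delta_x M u i j = (Y (Suc j) - Y j)\<^sup>2 / 6 * D1 0 2 (X i) ((Y j + Y (Suc j)) / 2)"
    if ij: "i \<le> nx M" "j < ny M"
  proof -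
    have "ymid M j \<in> {c..d}"
      by (rule Y_interval[OF ij(2)]) (use Y_less[of j "Suc j"] ij in \<open>simp add: ymid_def\<close>)
    from second_partials(1)[OF X_in[OF ij(1)] this] show ?thesis
      by (simp add: delta_x_def closure_domain hy_def ymid_def)
  qed
  show "delta_y M u i j = (X (Suc i) - X i)\<^sup>2 / 6 * D2 2 0 ((X i + X (Suc i)) / 2) (Y j)"
    if ij: "i < nx M" "j \<le> ny M"
  proof -
    have "xmid M i \<in> {a..b}"
      by (rule X_interval[OF ij(1)]) (use X_less[of i "Suc i"] ij in \<open>simp add: xmid_def\<close>)
    from second_partials(2)[OF this Y_in[OF ij(2)]] show ?thesis
      by (simp add: delta_y_def closure_domain hx_def xmid_def)
  qed
qed

lemma corrected_values:
  assumes "i < nx M" "j < ny M"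
  shows "w (Lower i j) $ 1 = V_mean (\<lambda>p. u p $ 1) i j - delta_x M u i j"
    "w (Lower i j) $ 2 = H_mean (\<lambda>p. u p $ 2) i j - delta_y M u i j"
    "w (Upper i j) $ 1 = V_mean (\<lambda>p. u p $ 1) (Suc i) j - delta_x M u (Suc i) j"
    "w (Upper i j) $ 2 = H_mean (\<lambda>p. u p $ 2) i (Suc j) - delta_y M u i (Suc j)"
  using assms by (simp_all add: interp_U_eq on_triangles delta_h_def mem_triangles)

lemma cell_x:
  assumes "i < nx M" "j < ny M"
  shows "transport_cell K L a b c d (X i) (X (Suc i)) (Y j) (Y (Suc j)) h D1 D2"
  using assms X_in[of i] X_in[of "Suc i"] Y_in[of j] Y_in[of "Suc j"] X_less[of i "Suc i"] Y_less[of j "Suc j"]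
    hx_le[of i] hy_le[of j] mesh_size_le jets
  by unfold_locales (simp_all add: hx_def hy_def)

lemma cell_y:
  assumes "i < nx M" "j < ny M"
  shows "transport_cell K L c d a b (Y j) (Y (Suc j)) (X i) (X (Suc i)) h (\<lambda>i j y x. D2 j i x y) (\<lambda>i j y x. D1 j i x y)"
  using assms X_in[of i] X_in[of "Suc i"] Y_in[of j] Y_in[of "Suc j"] X_less[of i "Suc i"] Y_less[of j "Suc j"]
    hx_le[of i] hy_le[of j] mesh_size_le jet_swap[OF jets(1)] jet_swap[OF jets(2)]
  by unfold_locales (simp_all add: hx_def hy_def)

lemma tri_integrals:
  assumes ij: "i < nx M" "j < ny M" and F: "second_order \<mu> {a..b} {c..d} F"
  shows "\<bar>integral (lower i j) (case_prod F) + integral (upper i j) (case_prod F)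
           - (X (Suc i) - X i) * (Y (Suc j) - Y j) * F ((X i + X (Suc i)) / 2) ((Y j + Y (Suc j)) / 2)\<bar>
         \<le> (X (Suc i) - X i) * (Y (Suc j) - Y j) * (\<mu> * h\<^sup>2)" (is ?mean)
    and "\<bar>integral (upper i j) (case_prod F) - integral (lower i j) (case_prod F)\<bar>
         \<le> (X (Suc i) - X i) * (Y (Suc j) - Y j) * (2 * \<mu> * h)" (is ?diff)
proof -
  interpret c: transport_cell K L a b c d "X i" "X (Suc i)" "Y j" "Y (Suc j)" h D1 D2
    by (rule cell_x[OF ij])
  have "continuous_on S (case_prod F)" by (rule second_order_continuous_on[OF F]) simp
  then have "continuous_on (cbox (X i, Y j) (X (Suc i), Y (Suc j))) (case_prod F)"
    by (rule continuous_on_subset) (use X_interval[OF ij(1)] Y_interval[OF ij(2)] in \<open>auto simp: cbox_eq_Times\<close>)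
  from integral_triangles_bounds[OF F c.x c.y c.h(1,2) this] show ?mean ?diff by simp_all
qed

text \<open>The contributions of the cell \<open>(i, j)\<close> to the consistency error, one for each component of the test function,
  which has the values \<open>v0\<close> and \<open>v1\<close> on the lower and the upper triangle.\<close>

definition "E1 v0 v1 i j =
   integral (lower i j) (case_prod F1) * v0
   + integral (upper i j) (case_prod F1) * v1
   - (hy M j * (((w (Upper i j) $ 1)\<^sup>2 - (w (Lower i j) $ 1)\<^sup>2) / 2) * ((v0 + v1) / 2)
      + hx M i * hy M j / 2 * (w (Lower i j) $ 2 * \<tau> (Lower i j) $ 1 $ 2 * v0
                             + w (Upper i j) $ 2 * \<tau> (Upper i j) $ 1 $ 2 * v1))"

definition "E2 v0 v1 i j =
   integral (lower i j) (case_prod F2) * v0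
   + integral (upper i j) (case_prod F2) * v1
   - (hx M i * (((w (Upper i j) $ 2)\<^sup>2 - (w (Lower i j) $ 2)\<^sup>2) / 2) * ((v0 + v1) / 2)
      + hx M i * hy M j / 2 * (w (Lower i j) $ 1 * \<tau> (Lower i j) $ 2 $ 1 * v0
                             + w (Upper i j) $ 1 * \<tau> (Upper i j) $ 2 $ 1 * v1))"

lemma F1_second_order: "second_order (8 * (2 * K)\<^sup>2) {a..b} {c..d} F1"
  and F2_second_order: "second_order (8 * (2 * K)\<^sup>2) {a..b} {c..d} F2"
  using convection_second_order[OF _ _ jets jets(1)] convection_second_order[OF _ _ jets jets(2)] ab by simp_all

lemma E1_bound:
  assumes ij: "i < nx M" "j < ny M"
  shows "\<bar>E1 v0 v1 i j\<bar> \<le> consistency_const K L * (hx M i * hy M j * (h\<^sup>2 * (\<bar>v0\<bar> + \<bar>v1\<bar>) + h * \<bar>v1 - v0\<bar>))"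
proof -
  interpret c: transport_cell K L a b c d "X i" "X (Suc i)" "Y j" "Y (Suc j)" h D1 D2
    by (rule cell_x[OF ij])
  have le: "i \<le> nx M" "Suc i \<le> nx M" "j \<le> ny M" "Suc j \<le> ny M" using ij by simp_all
  have vals: "w (Lower i j) $ 1 = c.u_tilde (X i)" "w (Upper i j) $ 1 = c.u_tilde (X (Suc i))"
    "w (Lower i j) $ 2 = c.w_tilde (Y j)" "w (Upper i j) $ 2 = c.w_tilde (Y (Suc j))"
    "\<tau> (Lower i j) $ 1 $ 2 = c.s_tilde (Y j)" "\<tau> (Upper i j) $ 1 $ 2 = c.s_tilde (Y (Suc j))"
    unfolding corrected_values[OF ij] interp_Sigma_shear[OF ij] c.u_tilde_def c.w_tilde_def c.s_tilde_def
      c.xm_def c.ym_def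
    using ij le by (simp_all only: mean_values delta_values)
  show ?thesis
    unfolding E1_def vals hx_def hy_def
    by (rule c.total_error)
       (unfold c.xm_def c.ym_def, (rule tri_integrals[OF ij F1_second_order])+)
qed

lemma E2_bound:
  assumes ij: "i < nx M" "j < ny M"
  shows "\<bar>E2 v0 v1 i j\<bar> \<le> consistency_const K L * (hy M j * hx M i * (h\<^sup>2 * (\<bar>v0\<bar> + \<bar>v1\<bar>) + h * \<bar>v1 - v0\<bar>))"
proof -
  interpret c: transport_cell K L c d a b "Y j" "Y (Suc j)" "X i" "X (Suc i)" h
      "\<lambda>i j y x. D2 j i x y" "\<lambda>i j y x. D1 j i x y"
    by (rule cell_y[OF ij])
  have le: "i \<le> nx M" "Suc i \<le> nx M" "j \<le> ny M" "Suc j \<le> ny M" using ij by simp_all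
  have vals: "w (Lower i j) $ 2 = c.u_tilde (Y j)" "w (Upper i j) $ 2 = c.u_tilde (Y (Suc j))"
    "w (Lower i j) $ 1 = c.w_tilde (X i)" "w (Upper i j) $ 1 = c.w_tilde (X (Suc i))"
    "\<tau> (Lower i j) $ 2 $ 1 = c.s_tilde (X i)" "\<tau> (Upper i j) $ 2 $ 1 = c.s_tilde (X (Suc i))"
    unfolding corrected_values[OF ij] interp_Sigma_shear[OF ij] c.u_tilde_def c.w_tilde_def c.s_tilde_def
      c.xm_def c.ym_def
    using ij le by (simp_all only: mean_values delta_values)
  have F: "F2 c.ym c.xm = D2 0 0 c.ym c.xm * D2 0 1 c.ym c.xm + D1 0 0 c.ym c.xm * D2 1 0 c.ym c.xm"
    by (rule add.commute)
  note I = tri_integrals[OF ij F2_second_order, folded c.xm_def c.ym_def, unfolded F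
      mult.commute[of "X (Suc i) - X i" "Y (Suc j) - Y j"]]
  show ?thesis
    unfolding E2_def vals hx_def hy_def mult.commute[of "X (Suc i) - X i" "Y (Suc j) - Y j"]
    by (rule c.total_error) (rule I)+
qed

theorem consistency:
  assumes v: "v \<in> U_h0 M"
  shows "L2_inner \<Omega> (\<lambda>p. \<sigma> p *v u p) (realize M v) - c_h M \<tau> w v
     \<le> consistency_const K L * ((2 * (b - a) + 1) * sqrt (C2 * ((b - a) * (d - c)))
          + (2 * (d - c) + 1) * sqrt (1 / C1 * ((d - c) * (b - a)))) * h\<^sup>2 * H1h_norm M v"
proof -
  define N where "N = H1h_norm M v"
  define vx where "vx = (\<lambda>i j. if i < nx M then v (Lower i j) $ 1 else 0)"
  define vy where "vy = (\<lambda>i j. if j < ny M then v (Lower i j) $ 2 else 0)"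
  let ?C = "consistency_const K L"
  let ?ex = "\<lambda>i j. hx M i * hy M j * (h\<^sup>2 * (\<bar>vx i j\<bar> + \<bar>vx (Suc i) j\<bar>) + h * \<bar>vx (Suc i) j - vx i j\<bar>)"
  let ?ey = "\<lambda>i j. hy M j * hx M i * (h\<^sup>2 * (\<bar>vy i j\<bar> + \<bar>vy i (Suc j)\<bar>) + h * \<bar>vy i (Suc j) - vy i j\<bar>)"
  note vals = normal_component_values[OF v vx_def vy_def]
  have K0: "0 \<le> ?C"
    using ab by (simp add: consistency_const_def Let_def)
  have G: "continuous_on S (case_prod F1)" "continuous_on S (case_prod F2)"
    by (rule second_order_continuous_on[OF F1_second_order] second_order_continuous_on[OF F2_second_order]; simp)+
  have val: "(\<sigma> p *v u p) $ 1 = case_prod F1 p" "(\<sigma> p *v u p) $ 2 = case_prod F2 p" if "p \<in> \<Omega>" for p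
    using that gradient_entries(3,4)[of "fst p" "snd p"] by (auto simp: case_prod_beta)
  have "L2_inner \<Omega> (\<lambda>p. \<sigma> p *v u p) (realize M v) - c_h M \<tau> w v
      = (\<Sum>i<nx M. \<Sum>j<ny M. E1 (v (Lower i j) $ 1) (v (Upper i j) $ 1) i j
                           + E2 (v (Lower i j) $ 2) (v (Upper i j) $ 2) i j)"
  proof -
    have "(x * a' + y * b' + (z * c' + t * d')) - (p + q + (r + s))
        = (a' * x + b' * y - (p + q)) + (c' * z + d' * t - (r + s))"
      for x y z t a' b' c' d' p q r s :: real by simp
    then show ?thesis
      unfolding c_h_eq E1_def E2_def
      by (subst L2_inner_continuous[OF G]) (rule val, assumption, rule val, assumption,
          unfold sum_subtractf[symmetric], intro sum.cong refl)
  qed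
  also have "\<dots> \<le> (\<Sum>i<nx M. \<Sum>j<ny M.
      ?C * ?ex i j
      + ?C * ?ey i j)"
  proof (intro sum_mono add_mono)
    fix i j assume "i \<in> {..<nx M}" "j \<in> {..<ny M}"
    then have ij: "i < nx M" "j < ny M" by simp_all
    show "E1 (v (Lower i j) $ 1) (v (Upper i j) $ 1) i j
        \<le> ?C * ?ex i j"
      unfolding vals(1)[OF ij] vals(2)[OF ij] by (rule order_trans[OF abs_ge_self E1_bound[OF ij]])
    show "E2 (v (Lower i j) $ 2) (v (Upper i j) $ 2) i j
        \<le> ?C * ?ey i j"
      unfolding vals(3)[OF ij] vals(4)[OF ij] by (rule order_trans[OF abs_ge_self E2_bound[OF ij]])
  qed
  also have "\<dots> = ?C *
      ((\<Sum>i<nx M. \<Sum>j<ny M. ?ex i j)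
       + (\<Sum>j<ny M. \<Sum>i<nx M. ?ey i j))"
    unfolding sum.swap[of "\<lambda>j i. ?ey i j" "{..<nx M}" "{..<ny M}"]
    by (simp only: sum.distrib sum_distrib_left distrib_left)
  also have "\<dots> \<le> ?C *
      ((2 * (b - a) + 1) * sqrt (C2 * ((b - a) * (d - c))) * h\<^sup>2 * N
       + (2 * (d - c) + 1) * sqrt (1 / C1 * ((d - c) * (b - a))) * h\<^sup>2 * N)"
  proof (intro mult_left_mono[OF _ K0] add_mono)
    have ratio: "hy M j \<le> C2 * hx M i" "hx M i \<le> 1 / C1 * hy M j" if "i < nx M" "j < ny M" for i j
      using regular that hx_pos[of i] hy_pos[of j] C1_pos
      by (auto simp: mesh_regular_def field_simps)
    have N0: "0 \<le> N" unfolding N_def by (rule H1h_norm_nonneg)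
    have Nx: "(\<Sum>i<nx M. \<Sum>j<ny M. (vx (Suc i) j - vx i j)\<^sup>2) \<le> N\<^sup>2"
    proof -
      have "(\<Sum>i<nx M. \<Sum>j<ny M. (vx (Suc i) j - vx i j)\<^sup>2)
          = (\<Sum>i<nx M. \<Sum>j<ny M. (v (Upper i j) $ 1 - v (Lower i j) $ 1)\<^sup>2)"
        by (intro sum.cong refl) (simp add: vals(1,2))
      also have "\<dots> \<le> N\<^sup>2" unfolding N_def by (rule H1h_norm_bound)
      finally show ?thesis .
    qed
    have Ny: "(\<Sum>j<ny M. \<Sum>i<nx M. (vy i (Suc j) - vy i j)\<^sup>2) \<le> N\<^sup>2"
    proof -
      have "(\<Sum>j<ny M. \<Sum>i<nx M. (vy i (Suc j) - vy i j)\<^sup>2)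
          = (\<Sum>j<ny M. \<Sum>i<nx M. (v (Upper i j) $ 2 - v (Lower i j) $ 2)\<^sup>2)"
        by (intro sum.cong refl) (simp add: vals(3,4))
      also have "\<dots> = (\<Sum>i<nx M. \<Sum>j<ny M. (v (Upper i j) $ 2 - v (Lower i j) $ 2)\<^sup>2)"
        by (rule sum.swap)
      also have "\<dots> \<le> N\<^sup>2" unfolding N_def by (rule H1h_norm_bound)
      finally show ?thesis .
    qed
    show "(\<Sum>i<nx M. \<Sum>j<ny M. ?ex i j)
        \<le> (2 * (b - a) + 1) * sqrt (C2 * ((b - a) * (d - c))) * h\<^sup>2 * N"
      by (rule discrete_poincare) (simp_all add: hx_pos hy_pos hx_le ratio sum_hx sum_hy vals Nx N0)
    show "(\<Sum>j<ny M. \<Sum>i<nx M. ?ey i j)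
        \<le> (2 * (d - c) + 1) * sqrt (1 / C1 * ((d - c) * (b - a))) * h\<^sup>2 * N"
      by (rule discrete_poincare[where V = "\<lambda>j i. vy i j"])
         (use ratio in \<open>simp_all add: hx_pos hy_pos hy_le sum_hx sum_hy vals Ny N0\<close>)
  qed
  finally show ?thesis by (simp add: N_def algebra_simps)
qed

end

theorem theorem2:
  fixes a b c d C1 C2 :: real
    and \<Omega> :: "(real \<times> real) set"
    and u :: "real \<times> real \<Rightarrow> real^2"
    and \<sigma> :: "real \<times> real \<Rightarrow> real^2^2"
  assumes "a < b" "c < d" "\<Omega> = {a<..<b} \<times> {c<..<d}"
    and "0 < C1" "0 < C2"
    and "\<forall>k. (\<lambda>p. u p $ k) \<in> sobolev_inf 3 \<Omega>"
    and "continuous_on (closure \<Omega>) u"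
    and "\<forall>p\<in>frontier \<Omega>. u p = 0"
    and "\<forall>p\<in>\<Omega>. divergence (closure \<Omega>) u p = 0"
    and "\<sigma> = gradient (closure \<Omega>) u"
  shows "\<exists>C>0. \<forall>M. cartesian_mesh_of \<Omega> M \<and> mesh_regular C1 C2 M \<longrightarrow>
           (\<forall>v\<in>U_h0 M.
              L2_inner \<Omega> (\<lambda>p. gradient (closure \<Omega>) u p *v u p) (realize M v)
                - c_h M (interp_Sigma M \<sigma>) (\<lambda>T. interp_U M u T - delta_h M u T) v
              \<le> C * (mesh_size M)\<^sup>2 * H1h_norm M v)"
proof -
  have \<Omega>: "\<Omega> = {a<..<b} \<times> {c<..<d}" by fact
  have closure: "closure \<Omega> = {a..b} \<times> {c..d}" using assms(1,2) by (simp add: \<Omega> closure_Times)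
  have cont: "continuous_on ({a..b} \<times> {c..d}) (\<lambda>p. u p $ k)" for k
    using assms(7) unfolding closure by (rule continuous_on_component)
  have sob: "(\<lambda>p. u p $ k) \<in> sobolev_inf 3 ({a<..<b} \<times> {c<..<d})" for k
    using assms(6) unfolding \<Omega> by blast
  obtain K1 D1 where 1: "jet K1 a b c d D1" "\<forall>x\<in>{a..b}. \<forall>y\<in>{c..d}. D1 0 0 x y = u (x, y) $ 1"
    using sobolev_inf_jet[OF assms(1,2) sob[of 1] cont[of 1]] by blast
  obtain K2 D2 where 2: "jet K2 a b c d D2" "\<forall>x\<in>{a..b}. \<forall>y\<in>{c..d}. D2 0 0 x y = u (x, y) $ 2"
    using sobolev_inf_jet[OF assms(1,2) sob[of 2] cont[of 2]] by blast
  define K where "K = max K1 K2"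
  define C where "C = consistency_const K ((b - a) + (d - c)) *
      ((2 * (b - a) + 1) * sqrt (C2 * ((b - a) * (d - c)))
        + (2 * (d - c) + 1) * sqrt (1 / C1 * ((d - c) * (b - a))))"
  have "L2_inner \<Omega> (\<lambda>p. gradient (closure \<Omega>) u p *v u p) (realize M v)
          - c_h M (interp_Sigma M \<sigma>) (\<lambda>T. interp_U M u T - delta_h M u T) v
        \<le> (\<bar>C\<bar> + 1) * (mesh_size M)\<^sup>2 * H1h_norm M v"
    if M: "cartesian_mesh_of \<Omega> M" "mesh_regular C1 C2 M" and v: "v \<in> U_h0 M" for M v
  proof -
    interpret consistency_setting a b c d M K C1 C2 D1 D2 u
    proof unfold_locales
      show "jet K a b c d D1" by (rule jet_mono[OF 1(1)]) (simp add: K_def)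
      show "jet K a b c d D2" by (rule jet_mono[OF 2(1)]) (simp add: K_def)
    qed (use assms(1,2,4) M 1(2) 2(2) in \<open>simp_all add: \<Omega>\<close>)
    have "L2_inner \<Omega> (\<lambda>p. gradient (closure \<Omega>) u p *v u p) (realize M v)
          - c_h M (interp_Sigma M \<sigma>) (\<lambda>T. interp_U M u T - delta_h M u T) v
        \<le> C * (mesh_size M)\<^sup>2 * H1h_norm M v"
      unfolding assms(10) closure unfolding \<Omega> C_def by (rule consistency[OF v])
    also have "\<dots> \<le> (\<bar>C\<bar> + 1) * (mesh_size M)\<^sup>2 * H1h_norm M v"
      by (intro mult_right_mono H1h_norm_nonneg) simp_all
    finally show ?thesis .
  qed
  then show ?thesis by (intro exI[of _ "\<bar>C\<bar> + 1"]) auto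
qed

end
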